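(* Let $0<\theta<1$ and for every $N$ let $A=A(N)$ be a random Hermitian matrix of size $N$ with eigenvalues $\lambda_1(A)\le\dots\le\lambda_N(A)$. Assume that for every finite $r\in\mathbb{N}$ one has $$\lim_{N\to\infty}\frac{1}{N^{\theta}}\log\mathbb{E}\left[HC(x_1,\dots,x_r,0^{N-r};\lambda_1(A),\dots,\lambda_N(A))\right]=\sum_{i=1}^r\Psi(x_i),$$ where $\Psi$ is a smooth function in a complex neighborhood of $0$ and the convergence is uniform in a complex neighborhood of $0^r$. Then, for every $k\in\mathbb{N}$, the $k$-th moment of the random measure $N^{-\theta}\sum_{i=1}^N\delta\left(N^{-1}\lambda_i(A)\right)$, that is, the random variable $N^{-\theta}\sum_{i=1}^N\left(N^{-1}\lambda_i(A)\right)^k$, converges in probability to $\dfrac{\Psi^{(k)}(0)}{(k-1)!}$ as $N\to\infty$.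
   Context: $\mathbb{N}=\{1,2,\dots\}$; $0^m$ denotes $m$ zeros $(0,\dots,0)$; $\delta(a)$ is the Dirac mass at $a$. For $x_1,\dots,x_N\in\mathbb{C}$ and $\lambda_1,\dots,\lambda_N\in\mathbb{R}$ the Harish-Chandra integral is $$HC(x_1,\dots,x_N;\lambda_1,\dots,\lambda_N)=\int_{U(N)}\exp\left(\operatorname{Tr}(D_\lambda U D_x U^* )\right)\mathbf{m}_N(dU),$$ where $D_\lambda=\operatorname{diag}(\lambda_1,\dots,\lambda_N)$, $D_x=\operatorname{diag}(x_1,\dots,x_N)$ and $\mathbf{m}_N$ is the Haar probability measure on the unitary group $U(N)$. The expectation $\mathbb{E}$ is over the random eigenvalues of $A$. The hypothesis implicitly includes that the expectations are finite and that the logarithm (the branch equal to $0$ at $x=0$) is well defined near the origin. "Smooth in a complex neighborhood" means complex differentiable (holomorphic). *)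

theory Defs
  imports
    "HOL-Probability.Probability"
    "HOL-Complex_Analysis.Complex_Analysis"
    "Jordan_Normal_Form.Schur_Decomposition"
begin

definition hermitian_mat :: "nat \<Rightarrow> complex mat \<Rightarrow> bool" where
  "hermitian_mat n A \<longleftrightarrow> A \<in> carrier_mat n n \<and> mat_adjoint A = A"

definition unitary_group :: "nat \<Rightarrow> complex mat set" where
  "unitary_group n = {U \<in> carrier_mat n n. U * mat_adjoint U = 1\<^sub>m n \<and> mat_adjoint U * U = 1\<^sub>m n}"

definition mat_trace :: "complex mat \<Rightarrow> complex" where
  "mat_trace A = (\<Sum>i<dim_row A. A $$ (i, i))"

(* The type of matrices carries no topology.  This is the Borel sigma-algebra of the n x n
   matrices, obtained by identifying a matrix with its family of n^2 entries. *)
definition mat_borel :: "nat \<Rightarrow> complex mat measure" where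
  "mat_borel n = vimage_algebra (carrier_mat n n)
     (\<lambda>A. \<lambda>p\<in>{..<n} \<times> {..<n}. A $$ p) (\<Pi>\<^sub>M p\<in>{..<n} \<times> {..<n}. (borel :: complex measure))"

(* A left-invariant Borel probability measure on U(n); as U(n) is compact there is exactly one,
   and it is also right-invariant. *)
definition is_haar_prob :: "nat \<Rightarrow> complex mat measure \<Rightarrow> bool" where
  "is_haar_prob n m \<longleftrightarrow>
     prob_space m \<and>
     space m = unitary_group n \<and>
     sets m = sets (restrict_space (mat_borel n) (unitary_group n)) \<and>
     (\<forall>V\<in>unitary_group n. distr m m (\<lambda>U. V * U) = m)"

(* Only the values x 0, ..., x (n - 1) and lam 0, ..., lam (n - 1) matter. *)
definition HC :: "complex mat measure \<Rightarrow> nat \<Rightarrow> (nat \<Rightarrow> complex) \<Rightarrow> (nat \<Rightarrow> real) \<Rightarrow> complex" where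
  "HC m n x lam =
     (\<integral>U. exp (mat_trace (mat_diag n (\<lambda>i. complex_of_real (lam i)) * U * mat_diag n x * mat_adjoint U)) \<partial>m)"

(* Eigenvalues of a Hermitian matrix in nondecreasing order, with multiplicity; the roots of the
   characteristic polynomial are then real, so that taking real parts only changes the type. *)
definition herm_eigvals :: "complex mat \<Rightarrow> real list" where
  "herm_eigvals A = sorted_list_of_multiset (image_mset Re (proots (char_poly A)))"

(* A point of C^r is encoded as the sequence that continues it by zeros; on such sequences the
   product topology is the topology of C^r. *)
definition polydisc :: "nat \<Rightarrow> real \<Rightarrow> (nat \<Rightarrow> complex) set" where
  "polydisc r \<epsilon> = {x. (\<forall>i<r. norm (x i) < \<epsilon>) \<and> (\<forall>i\<ge>r. x i = 0)}"

(* Determines L uniquely when S is connected and contains the origin. *)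
definition is_log_branch :: "(nat \<Rightarrow> complex) set \<Rightarrow> ((nat \<Rightarrow> complex) \<Rightarrow> complex)
    \<Rightarrow> ((nat \<Rightarrow> complex) \<Rightarrow> complex) \<Rightarrow> bool" where
  "is_log_branch S f L \<longleftrightarrow>
     continuous_on S L \<and> L (\<lambda>_. 0) = 0 \<and> (\<forall>x\<in>S. exp (L x) = f x)"

(* Convergence to a constant; the n-th variable may live on its own probability space. *)
definition converges_in_prob :: "(nat \<Rightarrow> 'a measure) \<Rightarrow> (nat \<Rightarrow> 'a \<Rightarrow> 'b::metric_space) \<Rightarrow> 'b \<Rightarrow> bool" where
  "converges_in_prob M X c \<longleftrightarrow>
     (\<forall>\<epsilon>>0. (\<lambda>n. measure (M n) {\<omega> \<in> space (M n). dist (X n \<omega>) c > \<epsilon>}) \<longlonglongrightarrow> 0)"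

end

theory Submission
  imports Defs
begin

text \<open>Write \<open>B = U* diag(\<lambda>) U\<close> for a Haar unitary \<open>U\<close>, so that the Harish-Chandra integral is the Haar average of
\<open>exp (\<Sum>a. x a * B a a)\<close>. The idea is to insert the diagonal entry \<open>(B^k) i i\<close> into this average.
Since \<open>(B^(k+1)) i i = (\<Sum>j. (B^k) j i * B i j)\<close>, two facts turn the averages for \<open>k\<close> into those for
\<open>k + 1\<close>: the term \<open>j = i\<close> is a derivative in \<open>x i\<close>, and for \<open>j \<noteq> i\<close> invariance of the Haar measure
under rotations of columns \<open>i\<close> and \<open>j\<close> gives a Ward identity (\<open>ward_identity\<close>), by which the average of
\<open>(B^k) j i * B i j\<close> is the divided difference, with denominator \<open>x i - x j\<close>, of the averages of
\<open>(B^k) i i\<close> and \<open>(B^k) j j\<close>. These are the Dunkl operators at work on the Harish-Chandra integral.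

Now take expectations over the eigenvalues as well and divide by \<open>N powr (k - 1 + \<theta>)\<close> times the mean
Harish-Chandra integral. Only finitely many \<open>x j\<close> are nonzero, hence all but boundedly many of the \<open>N\<close>
divided differences have \<open>x j = 0\<close> and are equal; they survive in the limit, whereas the derivative
term has the relative order \<open>N powr (\<theta> - 1)\<close> and vanishes because \<open>\<theta> < 1\<close>. So in the limit each step is
\<open>g \<mapsto> (\<lambda>z. (g z - g 0) / z)\<close>, a shift of the Taylor coefficients, and it starts from \<open>deriv \<Psi>\<close>, the limit of
the logarithmic derivative (\<open>diag_limit_0\<close>, \<open>diag_limit_Suc\<close>). All functions are holomorphic in each
variable, so Cauchy estimates and the maximum principle carry uniform bounds through derivatives and
divided differences, on smaller polydiscs. Summing over \<open>i\<close> gives the trace of \<open>B^k\<close>, that is, the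
\<open>k\<close>-th power sum of the eigenvalues, whose normalised mean tends to the Taylor coefficient of index \<open>k - 1\<close> of
\<open>deriv \<Psi>\<close> at \<open>0\<close>.

The same argument works with an extra random weight, provided that inserting the weight multiplies the mean
Harish-Chandra integral by a factor that tends to a constant, uniformly near the origin
(\<open>weight_limit_power_sum\<close>). In the limit the normalised power sum is such a weight, since the
factor that it produces is the Taylor shift evaluated at a variable that is \<open>0\<close>. Using it a second time
gives the second moment, which turns out to be the square of the first, and Chebyshev's inequality
finishes the proof.

Measurability in the random parameter is transported along the same recursion: derivatives and divided
differences are limits of combinations of Harish-Chandra integrals, and those are integrable by hypothesis.\<close>

section \<open>Holomorphic functions of one variable\<close>

lemma norm_deriv_le_ball:
  fixes f :: "complex \<Rightarrow> complex"
  assumes hol: "f holomorphic_on ball 0 e" and bd: "\<And>w. norm w < e \<Longrightarrow> norm (f w) \<le> C"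
    and z: "norm z < e / 2"
  shows "norm (deriv f z) \<le> 4 * C / e"
proof -
  have e: "e > 0" using z norm_ge_zero[of z] by linarith
  have sub: "cball z (e/4) \<subseteq> ball 0 e"
  proof
    fix w assume "w \<in> cball z (e/4)"
    then have "norm (w - z) \<le> e/4" by (simp add: dist_norm norm_minus_commute)
    then have "norm w \<le> norm z + e/4" using norm_triangle_sub[of w z] by linarith
    then show "w \<in> ball 0 e" using z e by simp
  qed
  have "norm ((deriv ^^ 1) f z) \<le> fact 1 * C / (e/4) ^ 1"
  proof (rule Cauchy_inequality)
    show "f holomorphic_on ball z (e/4)"
      by (rule holomorphic_on_subset[OF hol]) (use sub ball_subset_cball in blast)
    show "continuous_on (cball z (e/4)) f"
      by (rule continuous_on_subset[OF holomorphic_on_imp_continuous_on[OF hol] sub])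
    fix x assume "norm (z - x) = e/4"
    then have "x \<in> cball z (e/4)" by (simp add: dist_norm)
    then show "norm (f x) \<le> C" using sub bd by auto
  qed (use e in auto)
  then show ?thesis by (simp add: mult.commute)
qed

text \<open>On the circle of radius \<open>3 * e / 4\<close> the factor \<open>z - a\<close> is at least \<open>e / 4\<close> in modulus, so the bound holds there,
and the maximum principle carries it inside, across the point \<open>a\<close> where the quotient says nothing.\<close>
lemma norm_quotient_le_ball:
  fixes q :: "complex \<Rightarrow> complex"
  assumes hol: "q holomorphic_on ball 0 e"
    and bd: "\<And>w. norm w < e \<Longrightarrow> norm ((w - a) * q w) \<le> C"
    and a: "norm a < e / 2" and z: "norm z < e / 2"
  shows "norm (q z) \<le> 4 * C / e"
proof -
  have e: "e > 0" using z norm_ge_zero[of z] by linarith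
  have sub: "cball 0 (3*e/4) \<subseteq> ball (0::complex) e" using e by auto
  show ?thesis
  proof (rule maximum_modulus_frontier[of q "cball 0 (3*e/4)"])
    show "q holomorphic_on interior (cball 0 (3*e/4))"
      by (rule holomorphic_on_subset[OF hol]) (use sub interior_subset in blast)
    show "continuous_on (closure (cball 0 (3*e/4))) q"
      using continuous_on_subset[OF holomorphic_on_imp_continuous_on[OF hol] sub] by simp
    show "z \<in> cball 0 (3*e/4)" using z e by simp
    fix w :: complex assume "w \<in> frontier (cball 0 (3*e/4))"
    then have w: "norm w = 3*e/4" using e by (simp add: frontier_cball)
    have "norm w - norm a \<le> norm (w - a)" by (rule norm_triangle_ineq2)
    then have "e/4 \<le> norm (w - a)" using w a by linarith
    then have "e/4 * norm (q w) \<le> norm (w - a) * norm (q w)" by (intro mult_right_mono) auto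
    also have "\<dots> \<le> C" using bd[of w] w e by (simp add: norm_mult)
    finally show "norm (q w) \<le> 4 * C / e" using e by (simp add: field_simps)
  qed auto
qed

lemma punctured_sequence:
  fixes z :: complex
  assumes d: "0 < d"
  obtains X where "\<And>n. X n \<noteq> z" "\<And>n. X n \<in> ball z d" "X \<longlonglongrightarrow> z"
proof (rule that)
  let ?X = "\<lambda>n. z + complex_of_real (d / real (n + 2))"
  have "0 < d / real (n + 2)" "d / real (n + 2) < d" for n
    using d by (auto simp: field_simps intro: add_pos_nonneg)
  then show "?X n \<noteq> z" "?X n \<in> ball z d" for n
    using d by (auto simp add: dist_norm simp del: of_real_divide)
  have "(\<lambda>n. d / real (n + 2)) \<longlonglongrightarrow> 0" by real_asymp
  then have "(\<lambda>n. complex_of_real (d / real (n + 2))) \<longlonglongrightarrow> of_real 0" by (rule tendsto_of_real)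
  from tendsto_add[OF tendsto_const[of z] this] show "?X \<longlonglongrightarrow> z" by simp
qed

text \<open>Cauchy's inequality bounds the derivative, and hence all difference quotients near \<open>z\<close>, by a multiple
of the same integrable function \<open>D\<close>; dominated convergence along sequences then differentiates under the integral.\<close>
lemma holomorphic_integral_dominated:
  fixes g :: "'a \<Rightarrow> complex \<Rightarrow> complex"
  assumes hol: "\<And>\<omega>. \<omega> \<in> space M \<Longrightarrow> g \<omega> holomorphic_on ball a r"
    and meas: "\<And>z. z \<in> ball a r \<Longrightarrow> (\<lambda>\<omega>. g \<omega> z) \<in> borel_measurable M"
    and bd: "\<And>\<omega> z. \<omega> \<in> space M \<Longrightarrow> z \<in> ball a r \<Longrightarrow> norm (g \<omega> z) \<le> D \<omega>"
    and D: "integrable M D" and z: "z \<in> ball a r"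
  shows "((\<lambda>z. \<integral>\<omega>. g \<omega> z \<partial>M) has_field_derivative (\<integral>\<omega>. deriv (g \<omega>) z \<partial>M)) (at z)"
    and "(\<lambda>\<omega>. deriv (g \<omega>) z) \<in> borel_measurable M"
proof -
  have int: "integrable M (\<lambda>\<omega>. g \<omega> w)" if "w \<in> ball a r" for w
    by (rule Bochner_Integration.integrable_bound[OF D meas[OF that]])
       (use bd that in \<open>auto intro!: AE_I2 order_trans[OF bd abs_ge_self]\<close>)
  \<comment> \<open>radius 2 * d, so that Cauchy's inequality applies with radius d about each point of ball z d\<close>
  obtain d where d: "d > 0" "cball z (2*d) \<subseteq> ball a r"
  proof -
    obtain e where e: "e > 0" "cball z e \<subseteq> ball a r"
      using z open_contains_cball[of "ball a r"] open_ball by blast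
    show ?thesis by (rule that[of "e/2"]) (use e in auto)
  qed
  have der: "norm (deriv (g \<omega>) w) \<le> D \<omega> / d" if "\<omega> \<in> space M" "w \<in> ball z d" for \<omega> w
  proof -
    have sub: "cball w d \<subseteq> ball a r"
    proof
      fix v assume "v \<in> cball w d"
      then have "dist z v \<le> 2*d"
        using that(2) dist_triangle[of z v w] by auto
      then show "v \<in> ball a r" using d by auto
    qed
    have "norm ((deriv ^^ 1) (g \<omega>) w) \<le> fact 1 * D \<omega> / d ^ 1"
    proof (rule Cauchy_inequality)
      show "g \<omega> holomorphic_on ball w d"
        by (rule holomorphic_on_subset[OF hol]) (use sub that ball_subset_cball in auto)
      show "continuous_on (cball w d) (g \<omega>)"
        by (rule continuous_on_subset[OF holomorphic_on_imp_continuous_on[OF hol] sub]) (use that in auto)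
      fix x assume "norm (w - x) = d"
      then have "x \<in> cball w d" by (simp add: dist_norm)
      then show "norm (g \<omega> x) \<le> D \<omega>" using sub bd that by blast
    qed (use d in auto)
    then show ?thesis by simp
  qed
  have sub': "ball z d \<subseteq> ball a r"
    using d ball_subset_cball[of z "2*d"] subset_ball[of d "2*d" z] by (auto simp: subset_eq)
  have fd: "(g \<omega> has_field_derivative deriv (g \<omega>) w) (at w)" if "\<omega> \<in> space M" "w \<in> ball z d" for \<omega> w
    using hol[OF that(1)] that(2) sub' holomorphic_derivI open_ball by blast
  have lip: "norm ((g \<omega> w - g \<omega> z) / (w - z)) \<le> D \<omega> / d" if "\<omega> \<in> space M" "w \<in> ball z d" for \<omega> w
  proof -
    have "norm (g \<omega> w - g \<omega> z) \<le> D \<omega> / d * norm (w - z)"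
      by (rule field_differentiable_bound[of "ball z d" "g \<omega>" "deriv (g \<omega>)"])
         (use that d der fd in \<open>auto intro: has_field_derivative_at_within\<close>)
    moreover have "0 \<le> D \<omega> / d"
      using der[OF that(1), of z] d norm_ge_zero order_trans centre_in_ball by blast
    ultimately show ?thesis
      by (cases "w = z") (auto simp: norm_divide divide_simps)
  qed
  have pt: "(\<lambda>n. (g \<omega> (X n) - g \<omega> z) / (X n - z)) \<longlonglongrightarrow> deriv (g \<omega>) z"
    if "\<omega> \<in> space M" "\<And>n. X n \<noteq> z" "X \<longlonglongrightarrow> z" for \<omega> X
  proof -
    have "((\<lambda>w. (g \<omega> w - g \<omega> z) / (w - z)) \<longlongrightarrow> deriv (g \<omega>) z) (at z)"
      using fd[OF that(1), of z] d by (simp add: has_field_derivative_iff)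
    moreover have "filterlim X (at z) sequentially"
      using that by (simp add: filterlim_at)
    ultimately show ?thesis by (rule filterlim_compose)
  qed
  have main: "deriv_meas \<in> borel_measurable M \<and>
     (\<lambda>n. ((\<integral>\<omega>. g \<omega> (X n) \<partial>M) - (\<integral>\<omega>. g \<omega> z \<partial>M)) / (X n - z)) \<longlonglongrightarrow> (\<integral>\<omega>. deriv (g \<omega>) z \<partial>M)"
    if X: "\<And>n. X n \<noteq> z" "X \<longlonglongrightarrow> z" "\<And>n. X n \<in> ball z d"
      and dm: "deriv_meas = (\<lambda>\<omega>. deriv (g \<omega>) z)" for X deriv_meas
  proof -
    have m: "(\<lambda>\<omega>. (g \<omega> (X n) - g \<omega> z) / (X n - z)) \<in> borel_measurable M" for n
      using meas[of "X n"] meas[OF z] X(3)[of n] sub' by (intro borel_measurable_divide borel_measurable_diff) auto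
    have dmm: "deriv_meas \<in> borel_measurable M"
      unfolding dm by (rule borel_measurable_LIMSEQ_metric[OF m pt[OF _ X(1,2)]])
    have lim: "(\<lambda>n. \<integral>\<omega>. (g \<omega> (X n) - g \<omega> z) / (X n - z) \<partial>M) \<longlonglongrightarrow> (\<integral>\<omega>. deriv (g \<omega>) z \<partial>M)"
      by (rule integral_dominated_convergence[where w="\<lambda>\<omega>. D \<omega> / d"])
         (use dmm dm m pt[OF _ X(1,2)] lip X(3) D in \<open>auto intro!: AE_I2\<close>)
    have eq: "(\<integral>\<omega>. (g \<omega> (X n) - g \<omega> z) / (X n - z) \<partial>M) =
       ((\<integral>\<omega>. g \<omega> (X n) \<partial>M) - (\<integral>\<omega>. g \<omega> z \<partial>M)) / (X n - z)" for n
    proof -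
      have "X n \<in> ball a r" using X(3) sub' by blast
      then show ?thesis using int[OF z] int[of "X n"] by simp
    qed
    show ?thesis by (rule conjI[OF dmm lim[unfolded eq]])
  qed
  obtain X0 where X0: "\<And>n. X0 n \<noteq> z" "\<And>n. X0 n \<in> ball z d" and X0l: "X0 \<longlonglongrightarrow> z"
    using punctured_sequence[OF d(1), of z] by blast
  show "(\<lambda>\<omega>. deriv (g \<omega>) z) \<in> borel_measurable M"
    using main[OF X0(1) X0l X0(2) refl] by blast
  show "((\<lambda>z. \<integral>\<omega>. g \<omega> z \<partial>M) has_field_derivative (\<integral>\<omega>. deriv (g \<omega>) z \<partial>M)) (at z)"
    unfolding has_field_derivative_iff tendsto_at_iff_sequentially
  proof (intro allI impI)
    fix X :: "nat \<Rightarrow> complex" assume X: "\<forall>i. X i \<in> UNIV - {z}" "X \<longlonglongrightarrow> z"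
    have ev: "\<forall>\<^sub>F n in sequentially. X n \<in> ball z d"
      using X(2) d(1) by (auto simp: tendsto_iff dist_commute)
    define Y where "Y = (\<lambda>n. if X n \<in> ball z d then X n else X0 n)"
    have ev': "\<forall>\<^sub>F n in sequentially. Y n = X n" using ev by eventually_elim (simp add: Y_def)
    have Y: "Y \<longlonglongrightarrow> z" using X(2) ev' by (simp add: filterlim_cong[OF refl refl ev'])
    have Y2: "\<And>n. Y n \<noteq> z" "\<And>n. Y n \<in> ball z d" using X X0 by (auto simp: Y_def)
    have "(\<lambda>n. ((\<integral>\<omega>. g \<omega> (Y n) \<partial>M) - (\<integral>\<omega>. g \<omega> z \<partial>M)) / (Y n - z)) \<longlonglongrightarrow> (\<integral>\<omega>. deriv (g \<omega>) z \<partial>M)"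
      using main[OF Y2(1) Y Y2(2) refl] by blast
    moreover have "\<forall>\<^sub>F n in sequentially. ((\<integral>\<omega>. g \<omega> (Y n) \<partial>M) - (\<integral>\<omega>. g \<omega> z \<partial>M)) / (Y n - z)
        = (((\<lambda>y. ((\<integral>\<omega>. g \<omega> y \<partial>M) - (\<integral>\<omega>. g \<omega> z \<partial>M)) / (y - z)) \<circ> X)) n"
      using ev' by eventually_elim simp
    ultimately show "((\<lambda>y. ((\<integral>\<omega>. g \<omega> y \<partial>M) - (\<integral>\<omega>. g \<omega> z \<partial>M)) / (y - z)) \<circ> X) \<longlonglongrightarrow> (\<integral>\<omega>. deriv (g \<omega>) z \<partial>M)"
      by (rule Lim_transform_eventually)
  qed
qed

text \<open>Near a given point a continuous logarithm differs from its value there by less than \<open>\<pi>\<close> in imaginary part,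
so it agrees with a translate of the principal branch \<open>Ln\<close>.\<close>
lemma holomorphic_on_continuous_log:
  fixes L :: "complex \<Rightarrow> complex"
  assumes S: "open S" and cont: "continuous_on S L" and hol: "(\<lambda>z. exp (L z)) holomorphic_on S"
  shows "L holomorphic_on S"
proof (rule holomorphic_onI)
  fix z assume z: "z \<in> S"
  have "\<forall>\<^sub>F w in nhds z. dist (L w) (L z) < 1"
    using cont S z by (intro tendstoD) (auto simp: continuous_on_eq_continuous_at isCont_def tendsto_at_iff_tendsto_nhds)
  then obtain V where V: "open V" "z \<in> V" "\<And>w. w \<in> V \<Longrightarrow> dist (L w) (L z) < 1"
    by (auto simp: eventually_nhds)
  define T where "T = V \<inter> S"
  have T: "open T" "z \<in> T" using V S z by (auto simp: T_def)
  have im: "\<bar>Im (L w - L z)\<bar> < 1" if "w \<in> T" for w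
    using V(3)[of w] that abs_Im_le_cmod[of "L w - L z"] by (auto simp: T_def dist_norm)
  have re: "exp (L w) / exp (L z) \<notin> \<real>\<^sub>\<le>\<^sub>0" if "w \<in> T" for w
  proof -
    have "cos (Im (L w - L z)) > 0"
      using im[OF that] pi_gt3 by (intro cos_gt_zero_pi) auto
    then have "Re (exp (L w - L z)) > 0" by (simp add: Re_exp)
    then show ?thesis by (auto simp: exp_diff complex_nonpos_Reals_iff)
  qed
  have eq: "L w = L z + Ln (exp (L w) / exp (L z))" if "w \<in> T" for w
  proof -
    have "Ln (exp (L w - L z)) = L w - L z"
      using im[OF that] pi_gt3 by (intro Ln_exp) auto
    then show ?thesis by (simp add: exp_diff)
  qed
  have "(\<lambda>w. L z + Ln (exp (L w) / exp (L z))) holomorphic_on T"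
    using re by (intro holomorphic_intros holomorphic_on_subset[OF hol]) (auto simp: T_def)
  then have "L holomorphic_on T" using eq by (simp cong: holomorphic_cong)
  then have "L field_differentiable at z"
    using T holomorphic_on_imp_differentiable_at by blast
  then show "L field_differentiable at z within S" by (rule field_differentiable_at_within)
qed

text \<open>\<open>taylor_shift f k\<close> drops the first \<open>k\<close> Taylor coefficients of \<open>f\<close> at \<open>0\<close> and divides by \<open>z ^ k\<close>. The recursion by
divided differences at \<open>0\<close> is the form in which it arises from the Ward identity.\<close>
fun taylor_shift :: "(complex \<Rightarrow> complex) \<Rightarrow> nat \<Rightarrow> complex \<Rightarrow> complex" where
  "taylor_shift f 0 = f"
| "taylor_shift f (Suc k) = (\<lambda>z. if z = 0 then deriv (taylor_shift f k) 0
      else (taylor_shift f k z - taylor_shift f k 0) / z)"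

lemma taylor_shift_holomorphic:
  assumes "open S" "f holomorphic_on S" shows "taylor_shift f k holomorphic_on S"
proof (induction k)
  case (Suc k)
  show ?case using pole_lemma_open[OF Suc assms(1), of 0] by (simp add: if_distrib cong: if_cong)
qed (use assms in auto)

lemma taylor_shift_mult:
  "z * taylor_shift f (Suc k) z = taylor_shift f k z - taylor_shift f k 0"
  by simp

lemma taylor_shift_at_0:
  assumes S: "open S" "0 \<in> S" and hol: "f holomorphic_on S"
  shows "taylor_shift f k 0 = (deriv ^^ k) f 0 / fact k"
proof -
  have "f analytic_on {0}" using S hol analytic_at by blast
  then obtain F where F0: "f has_fps_expansion F" by (auto dest: analytic_at_imp_has_fps_expansion_0)
  have F: "taylor_shift f k has_fps_expansion fps_shift k F" for k
  proof (induction k)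
    case (Suc k)
    define G where "G = fps_shift k F"
    define h where "h = taylor_shift f k"
    have h: "h has_fps_expansion G" using Suc by (simp add: h_def G_def)
    have h0: "h 0 = fps_nth G 0" "deriv h 0 = fps_nth G 1"
      using fps_nth_fps_expansion[OF h, of 0] fps_nth_fps_expansion[OF h, of 1] by auto
    have "(\<lambda>x. h x - h 0) has_fps_expansion (G - fps_const (h 0))"
      by (intro fps_expansion_intros h)
    moreover have "1 \<le> subdegree (G - fps_const (h 0))" if "G - fps_const (h 0) \<noteq> 0"
      using that by (intro subdegree_geI) (auto simp: h0)
    ultimately have *: "(\<lambda>x. if x = 0 then fps_nth (G - fps_const (h 0)) 1 else (h x - h 0) / x ^ 1)
        has_fps_expansion fps_shift 1 (G - fps_const (h 0))" if "G - fps_const (h 0) \<noteq> 0"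
      using that by (intro has_fps_expansion_shift) auto
    have s: "fps_shift 1 (G - fps_const (h 0)) = fps_shift (Suc k) F"
      by (auto simp: fps_eq_iff G_def)
    \<comment> \<open>the zero series is separate because its subdegree is 0 by convention, while the shift rule asks for at least 1\<close>
    show ?case
    proof (cases "G - fps_const (h 0) = 0")
      case False
      have c: "fps_nth (G - fps_const (h 0)) 1 = deriv h 0" by (simp add: h0(2))
      show ?thesis using *[OF False, unfolded s c] by (simp only: h_def power_one_right taylor_shift.simps)
    next
      case True
      have z: "fps_shift (Suc k) F = 0" unfolding s[symmetric] True by simp
      have "\<forall>\<^sub>F x in nhds 0. h x - h 0 = 0"
        using \<open>(\<lambda>x. h x - h 0) has_fps_expansion (G - fps_const (h 0))\<close> unfolding True
        by (auto simp: has_fps_expansion_def)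
      moreover have "deriv h 0 = 0"
      proof -
        have "fps_nth G 1 = fps_nth (fps_const (h 0)) 1" using True by simp
        then show ?thesis using h0(2) by simp
      qed
      ultimately show ?thesis unfolding z has_fps_expansion_0_iff
        by (auto simp: h_def elim!: eventually_mono)
    qed
  qed (use F0 in simp)
  have "taylor_shift f k 0 = fps_nth (fps_shift k F) 0"
    using fps_nth_fps_expansion[OF F[of k], of 0] by simp
  also have "\<dots> = (deriv ^^ k) f 0 / fact k" using fps_nth_fps_expansion[OF F0, of k] by simp
  finally show ?thesis .
qed

section \<open>Unitary matrices and the entries of U* D U\<close>

lemma mat_adjoint_carrier: "A \<in> carrier_mat n n \<Longrightarrow> mat_adjoint A \<in> carrier_mat n n"
  for A :: "complex mat"
  by (auto simp: mat_adjoint_def)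

lemma mat_adjoint_index:
  fixes A :: "complex mat"
  assumes "A \<in> carrier_mat n n" "a < n" "b < n"
  shows "mat_adjoint A $$ (a, b) = cnj (A $$ (b, a))"
  using assms by (auto simp: mat_adjoint_def mat_of_rows_index)

lemma mat_adjoint_adjoint: "A \<in> carrier_mat n n \<Longrightarrow> mat_adjoint (mat_adjoint A) = A"
  for A :: "complex mat"
  by (intro eq_matI) (auto simp: mat_adjoint_index[where n=n] mat_adjoint_carrier dest: mat_adjoint_carrier)

lemma mult_index:
  fixes A B :: "complex mat"
  assumes "A \<in> carrier_mat n n" "B \<in> carrier_mat n n" "a < n" "b < n"
  shows "(A * B) $$ (a, b) = (\<Sum>l<n. A $$ (a, l) * B $$ (l, b))"
  using assms by (auto simp: scalar_prod_def atLeast0LessThan intro!: sum.cong)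

lemma mat_adjoint_mult:
  fixes A B :: "complex mat"
  assumes A: "A \<in> carrier_mat n n" and B: "B \<in> carrier_mat n n"
  shows "mat_adjoint (A * B) = mat_adjoint B * mat_adjoint A"
proof (rule eq_matI)
  note c = mat_adjoint_carrier[OF A] mat_adjoint_carrier[OF B] mult_carrier_mat[OF A B]
  fix a b assume "a < dim_row (mat_adjoint B * mat_adjoint A)" "b < dim_col (mat_adjoint B * mat_adjoint A)"
  then have ab: "a < n" "b < n" using c by auto
  show "mat_adjoint (A * B) $$ (a, b) = (mat_adjoint B * mat_adjoint A) $$ (a, b)"
    unfolding mat_adjoint_index[OF c(3) ab] mult_index[OF A B ab(2,1)] mult_index[OF c(2,1) ab] cnj_sum
    by (intro sum.cong) (use A B ab in \<open>auto simp: mat_adjoint_index[where n=n] mult.commute\<close>)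
qed (use A B mat_adjoint_carrier[OF A] mat_adjoint_carrier[OF B] mat_adjoint_carrier[OF mult_carrier_mat[OF A B]] in auto)

lemma unitary_group_carrier: "U \<in> unitary_group n \<Longrightarrow> U \<in> carrier_mat n n"
  by (simp add: unitary_group_def)

lemma unitary_group_adjoint: "U \<in> unitary_group n \<Longrightarrow> mat_adjoint U \<in> unitary_group n"
  by (auto simp: unitary_group_def mat_adjoint_carrier mat_adjoint_adjoint)

lemma unitary_group_mult:
  assumes "U \<in> unitary_group n" "V \<in> unitary_group n"
  shows "U * V \<in> unitary_group n"
proof -
  have U: "U \<in> carrier_mat n n" "U * mat_adjoint U = 1\<^sub>m n" "mat_adjoint U * U = 1\<^sub>m n"
    and V: "V \<in> carrier_mat n n" "V * mat_adjoint V = 1\<^sub>m n" "mat_adjoint V * V = 1\<^sub>m n"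
    using assms by (auto simp: unitary_group_def)
  note c = mat_adjoint_carrier[OF U(1)] mat_adjoint_carrier[OF V(1)]
  have "(U * V) * (mat_adjoint V * mat_adjoint U) = U * ((V * mat_adjoint V) * mat_adjoint U)"
    using U(1) V(1) c by (simp add: assoc_mult_mat[of _ n n _ n _ n])
  then have 1: "(U * V) * (mat_adjoint V * mat_adjoint U) = 1\<^sub>m n" using U V c by simp
  have "(mat_adjoint V * mat_adjoint U) * (U * V) = mat_adjoint V * ((mat_adjoint U * U) * V)"
    using U(1) V(1) c by (simp add: assoc_mult_mat[of _ n n _ n _ n])
  then have "(mat_adjoint V * mat_adjoint U) * (U * V) = 1\<^sub>m n" using U V c by simp
  with 1 show ?thesis using U(1) V(1) by (simp add: unitary_group_def mat_adjoint_mult)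
qed

lemma unitary_rows:
  assumes U: "U \<in> unitary_group n" and ab: "a < n" "b < n"
  shows "(\<Sum>l<n. U $$ (a, l) * cnj (U $$ (b, l))) = (if a = b then 1 else 0)"
proof -
  have c: "U \<in> carrier_mat n n" using U by (rule unitary_group_carrier)
  have "(U * mat_adjoint U) $$ (a, b) = (1\<^sub>m n :: complex mat) $$ (a, b)" using U by (simp add: unitary_group_def)
  then show ?thesis unfolding mult_index[OF c mat_adjoint_carrier[OF c] ab]
    using ab c by (simp add: mat_adjoint_index[where n=n])
qed

lemma unitary_cols:
  assumes U: "U \<in> unitary_group n" and ab: "a < n" "b < n"
  shows "(\<Sum>l<n. cnj (U $$ (l, a)) * U $$ (l, b)) = (if a = b then 1 else 0)"
proof -
  have c: "U \<in> carrier_mat n n" using U by (rule unitary_group_carrier)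
  have "(mat_adjoint U * U) $$ (a, b) = (1\<^sub>m n :: complex mat) $$ (a, b)" using U by (simp add: unitary_group_def)
  then show ?thesis unfolding mult_index[OF mat_adjoint_carrier[OF c] c ab]
    using ab c by (simp add: mat_adjoint_index[where n=n])
qed

lemma unitary_entry_le_1:
  assumes U: "U \<in> unitary_group n" and ab: "a < n" "b < n"
  shows "norm (U $$ (a, b)) \<le> 1"
proof -
  have "(\<Sum>l<n. (norm (U $$ (a, l)))\<^sup>2) = 1"
  proof -
    have "complex_of_real (\<Sum>l<n. (norm (U $$ (a, l)))\<^sup>2) = (\<Sum>l<n. U $$ (a, l) * cnj (U $$ (a, l)))"
      by (simp only: of_real_sum complex_norm_square)
    also have "\<dots> = complex_of_real 1" using unitary_rows[OF U ab(1) ab(1)] by simp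
    finally show ?thesis by (simp only: of_real_eq_iff)
  qed
  moreover have "(norm (U $$ (a, b)))\<^sup>2 \<le> (\<Sum>l<n. (norm (U $$ (a, l)))\<^sup>2)"
    using ab by (intro member_le_sum) auto
  ultimately show ?thesis by (simp add: abs_square_le_1)
qed

text \<open>The entry at \<open>(a, b)\<close> of \<open>U* diag(lam)^k U\<close>, the \<open>k\<close>-th power of \<open>B = U* diag(lam) U\<close>. Working with this sum
avoids powers of matrices: the multiplication rule and the trace below only use that \<open>U\<close> is unitary.\<close>
definition pow_entry :: "nat \<Rightarrow> (nat \<Rightarrow> real) \<Rightarrow> nat \<Rightarrow> nat \<Rightarrow> nat \<Rightarrow> complex mat \<Rightarrow> complex" where
  "pow_entry n lam k a b U = (\<Sum>l<n. of_real (lam l) ^ k * cnj (U $$ (l, a)) * U $$ (l, b))"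

text \<open>The integrand of the Harish-Chandra integral, see \<open>HC_eq_integral_tilt\<close>.\<close>
definition tilt :: "nat \<Rightarrow> (nat \<Rightarrow> real) \<Rightarrow> (nat \<Rightarrow> complex) \<Rightarrow> complex mat \<Rightarrow> complex" where
  "tilt n lam x U = exp (\<Sum>a<n. x a * pow_entry n lam 1 a a U)"

lemma pow_entry_0:
  "U \<in> unitary_group n \<Longrightarrow> a < n \<Longrightarrow> b < n \<Longrightarrow> pow_entry n lam 0 a b U = (if a = b then 1 else 0)"
  using unitary_cols[of U n a b] by (simp add: pow_entry_def)

lemma pow_entry_mult:
  assumes U: "U \<in> unitary_group n" and ab: "a < n" "b < n"
  shows "(\<Sum>j<n. pow_entry n lam p a j U * pow_entry n lam q j b U) = pow_entry n lam (p + q) a b U"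
proof -
  have "(\<Sum>j<n. pow_entry n lam p a j U * pow_entry n lam q j b U) =
     (\<Sum>j<n. \<Sum>l<n. \<Sum>l'<n. (of_real (lam l) ^ p * of_real (lam l') ^ q * cnj (U $$ (l, a)) * U $$ (l', b)) *
        (U $$ (l, j) * cnj (U $$ (l', j))))"
    unfolding pow_entry_def sum_product by (intro sum.cong refl) (simp add: mult_ac)
  also have "\<dots> = (\<Sum>l<n. \<Sum>l'<n. \<Sum>j<n. (of_real (lam l) ^ p * of_real (lam l') ^ q * cnj (U $$ (l, a)) * U $$ (l', b)) *
        (U $$ (l, j) * cnj (U $$ (l', j))))"
    by (subst sum.swap) (rule sum.cong[OF refl], rule sum.swap)
  also have "\<dots> = (\<Sum>l<n. \<Sum>l'<n. (of_real (lam l) ^ p * of_real (lam l') ^ q * cnj (U $$ (l, a)) * U $$ (l', b)) *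
        (if l = l' then 1 else 0))"
    by (intro sum.cong refl) (simp add: sum_distrib_left[symmetric] unitary_rows[OF U])
  also have "\<dots> = pow_entry n lam (p + q) a b U"
    unfolding pow_entry_def
    by (intro sum.cong refl) (simp add: power_add if_distrib[of "\<lambda>t. _ * t"] cong: if_cong)
  finally show ?thesis .
qed

lemma pow_entry_trace:
  assumes U: "U \<in> unitary_group n"
  shows "(\<Sum>a<n. pow_entry n lam k a a U) = (\<Sum>l<n. of_real (lam l) ^ k)"
proof -
  have "(\<Sum>a<n. pow_entry n lam k a a U) = (\<Sum>l<n. of_real (lam l) ^ k * (\<Sum>a<n. U $$ (l, a) * cnj (U $$ (l, a))))"
    unfolding pow_entry_def by (subst sum.swap) (simp add: sum_distrib_left mult_ac)
  also have "\<dots> = (\<Sum>l<n. of_real (lam l) ^ k)"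
    by (intro sum.cong refl) (simp add: unitary_rows[OF U])
  finally show ?thesis .
qed

lemma cnj_pow_entry: "cnj (pow_entry n lam k a b U) = pow_entry n lam k b a U"
  by (simp add: pow_entry_def mult_ac)

lemma norm_pow_entry_le:
  assumes U: "U \<in> unitary_group n" and ab: "a < n" "b < n"
  shows "norm (pow_entry n lam k a b U) \<le> (\<Sum>l<n. \<bar>lam l\<bar> ^ k)"
  unfolding pow_entry_def
proof (rule sum_norm_le)
  fix l assume "l \<in> {..<n}"
  then have "norm (U $$ (l, a)) \<le> 1" "norm (U $$ (l, b)) \<le> 1" using unitary_entry_le_1[OF U] ab by auto
  then have "norm (U $$ (l, a)) * norm (U $$ (l, b)) \<le> 1" by (intro mult_le_one) auto
  then have "\<bar>lam l\<bar> ^ k * (norm (U $$ (l, a)) * norm (U $$ (l, b))) \<le> \<bar>lam l\<bar> ^ k * 1"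
    by (intro mult_left_mono) auto
  then show "norm (of_real (lam l) ^ k * cnj (U $$ (l, a)) * U $$ (l, b)) \<le> \<bar>lam l\<bar> ^ k"
    by (simp add: norm_mult norm_power mult.assoc)
qed

text \<open>Multiplication by \<open>rot n i j c s\<close> from the right replaces column \<open>i\<close> by \<open>c\<close> times column \<open>i\<close> plus \<open>s\<close> times column \<open>j\<close>,
and column \<open>j\<close> by \<open>c\<close> times column \<open>j\<close> minus \<open>s\<close> times column \<open>i\<close>.\<close>
definition rot :: "nat \<Rightarrow> nat \<Rightarrow> nat \<Rightarrow> real \<Rightarrow> real \<Rightarrow> complex mat" where
  "rot n i j c s = Matrix.mat n n (\<lambda>(b, a).
     if a = i then (if b = i then of_real c else 0) + (if b = j then of_real s else 0)
     else if a = j then (if b = i then - of_real s else 0) + (if b = j then of_real c else 0)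
     else if b = a then 1 else 0)"

lemma rot_carrier: "rot n i j c s \<in> carrier_mat n n"
  by (simp add: rot_def)

lemma mult_rot_index:
  fixes A :: "complex mat"
  assumes A: "A \<in> carrier_mat n n" and ij: "i < n" "j < n" and la: "l < n" "a < n"
  shows "(A * rot n i j c s) $$ (l, a) =
    (if a = i then of_real c * A $$ (l, i) + of_real s * A $$ (l, j)
     else if a = j then of_real c * A $$ (l, j) - of_real s * A $$ (l, i)
     else A $$ (l, a))"
  unfolding mult_index[OF A rot_carrier la] using ij la
  by (simp add: rot_def distrib_left sum.distrib sum.delta if_distrib[of "\<lambda>t. _ * t"] cong: if_cong)

lemma rot_unitary:
  assumes ij: "i < n" "j < n" "i \<noteq> j" and cs: "c\<^sup>2 + s\<^sup>2 = 1"
  shows "rot n i j c s \<in> unitary_group n"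
proof -
  have adj: "mat_adjoint (rot n i j c s) = rot n i j c (- s)"
  proof (rule eq_matI)
    fix a b assume "a < dim_row (rot n i j c (- s))" "b < dim_col (rot n i j c (- s))"
    then have ab: "a < n" "b < n" by (auto simp: rot_def)
    show "mat_adjoint (rot n i j c s) $$ (a, b) = rot n i j c (- s) $$ (a, b)"
      unfolding mat_adjoint_index[OF rot_carrier ab] using ab ij by (auto simp: rot_def)
  qed (use mat_adjoint_carrier[OF rot_carrier[of n i j c s]] in \<open>auto simp: rot_def\<close>)
  have cs': "complex_of_real c * of_real c + of_real s * of_real s = 1"
    using arg_cong[OF cs, of complex_of_real] by (simp add: power2_eq_square)
  have 1: "rot n i j c s * rot n i j c (- s) = 1\<^sub>m n" if "c\<^sup>2 + s\<^sup>2 = 1"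
    "complex_of_real c * of_real c + of_real s * of_real s = 1" for c s
  proof (rule eq_matI)
    fix a b assume "a < dim_row (1\<^sub>m n :: complex mat)" "b < dim_col (1\<^sub>m n :: complex mat)"
    then have ab: "a < n" "b < n" by auto
    show "(rot n i j c s * rot n i j c (- s)) $$ (a, b) = 1\<^sub>m n $$ (a, b)"
      unfolding mult_rot_index[OF rot_carrier ij(1,2) ab]
      using ij ab that(2) by (auto simp: rot_def algebra_simps)
  qed (simp_all add: rot_def)
  have 2: "rot n i j c (- s) * rot n i j c s = 1\<^sub>m n"
    using 1[of c "- s"] cs cs' by simp
  show ?thesis unfolding unitary_group_def using adj 1[OF cs cs'] 2 by (simp add: rot_carrier)
qed

definition phase :: "nat \<Rightarrow> nat \<Rightarrow> complex mat" where
  "phase n i = mat_diag n (\<lambda>a. if a = i then \<i> else 1)"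

lemma phase_carrier: "phase n i \<in> carrier_mat n n"
  by (simp add: phase_def)

lemma mult_phase_index:
  fixes A :: "complex mat"
  assumes A: "A \<in> carrier_mat n n" and la: "l < n" "a < n"
  shows "(A * phase n i) $$ (l, a) = (if a = i then \<i> * A $$ (l, a) else A $$ (l, a))"
  using la by (simp add: phase_def mat_diag_mult_right[OF A])

lemma phase_unitary: "phase n i \<in> unitary_group n"
proof -
  have adj: "mat_adjoint (phase n i) = mat_diag n (\<lambda>a. if a = i then - \<i> else 1)"
  proof (rule eq_matI)
    fix a b assume "a < dim_row (mat_diag n (\<lambda>a. if a = i then - \<i> else 1))"
      "b < dim_col (mat_diag n (\<lambda>a. if a = i then - \<i> else 1))"
    then have ab: "a < n" "b < n" by (auto simp: mat_diag_def)
    show "mat_adjoint (phase n i) $$ (a, b) = mat_diag n (\<lambda>a. if a = i then - \<i> else 1) $$ (a, b)"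
      unfolding mat_adjoint_index[OF phase_carrier ab] using ab by (auto simp: phase_def mat_diag_def)
  qed (use mat_adjoint_carrier[OF phase_carrier[of n i]] in \<open>auto simp: mat_diag_def\<close>)
  have p: "(\<lambda>a. (if a = i then \<i> else 1) * (if a = i then - \<i> else 1)) = (\<lambda>a. 1)"
       "(\<lambda>a. (if a = i then - \<i> else 1) * (if a = i then \<i> else 1)) = (\<lambda>a. 1)" by auto
  have "phase n i * mat_adjoint (phase n i) = 1\<^sub>m n" "mat_adjoint (phase n i) * phase n i = 1\<^sub>m n"
    unfolding adj by (simp_all only: phase_def mat_diag_diag p mat_diag_one)
  then show ?thesis by (simp add: unitary_group_def phase_carrier)
qed

section \<open>Right invariance of the Haar measure\<close>

text \<open>Invariance is assumed on the left, but the rotations act on columns of \<open>U\<close>, hence on the right. The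
passage from one to the other goes through inversion.\<close>
locale haar_unitary =
  fixes n :: nat and m :: "complex mat measure"
  assumes haar: "is_haar_prob n m"
begin

sublocale prob_space m using haar by (simp add: is_haar_prob_def)

lemma space_haar: "space m = unitary_group n"
  using haar by (simp add: is_haar_prob_def)

lemma sets_haar: "sets m = sets (restrict_space (mat_borel n) (unitary_group n))"
  using haar by (simp add: is_haar_prob_def)

lemma measurable_entry [measurable]:
  assumes "a < n" "b < n"
  shows "(\<lambda>U. U $$ (a, b)) \<in> borel_measurable m"
proof -
  let ?f = "\<lambda>A :: complex mat. \<lambda>p\<in>{..<n} \<times> {..<n}. A $$ p"
  let ?P = "\<Pi>\<^sub>M p\<in>{..<n} \<times> {..<n}. (borel :: complex measure)"
  have 1: "?f \<in> measurable (mat_borel n) ?P"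
    unfolding mat_borel_def by (rule measurable_vimage_algebra1) (auto simp: space_PiM)
  have 2: "(\<lambda>w. w (a, b)) \<in> measurable ?P borel"
    using assms by (intro measurable_component_singleton) auto
  have "(\<lambda>A. ?f A (a, b)) \<in> borel_measurable (mat_borel n)"
    using measurable_compose[OF 1 2] by simp
  then have "(\<lambda>A. A $$ (a, b)) \<in> borel_measurable (mat_borel n)"
    using assms by simp
  then have "(\<lambda>A. A $$ (a, b)) \<in> borel_measurable (restrict_space (mat_borel n) (unitary_group n))"
    by (rule measurable_restrict_space1)
  then show ?thesis using measurable_cong_sets[OF sets_haar refl] by blast
qed

lemma measurable_into_haar:
  assumes "\<And>k. k \<in> space K \<Longrightarrow> g k \<in> unitary_group n"
    and "\<And>a b. a < n \<Longrightarrow> b < n \<Longrightarrow> (\<lambda>k. g k $$ (a, b)) \<in> borel_measurable K"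
  shows "g \<in> measurable K m"
proof -
  let ?f = "\<lambda>A :: complex mat. \<lambda>p\<in>{..<n} \<times> {..<n}. A $$ p"
  let ?P = "\<Pi>\<^sub>M p\<in>{..<n} \<times> {..<n}. (borel :: complex measure)"
  have "(\<lambda>k. ?f (g k)) \<in> measurable K ?P"
    by (rule measurable_restrict) (use assms(2) in auto)
  then have "g \<in> measurable K (mat_borel n)"
    unfolding mat_borel_def
    by (intro measurable_vimage_algebra2) (use assms(1) unitary_group_carrier in auto)
  then have "g \<in> measurable K (restrict_space (mat_borel n) (unitary_group n))"
    by (intro measurable_restrict_space2) (use assms(1) in auto)
  then show ?thesis using measurable_cong_sets[OF refl sets_haar] by blast
qed

lemma measurable_adjoint: "mat_adjoint \<in> measurable m m"
proof (rule measurable_into_haar)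
  fix a b assume ab: "a < n" "b < n"
  have "(\<lambda>U. cnj (U $$ (b, a))) \<in> borel_measurable m"
    by (rule measurable_compose[OF measurable_entry borel_measurable_continuous_onI])
       (use ab in \<open>auto intro: continuous_intros\<close>)
  moreover have "mat_adjoint U $$ (a, b) = cnj (U $$ (b, a))" if "U \<in> space m" for U
    using that ab mat_adjoint_index unitary_group_carrier space_haar by metis
  ultimately show "(\<lambda>U. mat_adjoint U $$ (a, b)) \<in> borel_measurable m"
    by (simp cong: measurable_cong)
qed (auto simp: space_haar unitary_group_adjoint)

lemma measurable_mult:
  assumes f: "f \<in> measurable K m" and g: "g \<in> measurable K m"
  shows "(\<lambda>k. f k * g k) \<in> measurable K m"
proof (rule measurable_into_haar)
  have fu: "f k \<in> unitary_group n" "g k \<in> unitary_group n" if "k \<in> space K" for k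
    using measurable_space[OF f that] measurable_space[OF g that] by (auto simp: space_haar)
  show "f k * g k \<in> unitary_group n" if "k \<in> space K" for k
    using fu[OF that] by (rule unitary_group_mult)
  fix a b assume ab: "a < n" "b < n"
  have "(\<lambda>k. \<Sum>l<n. f k $$ (a, l) * g k $$ (l, b)) \<in> borel_measurable K"
    using ab by (intro borel_measurable_sum borel_measurable_times measurable_compose[OF f measurable_entry]
        measurable_compose[OF g measurable_entry]) auto
  moreover have "(f k * g k) $$ (a, b) = (\<Sum>l<n. f k $$ (a, l) * g k $$ (l, b))" if "k \<in> space K" for k
    using fu[OF that] ab by (intro mult_index unitary_group_carrier)
  ultimately show "(\<lambda>k. (f k * g k) $$ (a, b)) \<in> borel_measurable K"
    by (simp cong: measurable_cong)
qed

lemma measurable_mult_left: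
  assumes V: "V \<in> unitary_group n" shows "(\<lambda>U. V * U) \<in> measurable m m"
  by (rule measurable_mult) (use V space_haar in auto)

lemma measurable_mult_right:
  assumes V: "V \<in> unitary_group n" shows "(\<lambda>U. U * V) \<in> measurable m m"
  by (rule measurable_mult) (use V space_haar in auto)

lemma nn_integral_left:
  assumes f: "f \<in> borel_measurable m" and V: "V \<in> unitary_group n"
  shows "(\<integral>\<^sup>+U. f (V * U) \<partial>m) = (\<integral>\<^sup>+U. f U \<partial>m)"
proof -
  have "distr m m (\<lambda>U. V * U) = m" using haar V by (simp add: is_haar_prob_def)
  then show ?thesis using nn_integral_distr[OF measurable_mult_left[OF V], of f] f by simp
qed

text \<open>Integrate \<open>f (U* W)\<close> over both variables. Integrating \<open>W\<close> first gives the integral of \<open>f\<close> by left invariance;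
integrating \<open>U\<close> first gives the integral of \<open>f (U*)\<close>, because \<open>U* W = (W* U)*\<close> and left invariance applies to \<open>W* U\<close>.\<close>
lemma nn_integral_adjoint:
  assumes f: "f \<in> borel_measurable m"
  shows "(\<integral>\<^sup>+U. f (mat_adjoint U) \<partial>m) = (\<integral>\<^sup>+U. f U \<partial>m)"
proof -
  interpret pair_sigma_finite m m ..
  have one: "(\<integral>\<^sup>+U. c \<partial>m) = c" for c :: ennreal
    using emeasure_space_1 by simp
  have fm: "(\<lambda>(U, W). f (mat_adjoint U * W)) \<in> borel_measurable (m \<Otimes>\<^sub>M m)"
    unfolding case_prod_beta
    by (rule measurable_compose[OF measurable_mult f])
       (auto intro: measurable_compose[OF measurable_fst measurable_adjoint])
  have fa: "(\<lambda>U. f (mat_adjoint U)) \<in> borel_measurable m"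
    by (rule measurable_compose[OF measurable_adjoint f])
  have "(\<integral>\<^sup>+U. f U \<partial>m) = (\<integral>\<^sup>+U. (\<integral>\<^sup>+W. f (mat_adjoint U * W) \<partial>m) \<partial>m)"
  proof -
    have "(\<integral>\<^sup>+U. (\<integral>\<^sup>+W. f (mat_adjoint U * W) \<partial>m) \<partial>m) = (\<integral>\<^sup>+U. (\<integral>\<^sup>+W. f W \<partial>m) \<partial>m)"
      by (intro nn_integral_cong nn_integral_left f unitary_group_adjoint) (simp add: space_haar)
    then show ?thesis unfolding one by simp
  qed
  also have "\<dots> = (\<integral>\<^sup>+W. (\<integral>\<^sup>+U. f (mat_adjoint U * W) \<partial>m) \<partial>m)"
    using Fubini'[OF fm] by simp
  also have "\<dots> = (\<integral>\<^sup>+W. (\<integral>\<^sup>+U. f (mat_adjoint U) \<partial>m) \<partial>m)"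
  proof (rule nn_integral_cong)
    fix W assume "W \<in> space m"
    then have W: "W \<in> unitary_group n" by (simp add: space_haar)
    have "(\<integral>\<^sup>+U. f (mat_adjoint U * W) \<partial>m) = (\<integral>\<^sup>+U. f (mat_adjoint (mat_adjoint W * U)) \<partial>m)"
    proof (rule nn_integral_cong)
      fix U assume "U \<in> space m"
      then have c: "U \<in> carrier_mat n n" "W \<in> carrier_mat n n"
        using W unitary_group_carrier by (auto simp: space_haar)
      show "f (mat_adjoint U * W) = f (mat_adjoint (mat_adjoint W * U))"
        using mat_adjoint_mult[OF mat_adjoint_carrier[OF c(2)] c(1)] mat_adjoint_adjoint[OF c(2)] by simp
    qed
    also have "\<dots> = (\<integral>\<^sup>+U. f (mat_adjoint U) \<partial>m)"
      by (rule nn_integral_left[OF fa unitary_group_adjoint[OF W]])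
    finally show "(\<integral>\<^sup>+U. f (mat_adjoint U * W) \<partial>m) = (\<integral>\<^sup>+U. f (mat_adjoint U) \<partial>m)" .
  qed
  finally show ?thesis unfolding one by simp
qed

text \<open>Right multiplication by \<open>V\<close> is left multiplication by \<open>V*\<close> conjugated with the inversion, and both preserve the measure.\<close>
lemma distr_mult_right:
  assumes V: "V \<in> unitary_group n"
  shows "distr m m (\<lambda>U. U * V) = m"
proof (rule measure_eqI)
  fix S assume S: "S \<in> sets (distr m m (\<lambda>U. U * V))"
  then have S': "S \<in> sets m" by simp
  let ?f = "indicator S :: complex mat \<Rightarrow> ennreal"
  have f: "?f \<in> borel_measurable m" using S' by simp
  have fa: "(\<lambda>U. ?f (mat_adjoint U)) \<in> borel_measurable m"
    by (rule measurable_compose[OF measurable_adjoint f])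
  have fV: "(\<lambda>U. ?f (U * V)) \<in> borel_measurable m"
    by (rule measurable_compose[OF measurable_mult_right[OF V] f])
  have "emeasure (distr m m (\<lambda>U. U * V)) S = (\<integral>\<^sup>+U. ?f U \<partial>distr m m (\<lambda>U. U * V))" using S' by simp
  also have "\<dots> = (\<integral>\<^sup>+U. ?f (U * V) \<partial>m)"
    by (rule nn_integral_distr[OF measurable_mult_right[OF V]]) (use S' in simp)
  also have "\<dots> = (\<integral>\<^sup>+U. ?f (mat_adjoint U * V) \<partial>m)"
    by (rule nn_integral_adjoint[OF fV, symmetric])
  also have "\<dots> = (\<integral>\<^sup>+U. ?f (mat_adjoint (mat_adjoint V * U)) \<partial>m)"
  proof (rule nn_integral_cong)
    fix U assume "U \<in> space m"
    then have c: "U \<in> carrier_mat n n" "V \<in> carrier_mat n n"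
      using V unitary_group_carrier by (auto simp: space_haar)
    show "?f (mat_adjoint U * V) = ?f (mat_adjoint (mat_adjoint V * U))"
      using mat_adjoint_mult[OF mat_adjoint_carrier[OF c(2)] c(1)] mat_adjoint_adjoint[OF c(2)] by simp
  qed
  also have "\<dots> = (\<integral>\<^sup>+U. ?f (mat_adjoint U) \<partial>m)"
    by (rule nn_integral_left[OF fa unitary_group_adjoint[OF V]])
  also have "\<dots> = emeasure m S" using nn_integral_adjoint[OF f] S' by simp
  finally show "emeasure (distr m m (\<lambda>U. U * V)) S = emeasure m S" .
qed simp

lemma integral_mult_right_invariant:
  fixes f :: "complex mat \<Rightarrow> complex"
  assumes f: "f \<in> borel_measurable m" and V: "V \<in> unitary_group n"
  shows "(\<integral>U. f (U * V) \<partial>m) = (\<integral>U. f U \<partial>m)"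
  using integral_distr[OF measurable_mult_right[OF V] f] distr_mult_right[OF V] by simp

lemma measurable_pow_entry [measurable]:
  assumes "a < n" "b < n" shows "pow_entry n lam k a b \<in> borel_measurable m"
proof -
  have "(\<lambda>U. \<Sum>l<n. of_real (lam l) ^ k * cnj (U $$ (l, a)) * U $$ (l, b)) \<in> borel_measurable m"
    by (intro borel_measurable_sum borel_measurable_times borel_measurable_const
        measurable_compose[OF measurable_entry borel_measurable_continuous_onI])
       (use assms in \<open>auto intro: measurable_entry continuous_intros\<close>)
  then show ?thesis by (simp add: pow_entry_def[abs_def])
qed

lemma measurable_tilt [measurable]: "tilt n lam x \<in> borel_measurable m"
proof -
  have s: "(\<lambda>U. \<Sum>a<n. x a * pow_entry n lam 1 a a U) \<in> borel_measurable m"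
    by (intro borel_measurable_sum borel_measurable_times borel_measurable_const measurable_pow_entry) auto
  have "(\<lambda>U. exp (\<Sum>a<n. x a * pow_entry n lam 1 a a U)) \<in> borel_measurable m"
    by (rule measurable_compose[OF s borel_measurable_continuous_onI]) (intro continuous_intros)
  then show ?thesis by (simp add: tilt_def[abs_def])
qed

lemma HC_eq_integral_tilt: "HC m n x lam = (\<integral>U. tilt n lam x U \<partial>m)"
  unfolding HC_def
proof (rule Bochner_Integration.integral_cong[OF refl])
  fix U assume "U \<in> space m"
  then have c: "U \<in> carrier_mat n n" using unitary_group_carrier by (auto simp: space_haar)
  note ca = mat_adjoint_carrier[OF c]
  let ?L = "mat_diag n (\<lambda>i. complex_of_real (lam i))" and ?X = "mat_diag n x"
  have LU: "?L * U * ?X = Matrix.mat n n (\<lambda>(i, j). (of_real (lam i) * U $$ (i, j)) * x j)"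
    by (subst mat_diag_mult_right[of _ n], use c in \<open>simp add: mat_diag_mult_left\<close>)
       (auto simp: mat_diag_mult_left[OF c] intro!: eq_matI)
  have "mat_trace (?L * U * ?X * mat_adjoint U) = (\<Sum>i<n. (?L * U * ?X * mat_adjoint U) $$ (i, i))"
    unfolding mat_trace_def LU by simp
  also have "\<dots> = (\<Sum>i<n. \<Sum>l<n. (of_real (lam i) * U $$ (i, l)) * x l * cnj (U $$ (i, l)))"
    unfolding LU
    by (intro sum.cong refl, subst mult_index[OF _ ca]) (auto simp: mat_adjoint_index[OF c] intro!: sum.cong)
  also have "\<dots> = (\<Sum>l<n. x l * pow_entry n lam 1 l l U)"
    unfolding pow_entry_def sum_distrib_left by (subst sum.swap) (simp add: mult_ac)
  finally show "exp (mat_trace (?L * U * ?X * mat_adjoint U)) = tilt n lam x U"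
    by (simp add: tilt_def)
qed

end

section \<open>Rotations of two columns and the Ward identity\<close>

lemma norm_tilt_le:
  assumes U: "U \<in> unitary_group n"
  shows "norm (tilt n lam x U) \<le> exp ((\<Sum>a<n. norm (x a)) * (\<Sum>l<n. \<bar>lam l\<bar>))"
proof -
  have "norm (\<Sum>a<n. x a * pow_entry n lam 1 a a U) \<le> (\<Sum>a<n. norm (x a) * (\<Sum>l<n. \<bar>lam l\<bar>))"
    by (rule sum_norm_le)
       (use norm_pow_entry_le[OF U, where k=1 and lam=lam] in \<open>auto simp: norm_mult intro!: mult_left_mono\<close>)
  then show ?thesis
    unfolding tilt_def by (intro order_trans[OF norm_exp]) (simp add: sum_distrib_right)
qed

lemma tilt_update:
  assumes i: "i < n"
  shows "tilt n lam (x(i := z)) U = exp (z * pow_entry n lam 1 i i U) * tilt n lam (x(i := 0)) U"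
proof -
  have "(\<Sum>a<n. (x(i := z)) a * pow_entry n lam 1 a a U) =
      z * pow_entry n lam 1 i i U + (\<Sum>a<n. (x(i := 0)) a * pow_entry n lam 1 a a U)"
    using i by (subst (1 2) sum.remove[of _ i]) (auto intro!: sum.cong)
  then show ?thesis by (simp add: tilt_def exp_add)
qed

text \<open>The images of the entries under a rotation of columns \<open>i\<close> and \<open>j\<close>. The cosine \<open>c\<close> and the sine \<open>s\<close> enter only through
polynomials without complex conjugation, so the angle can later be made complex.\<close>
lemma pow_entry_rot:
  assumes U: "U \<in> unitary_group n" and ij: "i < n" "j < n" "i \<noteq> j" and cs: "c\<^sup>2 + s\<^sup>2 = 1"
  defines "V \<equiv> U * rot n i j c s"
  shows "pow_entry n lam k j i V = of_real (c\<^sup>2) * pow_entry n lam k j i U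
      + of_real (c * s) * (pow_entry n lam k j j U - pow_entry n lam k i i U)
      - of_real (s\<^sup>2) * pow_entry n lam k i j U"
    and "pow_entry n lam k i i V = of_real (c\<^sup>2) * pow_entry n lam k i i U
      + of_real (c * s) * (pow_entry n lam k i j U + pow_entry n lam k j i U)
      + of_real (s\<^sup>2) * pow_entry n lam k j j U"
    and "pow_entry n lam k j j V = of_real (s\<^sup>2) * pow_entry n lam k i i U
      - of_real (c * s) * (pow_entry n lam k i j U + pow_entry n lam k j i U)
      + of_real (c\<^sup>2) * pow_entry n lam k j j U"
    and "a < n \<Longrightarrow> a \<noteq> i \<Longrightarrow> a \<noteq> j \<Longrightarrow> pow_entry n lam k a a V = pow_entry n lam k a a U"
    and "a < n \<Longrightarrow> a \<noteq> i \<Longrightarrow> a \<noteq> j \<Longrightarrow> pow_entry n lam k i a V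
       = of_real c * pow_entry n lam k i a U + of_real s * pow_entry n lam k j a U"
    and "a < n \<Longrightarrow> a \<noteq> i \<Longrightarrow> a \<noteq> j \<Longrightarrow> pow_entry n lam k a i V
       = of_real c * pow_entry n lam k a i U + of_real s * pow_entry n lam k a j U"
proof -
  note R = mult_rot_index[OF unitary_group_carrier[OF U] ij(1,2), where c=c and s=s, folded V_def]
  have Vi: "V $$ (l, i) = of_real c * U $$ (l, i) + of_real s * U $$ (l, j)" if "l < n" for l
    using R[OF that ij(1)] by simp
  have Vj: "V $$ (l, j) = of_real c * U $$ (l, j) - of_real s * U $$ (l, i)" if "l < n" for l
    using R[OF that ij(2)] ij by simp
  have Va: "V $$ (l, a) = U $$ (l, a)" if "l < n" "a < n" "a \<noteq> i" "a \<noteq> j" for l a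
    using R[OF that(1,2)] that by simp
  note d = pow_entry_def sum_distrib_left sum.distrib[symmetric] sum_subtractf[symmetric]
  show "pow_entry n lam k j i V = of_real (c\<^sup>2) * pow_entry n lam k j i U
      + of_real (c * s) * (pow_entry n lam k j j U - pow_entry n lam k i i U)
      - of_real (s\<^sup>2) * pow_entry n lam k i j U"
    unfolding d by (rule sum.cong) (auto simp: Vi Vj algebra_simps power2_eq_square)
  show "pow_entry n lam k i i V = of_real (c\<^sup>2) * pow_entry n lam k i i U
      + of_real (c * s) * (pow_entry n lam k i j U + pow_entry n lam k j i U)
      + of_real (s\<^sup>2) * pow_entry n lam k j j U"
    unfolding d by (rule sum.cong) (auto simp: Vi Vj algebra_simps power2_eq_square)
  show "pow_entry n lam k j j V = of_real (s\<^sup>2) * pow_entry n lam k i i U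
      - of_real (c * s) * (pow_entry n lam k i j U + pow_entry n lam k j i U)
      + of_real (c\<^sup>2) * pow_entry n lam k j j U"
    unfolding d by (rule sum.cong) (auto simp: Vi Vj algebra_simps power2_eq_square)
  assume a: "a < n" "a \<noteq> i" "a \<noteq> j"
  show "pow_entry n lam k a a V = pow_entry n lam k a a U"
    unfolding d by (rule sum.cong) (auto simp: Va a)
  show "pow_entry n lam k i a V
       = of_real c * pow_entry n lam k i a U + of_real s * pow_entry n lam k j a U"
    unfolding d by (rule sum.cong) (auto simp: Vi Va a algebra_simps)
  show "pow_entry n lam k a i V
       = of_real c * pow_entry n lam k a i U + of_real s * pow_entry n lam k a j U"
    unfolding d by (rule sum.cong) (auto simp: Vi Va a algebra_simps)
qed

lemma sum_update_two:
  fixes f g :: "nat \<Rightarrow> 'b :: ab_group_add"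
  assumes "i < n" "j < n" "i \<noteq> j" "\<And>a. a < n \<Longrightarrow> a \<noteq> i \<Longrightarrow> a \<noteq> j \<Longrightarrow> f a = g a"
  shows "(\<Sum>a<n. f a) = (\<Sum>a<n. g a) + (f i - g i) + (f j - g j)"
proof -
  have s: "(\<Sum>a<n. h a) = h i + (h j + (\<Sum>a\<in>{..<n} - {i} - {j}. h a))" for h :: "nat \<Rightarrow> 'b"
    using assms(1-3) by (subst sum.remove[of _ i], simp, simp, subst sum.remove[of _ j]) auto
  have "(\<Sum>a\<in>{..<n} - {i} - {j}. f a) = (\<Sum>a\<in>{..<n} - {i} - {j}. g a)"
    using assms by (intro sum.cong) auto
  then show ?thesis unfolding s[of f] s[of g] by (simp add: algebra_simps)
qed

lemma tilt_rot:
  assumes U: "U \<in> unitary_group n" and ij: "i < n" "j < n" "i \<noteq> j" and cs: "c\<^sup>2 + s\<^sup>2 = 1"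
  shows "tilt n lam x (U * rot n i j c s) = tilt n lam x U *
    exp ((x i - x j) * (of_real (c * s) * (pow_entry n lam 1 i j U + pow_entry n lam 1 j i U)
       + of_real (s\<^sup>2) * (pow_entry n lam 1 j j U - pow_entry n lam 1 i i U)))"
proof -
  let ?V = "U * rot n i j c s"
  have c2: "complex_of_real (c\<^sup>2) = 1 - of_real (s\<^sup>2)" using cs
    by (metis add_diff_cancel_right' of_real_1 of_real_diff)
  have "(\<Sum>a<n. x a * pow_entry n lam 1 a a ?V) = (\<Sum>a<n. x a * pow_entry n lam 1 a a U)
      + (x i * pow_entry n lam 1 i i ?V - x i * pow_entry n lam 1 i i U)
      + (x j * pow_entry n lam 1 j j ?V - x j * pow_entry n lam 1 j j U)"
    by (rule sum_update_two) (use ij pow_entry_rot(4)[OF U ij cs] in auto)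
  also have "\<dots> = (\<Sum>a<n. x a * pow_entry n lam 1 a a U) + (x i - x j) *
    (of_real (c * s) * (pow_entry n lam 1 i j U + pow_entry n lam 1 j i U)
       + of_real (s\<^sup>2) * (pow_entry n lam 1 j j U - pow_entry n lam 1 i i U))"
    unfolding pow_entry_rot(2,3)[OF U ij cs] c2 by (simp add: algebra_simps)
  finally show ?thesis by (simp add: tilt_def exp_add)
qed

lemma pow_entry_phase:
  assumes U: "U \<in> unitary_group n" and ab: "a < n" "b < n"
  shows "pow_entry n lam k a b (U * phase n i) =
    (if a = i then - \<i> else 1) * (if b = i then \<i> else 1) * pow_entry n lam k a b U"
  unfolding pow_entry_def sum_distrib_left
  by (rule sum.cong) (use ab in \<open>auto simp: mult_phase_index[OF unitary_group_carrier[OF U]]\<close>)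

lemma tilt_phase:
  assumes U: "U \<in> unitary_group n" shows "tilt n lam x (U * phase n i) = tilt n lam x U"
  unfolding tilt_def by (intro arg_cong[where f=exp] sum.cong) (auto simp: pow_entry_phase[OF U])

context haar_unitary
begin

lemma integrable_bounded:
  fixes f :: "complex mat \<Rightarrow> complex"
  assumes "f \<in> borel_measurable m" "\<And>U. U \<in> unitary_group n \<Longrightarrow> norm (f U) \<le> C"
  shows "integrable m f"
  by (rule integrable_const_bound[of _ C]) (use assms space_haar in auto)

lemma integrable_times_tilt:
  assumes "f \<in> borel_measurable m" "\<And>U. U \<in> unitary_group n \<Longrightarrow> norm (f U) \<le> C"
  shows "integrable m (\<lambda>U. f U * tilt n lam x U)"
proof (rule integrable_bounded)
  show "(\<lambda>U. f U * tilt n lam x U) \<in> borel_measurable m" using assms(1) by measurable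
  show "norm (f U * tilt n lam x U) \<le> C * exp ((\<Sum>a<n. norm (x a)) * (\<Sum>l<n. \<bar>lam l\<bar>))"
    if "U \<in> unitary_group n" for U
    unfolding norm_mult using assms(2)[OF that] norm_tilt_le[OF that, of lam x]
    by (intro mult_mono) (auto intro: order_trans[OF norm_ge_zero])
qed

text \<open>Differentiation in the source \<open>x i\<close> inserts a factor \<open>B i i\<close>. Domination is trivial here because all entries of \<open>B\<close> are
bounded on the unitary group.\<close>
lemma has_field_derivative_integral_tilt:
  assumes f: "f \<in> borel_measurable m" and bd: "\<And>U. U \<in> unitary_group n \<Longrightarrow> norm (f U) \<le> C"
    and i: "i < n"
  shows "((\<lambda>z. \<integral>U. f U * tilt n lam (x(i := z)) U \<partial>m) has_field_derivative
     (\<integral>U. f U * pow_entry n lam 1 i i U * tilt n lam (x(i := z)) U \<partial>m)) (at z)"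
proof -
  define g where "g = (\<lambda>U z. f U * tilt n lam (x(i := z)) U)"
  define X where "X = norm z + 1 + (\<Sum>a<n. norm (x a))"
  have g': "(g U has_field_derivative f U * pow_entry n lam 1 i i U * tilt n lam (x(i := w)) U) (at w)" for U w
  proof -
    have g: "g U = (\<lambda>z. f U * (exp (z * pow_entry n lam 1 i i U) * tilt n lam (x(i := 0)) U))"
      unfolding g_def by (rule ext) (subst tilt_update[OF i], rule refl)
    show ?thesis unfolding g
      by (subst tilt_update[OF i]) (auto intro!: derivative_eq_intros)
  qed
  have "((\<lambda>z. \<integral>U. g U z \<partial>m) has_field_derivative (\<integral>U. deriv (g U) z \<partial>m)) (at z)"
  proof (rule holomorphic_integral_dominated(1)[where a = z and r = 1 and D = "\<lambda>_. C * exp (X * (\<Sum>l<n. \<bar>lam l\<bar>))"])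
    show "g U holomorphic_on ball z 1" for U
      using g' by (auto simp: holomorphic_on_def field_differentiable_def intro: has_field_derivative_at_within)
    show "(\<lambda>U. g U w) \<in> borel_measurable m" for w unfolding g_def using f by measurable
    fix U w assume U: "U \<in> space m" and w: "w \<in> ball z 1"
    have w': "norm w \<le> norm z + 1"
      using w norm_triangle_ineq2[of w z] by (simp add: dist_norm norm_minus_commute)
    have "(\<Sum>a<n. norm ((x(i := w)) a)) = norm w + (\<Sum>a\<in>{..<n} - {i}. norm (x a))"
      using i by (subst sum.remove[of _ i]) (auto intro!: sum.cong)
    also have "\<dots> \<le> X" unfolding X_def using w' i by (intro add_mono sum_mono2) auto
    finally have X: "(\<Sum>a<n. norm ((x(i := w)) a)) \<le> X" .
    have U': "U \<in> unitary_group n" using U by (simp add: space_haar)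
    have "norm (tilt n lam (x(i := w)) U) \<le> exp ((\<Sum>a<n. norm ((x(i := w)) a)) * (\<Sum>l<n. \<bar>lam l\<bar>))"
      by (rule norm_tilt_le[OF U'])
    also have "\<dots> \<le> exp (X * (\<Sum>l<n. \<bar>lam l\<bar>))"
      using X by (auto intro!: mult_right_mono sum_nonneg)
    finally show "norm (g U w) \<le> C * exp (X * (\<Sum>l<n. \<bar>lam l\<bar>))"
      unfolding g_def norm_mult using bd[OF U'] by (intro mult_mono) (auto intro: order_trans[OF norm_ge_zero])
  qed auto
  moreover have "deriv (g U) z = f U * pow_entry n lam 1 i i U * tilt n lam (x(i := z)) U" for U
    by (rule DERIV_imp_deriv[OF g'])
  ultimately show ?thesis by (simp add: g_def)
qed

text \<open>The rotation identity produces \<open>B i j + B j i\<close>; this lemma discards the second summand, which changes sign when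
column \<open>i\<close> is multiplied by the imaginary unit, whereas the tilt does not change.\<close>
lemma integral_phase_zero:
  assumes ij: "i < n" "j < n" "i \<noteq> j"
  shows "(\<integral>U. pow_entry n lam k j i U * pow_entry n lam 1 j i U * tilt n lam x U \<partial>m) = 0"
proof -
  let ?f = "\<lambda>U. pow_entry n lam k j i U * pow_entry n lam 1 j i U * tilt n lam x U"
  have [measurable]: "pow_entry n lam p j i \<in> borel_measurable m" for p using ij by simp
  have ii: "\<i> * a * (\<i> * b) * c = - (a * b * c)" for a b c :: complex
  proof -
    have "\<i> * a * (\<i> * b) * c = (\<i> * \<i>) * (a * b * c)" by (simp only: mult_ac)
    then show ?thesis by simp
  qed
  have "(\<integral>U. ?f U \<partial>m) = (\<integral>U. ?f (U * phase n i) \<partial>m)"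
    by (rule integral_mult_right_invariant[symmetric]) (auto intro: phase_unitary)
  also have "\<dots> = (\<integral>U. - ?f U \<partial>m)"
    by (rule Bochner_Integration.integral_cong)
       (use ij in \<open>auto simp: space_haar tilt_phase pow_entry_phase ii\<close>)
  finally show ?thesis by simp
qed

text \<open>Rotate columns \<open>i\<close> and \<open>j\<close> by the angle \<open>t\<close> in the average of \<open>(B^k) j i\<close> against the tilt. The average does not depend on real \<open>t\<close>, so
its derivative at \<open>0\<close> vanishes. That derivative is the average of \<open>(B^k) j j - (B^k) i i\<close> from the entry, plus
\<open>(x i - x j)\<close> times the average of \<open>(B^k) j i * (B i j + B j i)\<close> from the tilt. To differentiate under the integral
with \<open>holomorphic_integral_dominated\<close>, the angle is taken complex.\<close>
lemma ward_identity:
  assumes ij: "i < n" "j < n" "i \<noteq> j"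
  shows "(x i - x j) * (\<integral>U. pow_entry n lam k j i U * pow_entry n lam 1 i j U * tilt n lam x U \<partial>m)
    = (\<integral>U. pow_entry n lam k i i U * tilt n lam x U \<partial>m) - (\<integral>U. pow_entry n lam k j j U * tilt n lam x U \<partial>m)"
proof -
  let ?P = "pow_entry n lam"
  have [measurable]: "?P p i i \<in> borel_measurable m" "?P p i j \<in> borel_measurable m"
    "?P p j i \<in> borel_measurable m" "?P p j j \<in> borel_measurable m" for p using ij by auto
  \<comment> \<open>M and E continue the rotated entry and the change of the rotated exponent to complex angles\<close>
  define M where "M = (\<lambda>U t. (cos t)\<^sup>2 * ?P k j i U + cos t * sin t * (?P k j j U - ?P k i i U)
      - (sin t)\<^sup>2 * ?P k i j U)"
  define E where "E = (\<lambda>U t. (x i - x j) * (cos t * sin t * (?P 1 i j U + ?P 1 j i U)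
       + (sin t)\<^sup>2 * (?P 1 j j U - ?P 1 i i U)))"
  define g where "g = (\<lambda>U t. M U t * (tilt n lam x U * exp (E U t)))"
  define g' where "g' = (\<lambda>U. ((?P k j j U - ?P k i i U) + ?P k j i U * ((x i - x j) * (?P 1 i j U + ?P 1 j i U))) * tilt n lam x U)"
  have gr: "g U (of_real t) = (\<lambda>U. ?P k j i U * tilt n lam x U) (U * rot n i j (cos t) (sin t))"
    if U: "U \<in> unitary_group n" for U t
  proof -
    have cs: "(cos t)\<^sup>2 + (sin t)\<^sup>2 = 1" by simp
    show ?thesis
      by (simp add: g_def M_def E_def tilt_rot[OF U ij cs] pow_entry_rot(1)[OF U ij cs] cos_of_real sin_of_real)
  qed
  have const: "(\<integral>U. g U (of_real t) \<partial>m) = (\<integral>U. ?P k j i U * tilt n lam x U \<partial>m)" for t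
  proof -
    have "(\<integral>U. g U (of_real t) \<partial>m) = (\<integral>U. (\<lambda>U. ?P k j i U * tilt n lam x U) (U * rot n i j (cos t) (sin t)) \<partial>m)"
      by (rule Bochner_Integration.integral_cong) (auto simp: space_haar gr)
    also have "\<dots> = (\<integral>U. ?P k j i U * tilt n lam x U \<partial>m)"
      by (rule integral_mult_right_invariant) (use ij in \<open>auto intro: rot_unitary\<close>)
    finally show ?thesis .
  qed
  have der: "(g U has_field_derivative g' U) (at 0)" for U
    unfolding g_def M_def E_def g'_def
    by (auto intro!: derivative_eq_intros simp: algebra_simps)
  have hol: "g U holomorphic_on S" for U S
    unfolding g_def M_def E_def by (intro holomorphic_intros)
  \<comment> \<open>uniform bounds on the complex unit disc, where cosine and sine may exceed 1\<close>
  obtain K where K: "K \<ge> 1" "\<And>t :: complex. norm t \<le> 1 \<Longrightarrow> norm (cos t) \<le> K" "\<And>t :: complex. norm t \<le> 1 \<Longrightarrow> norm (sin t) \<le> K"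
  proof -
    have "bounded (cos ` cball (0::complex) 1)" "bounded (sin ` cball (0::complex) 1)"
      by (intro compact_imp_bounded compact_continuous_image continuous_intros compact_cball)+
    then obtain K1 K2 where "\<forall>t\<in>cball (0::complex) 1. norm (cos t) \<le> K1" "\<forall>t\<in>cball (0::complex) 1. norm (sin t) \<le> K2"
      by (auto simp: bounded_iff)
    then show ?thesis by (intro that[of "max 1 (max K1 K2)"]) (auto simp: le_max_iff_disj)
  qed
  define L where "L = (\<lambda>k. \<Sum>l<n. \<bar>lam l\<bar> ^ k)"
  have L0: "L k \<ge> 0" for k by (auto simp: L_def intro: sum_nonneg)
  have P: "norm (?P p a b U) \<le> L p" if "U \<in> unitary_group n" "a < n" "b < n" for p a b U
    unfolding L_def using norm_pow_entry_le that by blast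
  define D where "D = (4 * (K\<^sup>2 * L k)) * (exp ((\<Sum>a<n. norm (x a)) * (\<Sum>l<n. \<bar>lam l\<bar>)) * exp (norm (x i - x j) * (4 * (K\<^sup>2 * L 1))))"
  have bd: "norm (g U t) \<le> D" if U: "U \<in> unitary_group n" and t: "norm t \<le> 1" for U t
  proof -
    have c2: "norm ((cos t)\<^sup>2) \<le> K\<^sup>2" "norm ((sin t)\<^sup>2) \<le> K\<^sup>2" "norm (cos t * sin t) \<le> K\<^sup>2"
      using K(2,3)[OF t] K(1) by (auto simp: norm_power norm_mult power2_eq_square intro!: mult_mono)
    have two: "norm (a + b) \<le> 2 * B" "norm (a - b) \<le> 2 * B" if "norm a \<le> B" "norm b \<le> B" for a b :: complex and B
      using norm_triangle_ineq[of a b] norm_triangle_ineq4[of a b] that by auto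
    have m: "norm (a * b) \<le> K\<^sup>2 * B" if "norm a \<le> K\<^sup>2" "norm b \<le> B" for a b :: complex and B
      unfolding norm_mult using that by (intro mult_mono) (auto intro: order_trans[OF norm_ge_zero])
    have "norm (M U t) \<le> K\<^sup>2 * L k + K\<^sup>2 * (2 * L k) + K\<^sup>2 * L k"
      unfolding M_def
      by (intro order_trans[OF norm_triangle_ineq4] order_trans[OF norm_triangle_ineq] add_mono m c2 two P U ij)
    then have M: "norm (M U t) \<le> 4 * (K\<^sup>2 * L k)" by (simp add: mult.commute)
    have "norm (E U t) \<le> norm (x i - x j) * (K\<^sup>2 * (2 * L 1) + K\<^sup>2 * (2 * L 1))"
      unfolding E_def norm_mult[of "x i - x j"]
      by (intro mult_left_mono order_trans[OF norm_triangle_ineq] add_mono m c2 two P U ij norm_ge_zero)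
    then have E: "norm (exp (E U t)) \<le> exp (norm (x i - x j) * (4 * (K\<^sup>2 * L 1)))"
      by (intro order_trans[OF norm_exp]) (simp add: mult_ac)
    show ?thesis unfolding g_def D_def norm_mult
      by (intro mult_mono M E norm_tilt_le U) (auto simp: L0)
  qed
  have meas: "(\<lambda>U. g U t) \<in> borel_measurable m" for t
  proof -
    have 1: "(\<lambda>U. E U t) \<in> borel_measurable m" unfolding E_def by measurable
    have "(\<lambda>U. exp (E U t)) \<in> borel_measurable m"
      by (rule measurable_compose[OF 1 borel_measurable_continuous_onI]) (intro continuous_intros)
    moreover have "(\<lambda>U. M U t) \<in> borel_measurable m" unfolding M_def by measurable
    ultimately show ?thesis unfolding g_def by measurable
  qed
  have "((\<lambda>t. \<integral>U. g U t \<partial>m) has_field_derivative (\<integral>U. deriv (g U) 0 \<partial>m)) (at 0)"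
    by (rule holomorphic_integral_dominated(1)[where a = 0 and r = 1 and D = "\<lambda>_. D"])
       (use hol meas bd in \<open>auto simp: space_haar\<close>)
  moreover have "deriv (g U) 0 = g' U" for U by (rule DERIV_imp_deriv[OF der])
  ultimately have "((\<lambda>t. \<integral>U. g U t \<partial>m) has_field_derivative (\<integral>U. g' U \<partial>m)) (at (of_real 0))" by simp
  then have "((\<lambda>t. \<integral>U. g U (of_real t) \<partial>m) has_vector_derivative (\<integral>U. g' U \<partial>m)) (at 0)"
    by (rule has_vector_derivative_real_field)
  moreover have "((\<lambda>t::real. \<integral>U. g U (of_real t) \<partial>m) has_vector_derivative 0) (at 0)"
    unfolding const by simp
  ultimately have "(\<integral>U. g' U \<partial>m) = 0" by (rule vector_derivative_unique_at)
  have b2: "norm (a * b) \<le> L k * L 1" if "norm a \<le> L k" "norm b \<le> L 1" for a b :: complex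
    unfolding norm_mult using that by (intro mult_mono) (auto intro: order_trans[OF norm_ge_zero])
  have int1: "integrable m (\<lambda>U. ?P k a a U * tilt n lam x U)" if "a < n" for a
    by (rule integrable_times_tilt[where C="L k"]) (use that P in auto)
  have int2: "integrable m (\<lambda>U. ?P k j i U * ?P 1 a b U * tilt n lam x U)" if "a < n" "b < n" for a b
    by (rule integrable_times_tilt[where C="L k * L 1"]) (use that ij in \<open>auto simp del: One_nat_def intro!: b2 P\<close>)
  have "(\<integral>U. g' U \<partial>m) = (\<integral>U. (?P k j j U * tilt n lam x U - ?P k i i U * tilt n lam x U)
     + (x i - x j) * (?P k j i U * ?P 1 i j U * tilt n lam x U + ?P k j i U * ?P 1 j i U * tilt n lam x U) \<partial>m)"
    by (rule Bochner_Integration.integral_cong) (auto simp: g'_def algebra_simps)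
  also have "\<dots> = ((\<integral>U. ?P k j j U * tilt n lam x U \<partial>m) - (\<integral>U. ?P k i i U * tilt n lam x U \<partial>m))
     + (x i - x j) * ((\<integral>U. ?P k j i U * ?P 1 i j U * tilt n lam x U \<partial>m) + (\<integral>U. ?P k j i U * ?P 1 j i U * tilt n lam x U \<partial>m))"
    using ij by (simp add: int1 int2 del: One_nat_def)
  finally show ?thesis using \<open>(\<integral>U. g' U \<partial>m) = 0\<close> integral_phase_zero[OF ij, of lam k x]
    by (simp add: algebra_simps)
qed

text \<open>A rotation by the angle \<open>\<pi> / 2\<close> exchanges two columns up to a sign, and fixes the tilt if the two sources agree. This
identifies all off-diagonal averages whose second index belongs to a vanishing source.\<close>
lemma integral_swap:
  assumes ij: "i < n" "j < n" "j' < n" "i \<noteq> j" "i \<noteq> j'" and x: "x j = x j'"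
  shows "(\<integral>U. pow_entry n lam k j i U * pow_entry n lam 1 i j U * tilt n lam x U \<partial>m)
    = (\<integral>U. pow_entry n lam k j' i U * pow_entry n lam 1 i j' U * tilt n lam x U \<partial>m)"
proof (cases "j = j'")
  case False
  let ?f = "\<lambda>j U. pow_entry n lam k j i U * pow_entry n lam 1 i j U * tilt n lam x U"
  have [measurable]: "pow_entry n lam p a b \<in> borel_measurable m" if "a < n" "b < n" for p a b using that by auto
  have "(\<integral>U. ?f j U \<partial>m) = (\<integral>U. ?f j (U * rot n j j' 0 1) \<partial>m)"
    by (rule integral_mult_right_invariant[symmetric]) (use ij False in \<open>auto intro: rot_unitary\<close>)
  also have "\<dots> = (\<integral>U. ?f j' U \<partial>m)"
    by (rule Bochner_Integration.integral_cong)
       (use ij False x in \<open>auto simp: space_haar tilt_rot pow_entry_rot(5,6)\<close>)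
  finally show ?thesis .
qed simp

end

section \<open>Haar averages as entire functions of the sources\<close>

definition partial_deriv :: "nat \<Rightarrow> ((nat \<Rightarrow> complex) \<Rightarrow> complex) \<Rightarrow> (nat \<Rightarrow> complex) \<Rightarrow> complex" where
  "partial_deriv i f x = deriv (\<lambda>z. f (x(i := z))) (x i)"

text \<open>The functions that the recursion runs on. By the Ward identity, \<open>off_avg\<close> extends the divided difference of \<open>diag_avg\<close> for two
indices to an entire function of the sources, also where \<open>x i = x j\<close>.\<close>
definition diag_avg :: "complex mat measure \<Rightarrow> nat \<Rightarrow> (nat \<Rightarrow> real) \<Rightarrow> nat \<Rightarrow> nat \<Rightarrow> (nat \<Rightarrow> complex) \<Rightarrow> complex" where
  "diag_avg m n lam k i x = (\<integral>U. pow_entry n lam k i i U * tilt n lam x U \<partial>m)"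

definition off_avg :: "complex mat measure \<Rightarrow> nat \<Rightarrow> (nat \<Rightarrow> real) \<Rightarrow> nat \<Rightarrow> nat \<Rightarrow> nat \<Rightarrow> (nat \<Rightarrow> complex) \<Rightarrow> complex" where
  "off_avg m n lam k i j x = (\<integral>U. pow_entry n lam k j i U * pow_entry n lam 1 i j U * tilt n lam x U \<partial>m)"

lemma exp_sum_le:
  fixes t :: "nat \<Rightarrow> real"
  assumes "r \<ge> 1"
  shows "exp (\<Sum>a<r. t a) \<le> (\<Sum>a<r. exp (real r * t a))"
proof -
  have ne: "t ` {..<r} \<noteq> {}" "finite (t ` {..<r})" using assms by (auto simp: lessThan_empty_iff)
  obtain b where b: "b < r" "t b = Max (t ` {..<r})" using Max_in[OF ne(2,1)] by auto
  have "(\<Sum>a<r. t a) \<le> real (card {..<r}) * t b"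
    by (rule sum_bounded_above) (use b ne in auto)
  then have "exp (\<Sum>a<r. t a) \<le> exp (real r * t b)" by simp
  also have "\<dots> \<le> (\<Sum>a<r. exp (real r * t a))" using b by (intro member_le_sum) auto
  finally show ?thesis .
qed

lemma sum_lessThan_split:
  fixes f :: "nat \<Rightarrow> 'b :: comm_monoid_add"
  assumes "r \<le> n" shows "(\<Sum>a<n. f a) = (\<Sum>a<r. f a) + (\<Sum>a\<in>{r..<n}. f a)"
proof -
  have "(\<Sum>a\<in>{..<r} \<union> {r..<n}. f a) = (\<Sum>a<r. f a) + (\<Sum>a\<in>{r..<n}. f a)"
    by (rule sum.union_disjoint) auto
  moreover have "{..<r} \<union> {r..<n} = {..<n}" using assms by auto
  ultimately show ?thesis by simp
qed

context haar_unitary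
begin

lemma norm_pow_entry_mult_le:
  assumes "U \<in> unitary_group n" "a < n" "b < n" "a' < n" "b' < n"
  shows "norm (pow_entry n lam k a b U * pow_entry n lam k' a' b' U) \<le> (\<Sum>l<n. \<bar>lam l\<bar> ^ k) * (\<Sum>l<n. \<bar>lam l\<bar> ^ k')"
  unfolding norm_mult using assms by (intro mult_mono norm_pow_entry_le sum_nonneg) auto

lemma diag_avg_0: "i < n \<Longrightarrow> diag_avg m n lam 0 i x = HC m n x lam"
  unfolding diag_avg_def HC_eq_integral_tilt
  by (intro Bochner_Integration.integral_cong) (auto simp: space_haar pow_entry_0)

lemma off_avg_0:
  assumes "i < n" "j < n" "i \<noteq> j" shows "off_avg m n lam 0 i j x = 0"
proof -
  have "off_avg m n lam 0 i j x = (\<integral>U. 0 \<partial>m)"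
    unfolding off_avg_def by (intro Bochner_Integration.integral_cong) (use assms in \<open>auto simp: space_haar pow_entry_0\<close>)
  then show ?thesis by simp
qed

lemma ward:
  assumes "i < n" "j < n" "i \<noteq> j"
  shows "(x i - x j) * off_avg m n lam k i j x = diag_avg m n lam k i x - diag_avg m n lam k j x"
  unfolding off_avg_def diag_avg_def by (rule ward_identity[OF assms])

lemma diag_avg_swap:
  assumes "i < n" "j < n" "x i = x j"
  shows "diag_avg m n lam k i x = diag_avg m n lam k j x"
  using ward[of i j x lam k] assms by (cases "i = j") auto

lemma off_avg_swap:
  assumes "i < n" "j < n" "j' < n" "i \<noteq> j" "i \<noteq> j'" "x j = x j'"
  shows "off_avg m n lam k i j x = off_avg m n lam k i j' x"
  unfolding off_avg_def by (rule integral_swap[OF assms])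

lemma diag_avg_has_deriv:
  assumes "i < n" "l < n"
  shows "((\<lambda>z. diag_avg m n lam k i (x(l := z))) has_field_derivative
     (\<integral>U. pow_entry n lam k i i U * pow_entry n lam 1 l l U * tilt n lam (x(l := z)) U \<partial>m)) (at z)"
  unfolding diag_avg_def
  by (rule has_field_derivative_integral_tilt) (use assms norm_pow_entry_le in auto)

lemma diag_avg_entire:
  assumes "i < n" "l < n" shows "(\<lambda>z. diag_avg m n lam k i (x(l := z))) holomorphic_on S"
  unfolding holomorphic_on_def field_differentiable_def
  using has_field_derivative_at_within[OF diag_avg_has_deriv[OF assms]] by blast

lemma off_avg_entire:
  assumes "i < n" "j < n" "l < n" shows "(\<lambda>z. off_avg m n lam k i j (x(l := z))) holomorphic_on S"
proof -
  have "((\<lambda>z. off_avg m n lam k i j (x(l := z))) has_field_derivative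
     (\<integral>U. (pow_entry n lam k j i U * pow_entry n lam 1 i j U) * pow_entry n lam 1 l l U * tilt n lam (x(l := z)) U \<partial>m)) (at z)" for z
    unfolding off_avg_def
    by (rule has_field_derivative_integral_tilt[OF _ norm_pow_entry_mult_le]) (use assms in auto)
  then show ?thesis
    unfolding holomorphic_on_def field_differentiable_def using has_field_derivative_at_within by blast
qed

text \<open>Expand \<open>B^(k+1) = B * B^k\<close>; the diagonal term of the sum is the derivative in \<open>x i\<close>.\<close>
lemma diag_avg_Suc:
  assumes i: "i < n"
  shows "diag_avg m n lam (Suc k) i x =
    partial_deriv i (diag_avg m n lam k i) x + (\<Sum>j\<in>{..<n} - {i}. off_avg m n lam k i j x)"
proof -
  let ?P = "pow_entry n lam"
  let ?f = "\<lambda>j U. ?P k j i U * ?P 1 i j U * tilt n lam x U"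
  have int: "integrable m (?f j)" if "j < n" for j
    by (rule integrable_times_tilt[OF _ norm_pow_entry_mult_le]) (use i that in auto)
  have "diag_avg m n lam (Suc k) i x = (\<integral>U. (\<Sum>j<n. ?f j U) \<partial>m)"
    unfolding diag_avg_def
  proof (rule Bochner_Integration.integral_cong[OF refl])
    fix U assume "U \<in> space m"
    then have U: "U \<in> unitary_group n" by (simp add: space_haar)
    have "?P (Suc k) i i U = (\<Sum>j<n. ?P 1 i j U * ?P k j i U)"
      using pow_entry_mult[OF U i i, of lam 1 k] by simp
    also have "\<dots> = (\<Sum>j<n. ?P k j i U * ?P 1 i j U)" by (simp only: mult.commute)
    finally show "?P (Suc k) i i U * tilt n lam x U = (\<Sum>j<n. ?f j U)" by (simp only: sum_distrib_right)
  qed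
  also have "\<dots> = (\<Sum>j<n. \<integral>U. ?f j U \<partial>m)" using int by (intro Bochner_Integration.integral_sum) auto
  also have "\<dots> = (\<integral>U. ?f i U \<partial>m) + (\<Sum>j\<in>{..<n} - {i}. \<integral>U. ?f j U \<partial>m)"
    using i by (intro sum.remove) auto
  also have "(\<integral>U. ?f i U \<partial>m) = partial_deriv i (diag_avg m n lam k i) x"
    unfolding partial_deriv_def using DERIV_imp_deriv[OF diag_avg_has_deriv[OF i i, of lam k x "x i"]] by simp
  finally show ?thesis by (simp add: off_avg_def)
qed

lemma diag_avg_Suc_finite_rank:
  assumes i: "i < r" and r: "r < n" and x: "\<And>a. a \<ge> r \<Longrightarrow> x a = 0"
  shows "diag_avg m n lam (Suc k) i x =
    partial_deriv i (diag_avg m n lam k i) x + (\<Sum>j\<in>{..<r} - {i}. off_avg m n lam k i j x)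
    + of_nat (n - r) * off_avg m n lam k i r x"
proof -
  have i': "i < n" using i r by simp
  have "(\<Sum>j\<in>{..<n} - {i}. off_avg m n lam k i j x) =
     (\<Sum>j\<in>{..<r} - {i}. off_avg m n lam k i j x) + (\<Sum>j\<in>{r..<n}. off_avg m n lam k i j x)"
    using i i' sum_lessThan_split[of r n "\<lambda>j. off_avg m n lam k i j x"] r by (simp add: sum_diff1)
  also have "(\<Sum>j\<in>{r..<n}. off_avg m n lam k i j x) = (\<Sum>j\<in>{r..<n}. off_avg m n lam k i r x)"
    by (intro sum.cong refl off_avg_swap) (use i r x in auto)
  finally show ?thesis unfolding diag_avg_Suc[OF i'] by (simp add: add.assoc)
qed

lemma sum_diag_avg:
  "(\<Sum>i<n. diag_avg m n lam k i x) = (\<Sum>l<n. of_real (lam l) ^ k) * HC m n x lam"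
proof -
  have int: "integrable m (\<lambda>U. pow_entry n lam k i i U * tilt n lam x U)" if "i < n" for i
    by (rule integrable_times_tilt) (use that norm_pow_entry_le in auto)
  have "(\<Sum>i<n. diag_avg m n lam k i x) = (\<integral>U. (\<Sum>i<n. pow_entry n lam k i i U * tilt n lam x U) \<partial>m)"
    unfolding diag_avg_def using int by (intro Bochner_Integration.integral_sum[symmetric]) auto
  also have "\<dots> = (\<integral>U. (\<Sum>l<n. of_real (lam l) ^ k) * tilt n lam x U \<partial>m)"
    by (intro Bochner_Integration.integral_cong)
       (auto simp: space_haar sum_distrib_right[symmetric] pow_entry_trace)
  finally show ?thesis by (simp add: HC_eq_integral_tilt)
qed

lemma sum_diag_avg_finite_rank:
  assumes r: "r < n" and x: "\<And>a. a \<ge> r \<Longrightarrow> x a = 0"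
  shows "(\<Sum>l<n. of_real (lam l) ^ k) * HC m n x lam =
    (\<Sum>i<r. diag_avg m n lam k i x) + of_nat (n - r) * diag_avg m n lam k r x"
proof -
  have "(\<Sum>i<n. diag_avg m n lam k i x) =
     (\<Sum>i<r. diag_avg m n lam k i x) + (\<Sum>i\<in>{r..<n}. diag_avg m n lam k i x)"
    using r by (intro sum_lessThan_split) simp
  also have "(\<Sum>i\<in>{r..<n}. diag_avg m n lam k i x) = (\<Sum>i\<in>{r..<n}. diag_avg m n lam k r x)"
    by (intro sum.cong refl diag_avg_swap) (use r x in auto)
  finally show ?thesis by (simp add: sum_diag_avg)
qed

lemma HC_0: "HC m n (\<lambda>_. 0) lam = 1"
proof -
  have "tilt n lam (\<lambda>_. 0) = (\<lambda>U. 1)" by (simp add: fun_eq_iff tilt_def)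
  then show ?thesis by (simp add: HC_eq_integral_tilt prob_space)
qed

text \<open>Bounds the integral on a whole polydisc by its values at finitely many points on the coordinate axes, so that integrability at those
points yields one dominating function for the polydisc. The diagonal entries of \<open>B\<close> are real, so only
the real parts of the sources count, and the exponential of a sum of \<open>r\<close> terms is at most the sum of the
exponentials of \<open>r\<close> times each term (\<open>exp_sum_le\<close>).\<close>
lemma norm_HC_le:
  assumes r: "1 \<le> r" "r \<le> n" and x: "\<And>a. a < r \<Longrightarrow> norm (x a) \<le> e" "\<And>a. a \<ge> r \<Longrightarrow> x a = 0"
  shows "norm (HC m n x lam) \<le> (\<Sum>l<r. norm (HC m n ((\<lambda>_. 0)(l := of_real (real r * e))) lam)
      + norm (HC m n ((\<lambda>_. 0)(l := - of_real (real r * e))) lam))"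
proof -
  let ?b = "\<lambda>a U. Re (pow_entry n lam 1 a a U)"
  let ?\<rho> = "real r * e"
  have re: "pow_entry n lam 1 a a U = of_real (?b a U)" for a U
    using cnj_pow_entry[of n lam 1 a a U] by (simp add: complex_eq_iff)
  have int: "integrable m (\<lambda>U. tilt n lam y U)" for y
    using integrable_times_tilt[of "\<lambda>_. 1" 1 lam y] by simp
  have one: "tilt n lam ((\<lambda>_. 0)(l := of_real s)) U = of_real (exp (s * ?b l U))" if "l < n" for l s U
  proof -
    have "(\<Sum>a<n. ((\<lambda>_. 0)(l := complex_of_real s)) a * pow_entry n lam 1 a a U) = of_real s * pow_entry n lam 1 l l U"
      using that by (subst sum.remove[of _ l]) auto
    then show ?thesis unfolding tilt_def by (subst (asm) re) (simp add: exp_of_real[symmetric])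
  qed
  have inte: "integrable m (\<lambda>U. exp (s * ?b l U))" if "l < n" for l s
    using int[of "(\<lambda>_. 0)(l := of_real s)"] unfolding one[OF that] by (simp only: complex_of_real_integrable_eq)
  have eq: "(\<integral>U. exp (s * ?b l U) \<partial>m) \<le> norm (HC m n ((\<lambda>_. 0)(l := of_real s)) lam)" if "l < n" for l s
  proof -
    have "HC m n ((\<lambda>_. 0)(l := of_real s)) lam = of_real (\<integral>U. exp (s * ?b l U) \<partial>m)"
      unfolding HC_eq_integral_tilt one[OF that] by simp
    then show ?thesis by simp
  qed
  have pt: "norm (tilt n lam x U) \<le> (\<Sum>l<r. exp (?\<rho> * ?b l U) + exp ((- ?\<rho>) * ?b l U))" for U
  proof -
    have "(\<Sum>a<n. x a * pow_entry n lam 1 a a U) =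
        (\<Sum>a<r. x a * pow_entry n lam 1 a a U) + (\<Sum>a\<in>{r..<n}. x a * pow_entry n lam 1 a a U)"
      using r by (intro sum_lessThan_split) simp
    then have "(\<Sum>a<n. x a * pow_entry n lam 1 a a U) = (\<Sum>a<r. x a * pow_entry n lam 1 a a U)"
      using x(2) by simp
    then have "Re (\<Sum>a<n. x a * pow_entry n lam 1 a a U) = (\<Sum>a<r. Re (x a) * ?b a U)"
      by (simp only: Re_sum) (subst re, simp)
    then have "norm (tilt n lam x U) = exp (\<Sum>a<r. Re (x a) * ?b a U)" by (simp add: tilt_def)
    also have "\<dots> \<le> (\<Sum>a<r. exp (real r * (Re (x a) * ?b a U)))" by (rule exp_sum_le[OF r(1)])
    also have "\<dots> \<le> (\<Sum>l<r. exp (?\<rho> * ?b l U) + exp ((- ?\<rho>) * ?b l U))"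
    proof (rule sum_mono)
      fix a assume "a \<in> {..<r}"
      then have "\<bar>Re (x a)\<bar> \<le> e" using x(1)[of a] abs_Re_le_cmod[of "x a"] by auto
      then have "\<bar>Re (x a) * ?b a U\<bar> \<le> e * \<bar>?b a U\<bar>" unfolding abs_mult by (intro mult_right_mono) auto
      then have "real r * (Re (x a) * ?b a U) \<le> real r * (e * \<bar>?b a U\<bar>)"
        by (intro mult_left_mono) auto
      then have *: "exp (real r * (Re (x a) * ?b a U)) \<le> exp (real r * (e * \<bar>?b a U\<bar>))" by simp
      show "exp (real r * (Re (x a) * ?b a U)) \<le> exp (?\<rho> * ?b a U) + exp ((- ?\<rho>) * ?b a U)"
      proof (cases "?b a U \<ge> 0")
        case True
        then have "real r * (e * \<bar>?b a U\<bar>) = ?\<rho> * ?b a U" by simp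
        from *[unfolded this] show ?thesis by (rule add_increasing2[OF exp_ge_zero])
      next
        case False
        then have "real r * (e * \<bar>?b a U\<bar>) = (- ?\<rho>) * ?b a U" by simp
        from *[unfolded this] show ?thesis by (rule add_increasing[OF exp_ge_zero])
      qed
    qed
    finally show ?thesis .
  qed
  have ints: "integrable m (\<lambda>U. exp (?\<rho> * ?b l U) + exp ((- ?\<rho>) * ?b l U))" if "l < r" for l
    using that r by (intro Bochner_Integration.integrable_add inte) auto
  have "norm (HC m n x lam) \<le> (\<integral>U. norm (tilt n lam x U) \<partial>m)"
    unfolding HC_eq_integral_tilt by (rule integral_norm_bound)
  also have "\<dots> \<le> (\<integral>U. (\<Sum>l<r. exp (?\<rho> * ?b l U) + exp ((- ?\<rho>) * ?b l U)) \<partial>m)"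
    by (intro integral_mono integrable_norm int Bochner_Integration.integrable_sum ints pt) auto
  also have "\<dots> = (\<Sum>l<r. (\<integral>U. exp (?\<rho> * ?b l U) + exp ((- ?\<rho>) * ?b l U) \<partial>m))"
    by (intro Bochner_Integration.integral_sum ints) auto
  also have "\<dots> = (\<Sum>l<r. (\<integral>U. exp (?\<rho> * ?b l U) \<partial>m) + (\<integral>U. exp ((- ?\<rho>) * ?b l U) \<partial>m))"
    by (intro sum.cong refl Bochner_Integration.integral_add inte) (use r in auto)
  also have "\<dots> \<le> (\<Sum>l<r. norm (HC m n ((\<lambda>_. 0)(l := of_real ?\<rho>)) lam)
      + norm (HC m n ((\<lambda>_. 0)(l := of_real (- ?\<rho>))) lam))"
    by (intro sum_mono add_mono eq) (use r in auto)
  finally show ?thesis by simp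
qed

end

text \<open>The condition that lets one interchange the expectation with derivatives in the sources.\<close>
definition dominated_on :: "'a measure \<Rightarrow> nat \<Rightarrow> real \<Rightarrow> ('a \<Rightarrow> (nat \<Rightarrow> complex) \<Rightarrow> complex) \<Rightarrow> bool" where
  "dominated_on P r e h \<longleftrightarrow> (\<forall>x\<in>polydisc r e. (\<lambda>\<omega>. h \<omega> x) \<in> borel_measurable P) \<and>
     (\<exists>D. integrable P D \<and> (\<forall>\<omega>\<in>space P. \<forall>x\<in>polydisc r e. norm (h \<omega> x) \<le> D \<omega>))"

lemma dominated_on_integrable:
  "dominated_on P r e h \<Longrightarrow> x \<in> polydisc r e \<Longrightarrow> integrable P (\<lambda>\<omega>. h \<omega> x)"
  unfolding dominated_on_def
  by (elim conjE exE) (rule Bochner_Integration.integrable_bound, auto intro!: AE_I2 order_trans[OF _ abs_ge_self])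

lemma polydisc_mono: "r \<le> r' \<Longrightarrow> e \<le> e' \<Longrightarrow> 0 < e' \<Longrightarrow> polydisc r e \<subseteq> polydisc r' e'"
  by (auto simp: polydisc_def) (metis leI norm_zero order_less_le_trans)

lemma dominated_on_mono:
  "dominated_on P r' e' h \<Longrightarrow> r \<le> r' \<Longrightarrow> e \<le> e' \<Longrightarrow> 0 < e' \<Longrightarrow> dominated_on P r e h"
  unfolding dominated_on_def using polydisc_mono[of r r' e e'] by blast

lemma polydisc_update: "x \<in> polydisc r e \<Longrightarrow> i < r \<Longrightarrow> norm z < e \<Longrightarrow> x(i := z) \<in> polydisc r e"
  by (auto simp: polydisc_def)

lemma polydisc_norm: "x \<in> polydisc r e \<Longrightarrow> 0 < e \<Longrightarrow> norm (x j) < e"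
  by (cases "j < r") (auto simp: polydisc_def)

lemma dominated_on_cong:
  assumes "dominated_on P r e h" "\<And>\<omega> x. \<omega> \<in> space P \<Longrightarrow> x \<in> polydisc r e \<Longrightarrow> h \<omega> x = h' \<omega> x"
  shows "dominated_on P r e h'"
  using assms unfolding dominated_on_def by (auto cong: measurable_cong)

lemma dominated_on_add:
  assumes "dominated_on P r e f" "dominated_on P r e g"
  shows "dominated_on P r e (\<lambda>\<omega> x. f \<omega> x + g \<omega> x)"
proof -
  obtain D1 D2 where "integrable P D1" "\<forall>\<omega>\<in>space P. \<forall>x\<in>polydisc r e. norm (f \<omega> x) \<le> D1 \<omega>"
    "integrable P D2" "\<forall>\<omega>\<in>space P. \<forall>x\<in>polydisc r e. norm (g \<omega> x) \<le> D2 \<omega>"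
    using assms unfolding dominated_on_def by auto
  then have "integrable P (\<lambda>\<omega>. D1 \<omega> + D2 \<omega>) \<and> (\<forall>\<omega>\<in>space P. \<forall>x\<in>polydisc r e. norm (f \<omega> x + g \<omega> x) \<le> D1 \<omega> + D2 \<omega>)"
    by (auto intro!: norm_triangle_mono)
  moreover have "\<forall>x\<in>polydisc r e. (\<lambda>\<omega>. f \<omega> x + g \<omega> x) \<in> borel_measurable P"
    using assms unfolding dominated_on_def by (auto intro: borel_measurable_add borel_measurable_times)
  ultimately show ?thesis unfolding dominated_on_def by blast
qed

lemma dominated_on_cmult:
  assumes "dominated_on P r e f" shows "dominated_on P r e (\<lambda>\<omega> x. c * f \<omega> x)"
proof -
  obtain D where "integrable P D" "\<forall>\<omega>\<in>space P. \<forall>x\<in>polydisc r e. norm (f \<omega> x) \<le> D \<omega>"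
    using assms unfolding dominated_on_def by auto
  then have "integrable P (\<lambda>\<omega>. norm c * D \<omega>) \<and> (\<forall>\<omega>\<in>space P. \<forall>x\<in>polydisc r e. norm (c * f \<omega> x) \<le> norm c * D \<omega>)"
    by (auto simp: norm_mult intro!: mult_left_mono)
  moreover have "\<forall>x\<in>polydisc r e. (\<lambda>\<omega>. c * f \<omega> x) \<in> borel_measurable P"
    using assms unfolding dominated_on_def by (auto intro: borel_measurable_add borel_measurable_times)
  ultimately show ?thesis unfolding dominated_on_def by blast
qed

lemma dominated_on_sum:
  assumes "finite A" "\<And>j. j \<in> A \<Longrightarrow> dominated_on P r e (f j)"
  shows "dominated_on P r e (\<lambda>\<omega> x. \<Sum>j\<in>A. f j \<omega> x)"
  using assms
proof (induction A rule: finite_induct)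
  case empty
  show ?case unfolding dominated_on_def by (auto intro!: exI[of _ "\<lambda>_. 0"])
next
  case (insert a A)
  then show ?case using dominated_on_add[of P r e "f a" "\<lambda>\<omega> x. \<Sum>j\<in>A. f j \<omega> x"] by simp
qed

lemma
  fixes h :: "'a \<Rightarrow> (nat \<Rightarrow> complex) \<Rightarrow> complex"
  assumes dom: "dominated_on P r e h" and i: "i < r"
    and hol: "\<And>\<omega> x. \<omega> \<in> space P \<Longrightarrow> (\<lambda>z. h \<omega> (x(i := z))) holomorphic_on ball 0 e"
  shows has_field_derivative_expectation:
      "x \<in> polydisc r e \<Longrightarrow> norm z < e \<Longrightarrow> ((\<lambda>z. \<integral>\<omega>. h \<omega> (x(i := z)) \<partial>P) has_field_derivative
         (\<integral>\<omega>. partial_deriv i (h \<omega>) (x(i := z)) \<partial>P)) (at z)"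
    and dominated_on_partial_deriv: "dominated_on P r (e / 2) (\<lambda>\<omega>. partial_deriv i (h \<omega>))"
proof -
  obtain D where D: "integrable P D" "\<And>\<omega> x. \<omega> \<in> space P \<Longrightarrow> x \<in> polydisc r e \<Longrightarrow> norm (h \<omega> x) \<le> D \<omega>"
    using dom unfolding dominated_on_def by auto
  note H = holomorphic_integral_dominated[where M = P and g = "\<lambda>\<omega> z. h \<omega> (_(i := z))" and a = 0 and r = e and D = D,
      OF hol _ _ D(1)]
  have pd: "partial_deriv i f (x(i := z)) = deriv (\<lambda>z. f (x(i := z))) z" for f x z
    by (simp add: partial_deriv_def)
  have m: "(\<lambda>\<omega>. h \<omega> (x(i := z))) \<in> borel_measurable P" if "x \<in> polydisc r e" "z \<in> ball 0 e" for x z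
    using dom polydisc_update[OF that(1) i, of z] that unfolding dominated_on_def by auto
  have b: "norm (h \<omega> (x(i := z))) \<le> D \<omega>" if "x \<in> polydisc r e" "z \<in> ball 0 e" "\<omega> \<in> space P" for x z \<omega>
    using D(2)[OF that(3)] polydisc_update[OF that(1) i, of z] that by auto
  show "((\<lambda>z. \<integral>\<omega>. h \<omega> (x(i := z)) \<partial>P) has_field_derivative
         (\<integral>\<omega>. partial_deriv i (h \<omega>) (x(i := z)) \<partial>P)) (at z)" if "x \<in> polydisc r e" "norm z < e" for x z
    unfolding pd by (rule H(1)) (use m b that in auto)
  show "dominated_on P r (e / 2) (\<lambda>\<omega>. partial_deriv i (h \<omega>))"
    unfolding dominated_on_def
  proof (intro conjI ballI exI[of _ "\<lambda>\<omega>. 4 * D \<omega> / e"])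
    show "integrable P (\<lambda>\<omega>. 4 * D \<omega> / e)" using D by auto
    fix x assume x: "x \<in> polydisc r (e/2)"
    have z: "norm (x i) < e / 2" using x i by (auto simp: polydisc_def)
    then have e: "e > 0" using norm_ge_zero[of "x i"] by linarith
    have x': "x \<in> polydisc r e" using polydisc_mono[of r r "e/2" e] x e by auto
    show "(\<lambda>\<omega>. partial_deriv i (h \<omega>) x) \<in> borel_measurable P"
      unfolding partial_deriv_def by (rule H(2)) (use m b x' z e in auto)
    fix \<omega> assume w: "\<omega> \<in> space P"
    show "norm (partial_deriv i (h \<omega>) x) \<le> 4 * D \<omega> / e"
      unfolding partial_deriv_def by (rule norm_deriv_le_ball[OF hol[OF w]]) (use b[OF x'] w z in auto)
  qed
qed

text \<open>The bound is that of \<open>norm_quotient_le_ball\<close>. Where \<open>x i = x j\<close>, measurability is obtained by moving \<open>x i\<close> slightly and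
passing to the limit.\<close>
lemma dominated_on_quotient:
  fixes q :: "'a \<Rightarrow> (nat \<Rightarrow> complex) \<Rightarrow> complex"
  assumes p: "dominated_on P r e p" and i: "i < r" and ij: "i \<noteq> j"
    and hol: "\<And>\<omega> x. \<omega> \<in> space P \<Longrightarrow> (\<lambda>z. q \<omega> (x(i := z))) holomorphic_on ball 0 e"
    and eq: "\<And>\<omega> x. \<omega> \<in> space P \<Longrightarrow> x \<in> polydisc r e \<Longrightarrow> (x i - x j) * q \<omega> x = p \<omega> x"
  shows "dominated_on P r (e / 2) q"
proof -
  obtain D where D: "integrable P D" "\<And>\<omega> x. \<omega> \<in> space P \<Longrightarrow> x \<in> polydisc r e \<Longrightarrow> norm (p \<omega> x) \<le> D \<omega>"
    using p unfolding dominated_on_def by auto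
  show ?thesis
    unfolding dominated_on_def
  proof (intro conjI ballI exI[of _ "\<lambda>\<omega>. 4 * D \<omega> / e"])
    show "integrable P (\<lambda>\<omega>. 4 * D \<omega> / e)" using D by auto
    fix x assume x: "x \<in> polydisc r (e/2)"
    have z: "norm (x i) < e / 2" using x i by (auto simp: polydisc_def)
    then have e: "e > 0" using norm_ge_zero[of "x i"] by linarith
    have zj: "norm (x j) < e / 2" using polydisc_norm[OF x] e by auto
    have x': "x \<in> polydisc r e" using polydisc_mono[of r r "e/2" e] x e by auto
    have eq': "(z - x j) * q \<omega> (x(i := z)) = p \<omega> (x(i := z))" if "norm z < e" "\<omega> \<in> space P" for z \<omega>
      using eq[OF that(2) polydisc_update[OF x' i that(1)]] ij by simp
    {
      fix \<omega> assume w: "\<omega> \<in> space P"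
      have "norm (q \<omega> (x(i := x i))) \<le> 4 * D \<omega> / e"
        by (rule norm_quotient_le_ball[OF hol[OF w] _ zj z])
           (use D(2)[OF w polydisc_update[OF x' i]] eq'[OF _ w] in auto)
      then show "norm (q \<omega> x) \<le> 4 * D \<omega> / e" by simp
    }
    have meas: "(\<lambda>\<omega>. q \<omega> (x(i := z))) \<in> borel_measurable P" if "norm z < e" "z \<noteq> x j" for z
    proof -
      have "(\<lambda>\<omega>. p \<omega> (x(i := z))) \<in> borel_measurable P"
        using p polydisc_update[OF x' i that(1)] unfolding dominated_on_def by auto
      then have "(\<lambda>\<omega>. p \<omega> (x(i := z)) / (z - x j)) \<in> borel_measurable P" by measurable
      moreover have "q \<omega> (x(i := z)) = p \<omega> (x(i := z)) / (z - x j)" if "\<omega> \<in> space P" for \<omega>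
        using eq'[OF \<open>norm z < e\<close> that] \<open>z \<noteq> x j\<close> by (simp add: field_simps)
      ultimately show ?thesis by (simp cong: measurable_cong)
    qed
    show "(\<lambda>\<omega>. q \<omega> x) \<in> borel_measurable P"
    proof (cases "x i = x j")
      case False
      then show ?thesis using meas[of "x i"] z e by simp
    next
      case True
      define d where "d = e - norm (x i)"
      have d: "d > 0" using z e by (auto simp: d_def)
      obtain X where X0: "\<And>n. X n \<noteq> x i" "\<And>n. X n \<in> ball (x i) d" and X: "X \<longlonglongrightarrow> x i"
        using punctured_sequence[OF d] by blast
      have Xn: "X n \<noteq> x j" "norm (X n) < e" for n
        using X0[of n] True norm_triangle_sub[of "X n" "x i"]
        by (auto simp: d_def dist_norm norm_minus_commute)
      show ?thesis
      proof (rule borel_measurable_LIMSEQ_metric)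
        show "(\<lambda>\<omega>. q \<omega> (x(i := X n))) \<in> borel_measurable P" for n by (rule meas[OF Xn(2,1)])
        fix \<omega> assume w: "\<omega> \<in> space P"
        have "isCont (\<lambda>z. q \<omega> (x(i := z))) (x i)"
          using holomorphic_on_imp_continuous_on[OF hol[OF w]] z e
          by (simp add: continuous_on_eq_continuous_at)
        from isCont_tendsto_compose[OF this X] show "(\<lambda>n. q \<omega> (x(i := X n))) \<longlonglongrightarrow> q \<omega> x" by simp
      qed
    qed
  qed
qed

section \<open>Functions on polydiscs and their uniform limits\<close>

text \<open>Only one variable at a time: all derivatives and quotients below are taken in a single coordinate.\<close>
definition holo_in :: "nat \<Rightarrow> nat \<Rightarrow> real \<Rightarrow> ((nat \<Rightarrow> complex) \<Rightarrow> complex) \<Rightarrow> bool" where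
  "holo_in i r e f \<longleftrightarrow> (\<forall>x\<in>polydisc r e. (\<lambda>z. f (x(i := z))) holomorphic_on ball 0 e)"

lemma holo_in_mono:
  assumes "holo_in i r' e' f" "r \<le> r'" "e \<le> e'" "0 < e'"
  shows "holo_in i r e f"
  unfolding holo_in_def
proof
  fix x assume "x \<in> polydisc r e"
  then have "x \<in> polydisc r' e'" using polydisc_mono[OF assms(2-4)] by blast
  then have "(\<lambda>z. f (x(i := z))) holomorphic_on ball 0 e'" using assms(1) by (simp add: holo_in_def)
  then show "(\<lambda>z. f (x(i := z))) holomorphic_on ball 0 e"
    by (rule holomorphic_on_subset) (use assms in auto)
qed

lemma holo_in_const: "holo_in i r e (\<lambda>x. c)"
  by (simp add: holo_in_def)

lemma holo_in_mult: "holo_in i r e f \<Longrightarrow> holo_in i r e g \<Longrightarrow> holo_in i r e (\<lambda>x. f x * g x)"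
  by (auto simp: holo_in_def intro: holomorphic_intros)

lemma holo_in_divide:
  assumes "holo_in i r e f" "holo_in i r e g" "i < r" "\<And>x. x \<in> polydisc r e \<Longrightarrow> g x \<noteq> 0"
  shows "holo_in i r e (\<lambda>x. f x / g x)"
  using assms polydisc_update unfolding holo_in_def
  by (auto intro!: holomorphic_on_divide)

lemma holo_in_coordinate:
  assumes "f holomorphic_on S" "ball 0 e \<subseteq> S" "i < r"
  shows "holo_in i r e (\<lambda>x. f (x i))"
  using assms by (auto simp: holo_in_def intro: holomorphic_on_subset)

lemma polydisc_coord_in_ball: "x \<in> polydisc r e \<Longrightarrow> i < r \<Longrightarrow> x i \<in> ball 0 e"
  by (auto simp: polydisc_def)

lemma holo_in_differentiable:
  assumes "holo_in i r e f" "x \<in> polydisc r e" "i < r"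
  shows "(\<lambda>z. f (x(i := z))) field_differentiable at (x i)"
  using assms polydisc_coord_in_ball[OF assms(2,3)] unfolding holo_in_def
  by (metis holomorphic_on_imp_differentiable_at open_ball)

lemma partial_deriv_mult:
  assumes "holo_in i r e f" "holo_in i r e g" "x \<in> polydisc r e" "i < r"
  shows "partial_deriv i (\<lambda>x. f x * g x) x = partial_deriv i f x * g x + f x * partial_deriv i g x"
  unfolding partial_deriv_def
  using deriv_mult[OF holo_in_differentiable[OF assms(1,3,4)] holo_in_differentiable[OF assms(2,3,4)]]
  by (simp add: add.commute)

lemma partial_deriv_cong:
  assumes "\<And>x. x \<in> polydisc r e \<Longrightarrow> f x = g x" "x \<in> polydisc r e" "i < r"
  shows "partial_deriv i f x = partial_deriv i g x"
  unfolding partial_deriv_def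
proof (rule deriv_cong_ev)
  have "\<forall>\<^sub>F z in nhds (x i). z \<in> ball 0 e"
    using polydisc_coord_in_ball[OF assms(2,3)] eventually_nhds_in_open open_ball by blast
  then show "\<forall>\<^sub>F z in nhds (x i). f (x(i := z)) = g (x(i := z))"
    by eventually_elim (use assms polydisc_update in auto)
qed simp

lemma norm_partial_deriv_diff_le:
  assumes f: "holo_in i r e f" and g: "holo_in i r e g" and i: "i < r" and e: "0 < e"
    and bd: "\<And>x. x \<in> polydisc r e \<Longrightarrow> norm (f x - g x) \<le> C" and x: "x \<in> polydisc r (e / 2)"
  shows "norm (partial_deriv i f x - partial_deriv i g x) \<le> 4 * C / e"
proof -
  have x': "x \<in> polydisc r e" using x polydisc_mono[of r r "e/2" e] e by auto
  have "norm (deriv (\<lambda>z. f (x(i := z)) - g (x(i := z))) (x i)) \<le> 4 * C / e"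
    by (rule norm_deriv_le_ball[where f = "\<lambda>z. f (x(i := z)) - g (x(i := z))"])
       (use f g x' x i bd polydisc_update[OF x' i] in \<open>auto simp: holo_in_def polydisc_def intro!: holomorphic_intros\<close>)
  then show ?thesis
    unfolding partial_deriv_def
    using deriv_diff[OF holo_in_differentiable[OF f x' i] holo_in_differentiable[OF g x' i]] by simp
qed

lemma norm_quotient_le:
  assumes q: "holo_in i r e q" and ij: "i < r" "i \<noteq> j" and e: "0 < e"
    and bd: "\<And>x. x \<in> polydisc r e \<Longrightarrow> norm ((x i - x j) * q x) \<le> C" and x: "x \<in> polydisc r (e / 2)"
  shows "norm (q x) \<le> 4 * C / e"
proof -
  have x': "x \<in> polydisc r e" using x polydisc_mono[of r r "e/2" e] e by auto
  have "norm (q (x(i := x i))) \<le> 4 * C / e"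
  proof (rule norm_quotient_le_ball[where a = "x j" and q = "\<lambda>z. q (x(i := z))"])
    show "(\<lambda>z. q (x(i := z))) holomorphic_on ball 0 e" using q x' by (simp add: holo_in_def)
    show "norm ((w - x j) * q (x(i := w))) \<le> C" if "norm w < e" for w
      using bd[OF polydisc_update[OF x' ij(1) that]] ij by simp
  qed (use polydisc_norm[OF x] e in auto)
  then show ?thesis by simp
qed

lemma uniform_limit_normD:
  fixes h :: "nat \<Rightarrow> 'b \<Rightarrow> complex"
  assumes "uniform_limit X h g sequentially" "0 < \<epsilon>"
  shows "\<forall>\<^sub>F N in sequentially. \<forall>x\<in>X. norm (h N x - g x) < \<epsilon>"
  using uniform_limitD[OF assms] by (simp add: dist_norm)

lemma uniform_limit_normI:
  fixes h :: "nat \<Rightarrow> 'b \<Rightarrow> complex"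
  assumes "\<And>\<epsilon>. 0 < \<epsilon> \<Longrightarrow> \<forall>\<^sub>F N in sequentially. \<forall>x\<in>X. norm (h N x - g x) < \<epsilon>"
  shows "uniform_limit X h g sequentially"
  using assms by (intro uniform_limitI) (simp add: dist_norm)

lemma uniform_limit_partial_deriv:
  assumes i: "i < r" and e: "0 < e"
    and h: "\<forall>\<^sub>F N in sequentially. holo_in i r e (h N)" and g: "holo_in i r e g"
    and lim: "uniform_limit (polydisc r e) h g sequentially"
  shows "uniform_limit (polydisc r (e / 2)) (\<lambda>N. partial_deriv i (h N)) (partial_deriv i g) sequentially"
proof (rule uniform_limit_normI)
  fix \<epsilon> :: real assume \<epsilon>: "0 < \<epsilon>"
  have "0 < \<epsilon> * e / 8" using \<epsilon> e by simp
  from uniform_limit_normD[OF lim this] h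
  show "\<forall>\<^sub>F N in sequentially. \<forall>x\<in>polydisc r (e / 2). norm (partial_deriv i (h N) x - partial_deriv i g x) < \<epsilon>"
  proof eventually_elim
    case (elim N)
    have "norm (partial_deriv i (h N) x - partial_deriv i g x) \<le> 4 * (\<epsilon> * e / 8) / e" if "x \<in> polydisc r (e / 2)" for x
      by (rule norm_partial_deriv_diff_le[OF elim(2) g i e _ that]) (use elim(1) in \<open>auto intro: less_imp_le\<close>)
    moreover have "4 * (\<epsilon> * e / 8) / e < \<epsilon>" using e \<epsilon> by simp
    ultimately show ?case by (meson le_less_trans)
  qed
qed

text \<open>Uniform convergence of \<open>(x i - x j) * q N x\<close> passes to the quotients themselves because the differences
\<open>q N - q'\<close> are holomorphic in \<open>x i\<close>; the price is half of the radius.\<close>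
lemma uniform_limit_quotient:
  assumes ij: "i < r" "i \<noteq> j" and e: "0 < e"
    and h: "\<forall>\<^sub>F N in sequentially. holo_in i r e (q N)" and g: "holo_in i r e q'"
    and eq: "\<forall>\<^sub>F N in sequentially. \<forall>x\<in>polydisc r e. (x i - x j) * q N x = p N x"
    and eq': "\<And>x. x \<in> polydisc r e \<Longrightarrow> (x i - x j) * q' x = p' x"
    and lim: "uniform_limit (polydisc r e) p p' sequentially"
  shows "uniform_limit (polydisc r (e / 2)) q q' sequentially"
proof (rule uniform_limit_normI)
  fix \<epsilon> :: real assume \<epsilon>: "0 < \<epsilon>"
  have "0 < \<epsilon> * e / 8" using \<epsilon> e by simp
  from uniform_limit_normD[OF lim this] h eq
  show "\<forall>\<^sub>F N in sequentially. \<forall>x\<in>polydisc r (e / 2). norm (q N x - q' x) < \<epsilon>"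
  proof eventually_elim
    case (elim N)
    have hol: "holo_in i r e (\<lambda>x. q N x - q' x)"
      using elim(2) g by (auto simp: holo_in_def intro: holomorphic_intros)
    have "norm (q N x - q' x) \<le> 4 * (\<epsilon> * e / 8) / e" if "x \<in> polydisc r (e / 2)" for x
    proof (rule norm_quotient_le[OF hol ij e _ that])
      fix y assume y: "y \<in> polydisc r e"
      show "norm ((y i - y j) * (q N y - q' y)) \<le> \<epsilon> * e / 8"
        unfolding right_diff_distrib using elim(1,3) eq'[OF y] y by (auto intro: less_imp_le)
    qed
    moreover have "4 * (\<epsilon> * e / 8) / e < \<epsilon>" using e \<epsilon> by simp
    ultimately show ?case by (meson le_less_trans)
  qed
qed

text \<open>Uniform boundedness for all large \<open>N\<close>; enough for terms that carry a prefactor tending to \<open>0\<close>.\<close>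
definition ev_bounded :: "'b set \<Rightarrow> (nat \<Rightarrow> 'b \<Rightarrow> complex) \<Rightarrow> bool" where
  "ev_bounded X h \<longleftrightarrow> (\<exists>C. \<forall>\<^sub>F N in sequentially. \<forall>x\<in>X. norm (h N x) \<le> C)"

lemma ev_bounded_limit:
  assumes "uniform_limit X h g sequentially" "bounded (g ` X)"
  shows "ev_bounded X h"
proof -
  obtain B where B: "\<And>x. x \<in> X \<Longrightarrow> norm (g x) \<le> B" using assms(2) by (auto simp: bounded_iff)
  have "\<forall>\<^sub>F N in sequentially. \<forall>x\<in>X. norm (h N x) \<le> B + 1"
    using uniform_limit_normD[OF assms(1), of 1, simplified]
  proof eventually_elim
    case (elim N)
    show ?case
    proof
      fix x assume x: "x \<in> X"
      have "norm (h N x) \<le> norm (g x) + norm (h N x - g x)"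
        using norm_triangle_sub[of "h N x" "g x"] by simp
      then show "norm (h N x) \<le> B + 1" using B[OF x] elim x by force
    qed
  qed
  then show ?thesis by (auto simp: ev_bounded_def)
qed

lemma ev_bounded_subset: "ev_bounded X h \<Longrightarrow> Y \<subseteq> X \<Longrightarrow> ev_bounded Y h"
  unfolding ev_bounded_def by (elim exE, intro exI) (erule eventually_mono, blast)

lemma ev_bounded_add:
  assumes "ev_bounded X f" "ev_bounded X g" shows "ev_bounded X (\<lambda>N x. f N x + g N x)"
proof -
  obtain A B where "\<forall>\<^sub>F N in sequentially. \<forall>x\<in>X. norm (f N x) \<le> A" "\<forall>\<^sub>F N in sequentially. \<forall>x\<in>X. norm (g N x) \<le> B"
    using assms by (auto simp: ev_bounded_def)
  then have "\<forall>\<^sub>F N in sequentially. \<forall>x\<in>X. norm (f N x + g N x) \<le> A + B"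
    by eventually_elim (auto intro!: norm_triangle_mono)
  then show ?thesis by (auto simp: ev_bounded_def)
qed

lemma ev_bounded_mult:
  assumes "ev_bounded X f" "ev_bounded X g" shows "ev_bounded X (\<lambda>N x. f N x * g N x)"
proof -
  obtain A B where "\<forall>\<^sub>F N in sequentially. \<forall>x\<in>X. norm (f N x) \<le> A" "\<forall>\<^sub>F N in sequentially. \<forall>x\<in>X. norm (g N x) \<le> B"
    using assms by (auto simp: ev_bounded_def)
  then have "\<forall>\<^sub>F N in sequentially. \<forall>x\<in>X. norm (f N x * g N x) \<le> A * B"
    by eventually_elim (auto simp: norm_mult intro!: mult_mono intro: order_trans[OF norm_ge_zero])
  then show ?thesis by (auto simp: ev_bounded_def)
qed

lemma ev_bounded_sum:
  assumes "finite A" "\<And>j. j \<in> A \<Longrightarrow> ev_bounded X (f j)"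
  shows "ev_bounded X (\<lambda>N x. \<Sum>j\<in>A. f j N x)"
  using assms
proof (induction A rule: finite_induct)
  case empty
  show ?case by (auto simp: ev_bounded_def)
next
  case (insert a A)
  then show ?case using ev_bounded_add[of X "f a" "\<lambda>N x. \<Sum>j\<in>A. f j N x"] by simp
qed

lemma uniform_limit_null_mult:
  fixes a :: "nat \<Rightarrow> complex"
  assumes a: "a \<longlonglongrightarrow> 0" and h: "ev_bounded X h"
  shows "uniform_limit X (\<lambda>N x. a N * h N x) (\<lambda>x. 0) sequentially"
proof (rule uniform_limit_normI)
  fix \<epsilon> :: real assume \<epsilon>: "0 < \<epsilon>"
  obtain C where C: "\<forall>\<^sub>F N in sequentially. \<forall>x\<in>X. norm (h N x) \<le> C" using h by (auto simp: ev_bounded_def)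
  define C' where "C' = max C 1"
  have "\<forall>\<^sub>F N in sequentially. norm (a N) < \<epsilon> / C'"
    using tendstoD[OF a, of "\<epsilon> / C'"] \<epsilon> by (auto simp: C'_def)
  with C show "\<forall>\<^sub>F N in sequentially. \<forall>x\<in>X. norm (a N * h N x - 0) < \<epsilon>"
  proof eventually_elim
    case (elim N)
    show ?case
    proof
      fix x assume "x \<in> X"
      then have "norm (a N) * norm (h N x) \<le> norm (a N) * C'"
        using elim(1) by (intro mult_left_mono) (auto simp: C'_def le_max_iff_disj)
      also have "\<dots> < \<epsilon>" using elim(2) by (simp add: C'_def field_simps)
      finally show "norm (a N * h N x - 0) < \<epsilon>" by (simp add: norm_mult)
    qed
  qed
qed

lemma uniform_limit_scalar:
  fixes a :: "nat \<Rightarrow> complex"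
  assumes "a \<longlonglongrightarrow> b" shows "uniform_limit X (\<lambda>N x. a N) (\<lambda>x. b) sequentially"
  using tendstoD[OF assms] by (intro uniform_limitI) auto

lemma uniform_limit_eventually_cong:
  assumes "uniform_limit X f g sequentially" "\<forall>\<^sub>F N in sequentially. \<forall>x\<in>X. f N x = f' N x"
  shows "uniform_limit X f' g sequentially"
  using assms(1) uniform_limit_cong[OF assms(2), of g g] by blast

lemma bounded_coordinate_image:
  assumes "f holomorphic_on S" "cball 0 e \<subseteq> S" and e: "0 < e"
  shows "bounded ((\<lambda>x. c * f (x i)) ` polydisc r e)"
proof -
  have "compact (f ` cball 0 e)"
    using assms by (intro compact_continuous_image holomorphic_on_imp_continuous_on compact_cball)
       (auto intro: holomorphic_on_subset)
  then have "bounded (f ` cball 0 e)" by (rule compact_imp_bounded)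
  then obtain B where "\<forall>z\<in>cball 0 e. norm (f z) \<le> B" unfolding bounded_iff by blast
  then have B: "norm (f z) \<le> B" if "z \<in> cball 0 e" for z using that by blast
  have "norm (c * f (x i)) \<le> norm c * B" if "x \<in> polydisc r e" for x
    using B[of "x i"] polydisc_norm[OF that e, of i] by (auto simp: norm_mult intro!: mult_left_mono)
  then show ?thesis by (auto simp: bounded_iff)
qed

lemma holo_in_expectation:
  assumes "dominated_on P r e h" "i < r"
    and "\<And>\<omega> x. \<omega> \<in> space P \<Longrightarrow> (\<lambda>z. h \<omega> (x(i := z))) holomorphic_on ball 0 e"
  shows "holo_in i r e (\<lambda>x. \<integral>\<omega>. h \<omega> x \<partial>P)"
  unfolding holo_in_def
proof
  fix x assume x: "x \<in> polydisc r e"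
  have "\<exists>d. ((\<lambda>z. \<integral>\<omega>. h \<omega> (x(i := z)) \<partial>P) has_field_derivative d) (at z)" if "z \<in> ball 0 e" for z
    using has_field_derivative_expectation[OF assms x, of z] that unfolding mem_ball_0 by blast
  then show "(\<lambda>z. \<integral>\<omega>. h \<omega> (x(i := z)) \<partial>P) holomorphic_on ball 0 e"
    unfolding holomorphic_on_def field_differentiable_def using has_field_derivative_at_within by blast
qed

lemma partial_deriv_expectation:
  assumes "dominated_on P r e h" "i < r"
    and "\<And>\<omega> x. \<omega> \<in> space P \<Longrightarrow> (\<lambda>z. h \<omega> (x(i := z))) holomorphic_on ball 0 e"
    and x: "x \<in> polydisc r e"
  shows "partial_deriv i (\<lambda>x. \<integral>\<omega>. h \<omega> x \<partial>P) x = (\<integral>\<omega>. partial_deriv i (h \<omega>) x \<partial>P)"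
  unfolding partial_deriv_def[of i "\<lambda>x. \<integral>\<omega>. h \<omega> x \<partial>P"]
  using DERIV_imp_deriv[OF has_field_derivative_expectation[OF assms, of "x i"]]
    polydisc_coord_in_ball[OF x assms(2)] by (simp only: mem_ball_0 fun_upd_triv)

section \<open>The logarithmic derivative of the mean Harish-Chandra integral\<close>

locale log_HC_asymptotics =
  fixes \<theta> :: real
    and haar :: "nat \<Rightarrow> complex mat measure"
    and M :: "nat \<Rightarrow> 'a measure"
    and lam :: "nat \<Rightarrow> 'a \<Rightarrow> nat \<Rightarrow> real"
    and S :: "complex set"
    and \<Psi> :: "complex \<Rightarrow> complex"
  assumes theta: "0 < \<theta>" "\<theta> < 1"
    and haar: "\<And>N. N \<ge> 1 \<Longrightarrow> is_haar_prob N (haar N)"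
    and prob: "\<And>N. N \<ge> 1 \<Longrightarrow> prob_space (M N)"
    and S: "open S" "0 \<in> S" and \<Psi>: "\<Psi> holomorphic_on S"
    and log_HC: "\<And>r. r \<ge> 1 \<Longrightarrow> \<exists>\<epsilon>>0. \<exists>L.
          (\<forall>\<^sub>F N in sequentially.
             (\<forall>x\<in>polydisc r \<epsilon>. integrable (M N) (\<lambda>\<omega>. HC (haar N) N x (lam N \<omega>))) \<and>
             is_log_branch (polydisc r \<epsilon>) (\<lambda>x. \<integral>\<omega>. HC (haar N) N x (lam N \<omega>) \<partial>M N) (L N)) \<and>
          uniform_limit (polydisc r \<epsilon>)
            (\<lambda>N x. L N x / complex_of_real (real N powr \<theta>))
            (\<lambda>x. \<Sum>i<r. \<Psi> (x i)) sequentially"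
begin

abbreviation hc :: "nat \<Rightarrow> 'a \<Rightarrow> (nat \<Rightarrow> complex) \<Rightarrow> complex" where
  "hc N \<omega> x \<equiv> HC (haar N) N x (lam N \<omega>)"

definition mean_HC :: "nat \<Rightarrow> (nat \<Rightarrow> complex) \<Rightarrow> complex" where
  "mean_HC N x = (\<integral>\<omega>. hc N \<omega> x \<partial>M N)"

abbreviation pw :: "real \<Rightarrow> nat \<Rightarrow> complex" where
  "pw s N \<equiv> complex_of_real (real N powr s)"

lemma haar_at: "N \<ge> 1 \<Longrightarrow> haar_unitary N (haar N)"
  using haar by (simp add: haar_unitary_def)

lemma hc_entire:
  assumes "i < N" shows "(\<lambda>z. hc N \<omega> (x(i := z))) holomorphic_on T"
proof -
  have N: "N \<ge> 1" using assms by simp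
  show ?thesis
    using haar_unitary.diag_avg_entire[OF haar_at[OF N] assms assms, of "lam N \<omega>" 0 x T]
    by (simp add: haar_unitary.diag_avg_0[OF haar_at[OF N] assms])
qed

lemma dominated_on_hc:
  assumes r: "1 \<le> r" "r \<le> N" and e: "0 < e"
    and int: "\<And>x. x \<in> polydisc r e \<Longrightarrow> integrable (M N) (\<lambda>\<omega>. hc N \<omega> x)"
  shows "dominated_on (M N) r (e / (2 * real r)) (\<lambda>\<omega> x. hc N \<omega> x)"
proof -
  interpret haar_unitary N "haar N" using haar_at r by simp
  let ?e = "e / (2 * real r)"
  have sub: "polydisc r ?e \<subseteq> polydisc r e"
  proof (rule polydisc_mono)
    have "e * 1 \<le> e * (2 * real r)" using r e by (intro mult_left_mono) auto
    then show "?e \<le> e" using r by (simp add: divide_le_eq)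
  qed (use e in auto)
  \<comment> \<open>the points of norm_HC_le then lie at distance e / 2 from the origin, inside the given polydisc\<close>
  have re: "real r * ?e = e / 2" using r by simp
  define D where "D = (\<lambda>\<omega>. \<Sum>l<r. norm (hc N \<omega> ((\<lambda>_. 0)(l := of_real (real r * ?e))))
      + norm (hc N \<omega> ((\<lambda>_. 0)(l := - of_real (real r * ?e)))))"
  have D: "integrable (M N) D"
    unfolding D_def
  proof (intro Bochner_Integration.integrable_sum Bochner_Integration.integrable_add integrable_norm int)
    fix l assume "l \<in> {..<r}"
    then show "(\<lambda>_. 0)(l := complex_of_real (real r * ?e)) \<in> polydisc r e"
      "(\<lambda>_. 0)(l := - complex_of_real (real r * ?e)) \<in> polydisc r e"
      unfolding re polydisc_def using e by auto
  qed
  have bound: "norm (hc N \<omega> x) \<le> D \<omega>" if "x \<in> polydisc r ?e" for x \<omega>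
    unfolding D_def
  proof (rule norm_HC_le[OF r])
    show "norm (x a) \<le> ?e" if "a < r" for a
      using \<open>x \<in> polydisc r ?e\<close> that unfolding polydisc_def by fastforce
    show "x a = 0" if "a \<ge> r" for a
      using \<open>x \<in> polydisc r ?e\<close> that unfolding polydisc_def by blast
  qed
  have meas: "(\<lambda>\<omega>. hc N \<omega> x) \<in> borel_measurable (M N)" if "x \<in> polydisc r ?e" for x
    using sub that by (intro borel_measurable_integrable int) auto
  show ?thesis unfolding dominated_on_def
    by (intro conjI ballI exI[of _ D] D) (rule meas bound, assumption)+
qed

lemma continuous_on_update: "continuous_on T (\<lambda>z. x(i := z))"
  for x :: "nat \<Rightarrow> complex"
proof (rule continuous_on_coordinatewise_then_product)
  show "continuous_on T (\<lambda>z. (x(i := z)) j)" for j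
    by (cases "j = i") auto
qed

text \<open>The logarithm \<open>L N\<close> is given as a continuous function, but it is holomorphic in each variable by
\<open>holomorphic_on_continuous_log\<close>. Hence its normalised uniform limit may be differentiated, and
\<open>partial_deriv i (L N)\<close> is the logarithmic derivative of the mean Harish-Chandra integral. The radius is also shrunk
so that one dominating function is available and \<open>\<Psi>\<close> is bounded.\<close>
lemma log_derivative_limit:
  assumes r: "r \<ge> 1"
  obtains e where "0 < e" "cball 0 e \<subseteq> S"
    "\<forall>\<^sub>F N in sequentially. dominated_on (M N) r e (\<lambda>\<omega> x. hc N \<omega> x)"
    "\<forall>\<^sub>F N in sequentially. \<forall>x\<in>polydisc r e. mean_HC N x \<noteq> 0"
    "\<And>i. i < r \<Longrightarrow> \<forall>\<^sub>F N in sequentially. holo_in i r e (mean_HC N)"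
    "\<And>i. i < r \<Longrightarrow> uniform_limit (polydisc r e) (\<lambda>N x. partial_deriv i (mean_HC N) x / (mean_HC N x * pw \<theta> N))
        (\<lambda>x. deriv \<Psi> (x i)) sequentially"
proof -
  obtain e0 L where e0: "e0 > 0" and
    ev: "\<forall>\<^sub>F N in sequentially.
             (\<forall>x\<in>polydisc r e0. integrable (M N) (\<lambda>\<omega>. hc N \<omega> x)) \<and>
             is_log_branch (polydisc r e0) (mean_HC N) (L N)" and
    lim: "uniform_limit (polydisc r e0)
            (\<lambda>N x. L N x / pw \<theta> N) (\<lambda>x. \<Sum>i<r. \<Psi> (x i)) sequentially"
    using log_HC[OF r] unfolding mean_HC_def by blast
  obtain e1 where e1: "e1 > 0" "cball 0 e1 \<subseteq> S" using S open_contains_cball by blast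
  define e2 where "e2 = min e0 e1"
  have e2: "e2 > 0" "e2 \<le> e0" "e2 \<le> e1" using e0 e1 by (auto simp: e2_def)
  define e where "e = e2 / (2 * real r)"
  have e: "e > 0" using e2 r by (simp add: e_def)
  have "e2 * 1 \<le> e2 * (2 * real r)" using r e2 by (intro mult_left_mono) auto
  then have ee2: "e \<le> e2" using r by (simp add: e_def divide_le_eq)
  have sub0: "polydisc r e2 \<subseteq> polydisc r e0" using e2 e0 by (intro polydisc_mono) auto
  have sub: "polydisc r e \<subseteq> polydisc r e0" using ee2 e2 e0 by (intro polydisc_mono) auto
  have dom: "\<forall>\<^sub>F N in sequentially. dominated_on (M N) r e (\<lambda>\<omega> x. hc N \<omega> x)"
    using ev eventually_ge_at_top[of r]
    by eventually_elim (unfold e_def, rule dominated_on_hc, use r e2 sub0 in auto)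
  have nz: "\<forall>\<^sub>F N in sequentially. \<forall>x\<in>polydisc r e. mean_HC N x \<noteq> 0"
    using ev
  proof eventually_elim
    case (elim N)
    show ?case
    proof
      fix x assume "x \<in> polydisc r e"
      then have "exp (L N x) = mean_HC N x" using elim sub by (auto simp: is_log_branch_def)
      then show "mean_HC N x \<noteq> 0" by (metis exp_not_eq_zero)
    qed
  qed
  have hol: "\<forall>\<^sub>F N in sequentially. holo_in i r e (mean_HC N)" if i: "i < r" for i
    using dom eventually_ge_at_top[of r]
    by eventually_elim (unfold mean_HC_def[abs_def], rule holo_in_expectation, use i hc_entire in auto)
  have logd: "\<forall>\<^sub>F N in sequentially. holo_in i r e (L N) \<and>
      (\<forall>x\<in>polydisc r e. partial_deriv i (mean_HC N) x / mean_HC N x = partial_deriv i (L N) x)" if i: "i < r" for i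
    using ev hol[OF i] nz
  proof eventually_elim
    case (elim N)
    have expL: "exp (L N x) = mean_HC N x" if "x \<in> polydisc r e" for x
      using elim(1) sub that by (auto simp: is_log_branch_def)
    have holL: "holo_in i r e (L N)"
      unfolding holo_in_def
    proof
      fix x assume x: "x \<in> polydisc r e"
      have im: "(\<lambda>z. x(i := z)) ` ball 0 e \<subseteq> polydisc r e" using polydisc_update[OF x i] by auto
      show "(\<lambda>z. L N (x(i := z))) holomorphic_on ball 0 e"
      proof (rule holomorphic_on_continuous_log)
        have "continuous_on (polydisc r e) (L N)"
          using elim(1) sub by (auto simp: is_log_branch_def intro: continuous_on_subset)
        from continuous_on_compose2[OF this continuous_on_update im]
        show "continuous_on (ball 0 e) (\<lambda>z. L N (x(i := z)))" .
        show "(\<lambda>z. exp (L N (x(i := z)))) holomorphic_on ball 0 e"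
          by (rule holomorphic_transform[of "\<lambda>z. mean_HC N (x(i := z))"])
             (use elim(2) x expL polydisc_update[OF x i] in \<open>auto simp: holo_in_def\<close>)
      qed simp
    qed
    have "partial_deriv i (mean_HC N) x / mean_HC N x = partial_deriv i (L N) x" if x: "x \<in> polydisc r e" for x
    proof -
      have "partial_deriv i (mean_HC N) x = partial_deriv i (\<lambda>x. exp (L N x)) x"
        by (rule partial_deriv_cong[OF _ x i]) (use expL in auto)
      also have "\<dots> = exp (L N x) * partial_deriv i (L N) x"
      proof -
        have "((\<lambda>z. L N (x(i := z))) has_field_derivative partial_deriv i (L N) x) (at (x i))"
          unfolding partial_deriv_def
          using holo_in_differentiable[OF holL x i] by (simp add: field_differentiable_derivI)
        from DERIV_fun_exp[OF this] show ?thesis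
          unfolding partial_deriv_def by (intro DERIV_imp_deriv) simp
      qed
      finally show ?thesis using expL[OF x] elim(3) x by simp
    qed
    with holL show ?case by simp
  qed
  have e_S: "cball 0 e \<subseteq> S" using e1 ee2 e2 by (auto intro: order_trans)
  have final: "uniform_limit (polydisc r (e/2)) (\<lambda>N x. partial_deriv i (mean_HC N) x / (mean_HC N x * pw \<theta> N))
        (\<lambda>x. deriv \<Psi> (x i)) sequentially" if i: "i < r" for i
  proof -
    have hol\<Psi>: "holo_in i r e (\<lambda>x. \<Sum>j<r. \<Psi> (x j))"
    proof -
      have "\<Psi> holomorphic_on ball 0 e"
        using \<Psi> e_S ball_subset_cball by (blast intro: holomorphic_on_subset)
      then have "(\<lambda>z. \<Psi> ((x(i := z)) j)) holomorphic_on ball 0 e" for x :: "nat \<Rightarrow> complex" and j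
        by (cases "j = i") auto
      then show ?thesis by (auto simp: holo_in_def intro!: holomorphic_on_sum)
    qed
    have "uniform_limit (polydisc r (e/2)) (\<lambda>N. partial_deriv i (\<lambda>x. L N x / pw \<theta> N))
        (partial_deriv i (\<lambda>x. \<Sum>i<r. \<Psi> (x i))) sequentially"
    proof (rule uniform_limit_partial_deriv[OF i e _ hol\<Psi>])
      show "\<forall>\<^sub>F N in sequentially. holo_in i r e (\<lambda>x. L N x / pw \<theta> N)"
        using logd[OF i] eventually_gt_at_top[of 0]
        by eventually_elim (auto simp: holo_in_def intro!: holomorphic_intros)
      show "uniform_limit (polydisc r e) (\<lambda>N x. L N x / pw \<theta> N) (\<lambda>x. \<Sum>i<r. \<Psi> (x i)) sequentially"
        by (rule uniform_limit_on_subset[OF lim sub])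
    qed
    moreover have "partial_deriv i (\<lambda>x. \<Sum>i<r. \<Psi> (x i)) x = deriv \<Psi> (x i)" if x: "x \<in> polydisc r (e/2)" for x
    proof -
      have xS: "x i \<in> S" using polydisc_norm[OF x, of i] e e_S by (auto simp: subset_eq)
      then have d\<Psi>: "(\<Psi> has_field_derivative deriv \<Psi> (x i)) (at (x i))"
        using \<Psi> S holomorphic_derivI by blast
      have "((\<lambda>z. \<Psi> ((x(i := z)) j)) has_field_derivative (if j = i then deriv \<Psi> (x i) else 0)) (at (x i))" for j
        using d\<Psi> by (cases "j = i") auto
      then have "((\<lambda>z. \<Sum>j<r. \<Psi> ((x(i := z)) j)) has_field_derivative (\<Sum>j<r. if j = i then deriv \<Psi> (x i) else 0)) (at (x i))"
        by (intro DERIV_sum)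
      then show ?thesis unfolding partial_deriv_def
        using i by (intro DERIV_imp_deriv) (simp add: sum.delta)
    qed
    ultimately have *: "uniform_limit (polydisc r (e/2)) (\<lambda>N. partial_deriv i (\<lambda>x. L N x / pw \<theta> N))
        (\<lambda>x. deriv \<Psi> (x i)) sequentially"
      by (simp cong: uniform_limit_cong')
    have sub2: "polydisc r (e/2) \<subseteq> polydisc r e" using e by (intro polydisc_mono) auto
    show ?thesis
    proof (rule uniform_limit_eventually_cong[OF *])
      show "\<forall>\<^sub>F N in sequentially. \<forall>x\<in>polydisc r (e/2). partial_deriv i (\<lambda>x. L N x / pw \<theta> N) x
          = partial_deriv i (mean_HC N) x / (mean_HC N x * pw \<theta> N)"
        using logd[OF i]
      proof eventually_elim
        case (elim N)
        show ?case
        proof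
          fix x assume "x \<in> polydisc r (e/2)"
          then have x: "x \<in> polydisc r e" using sub2 by blast
          have "partial_deriv i (\<lambda>x. L N x / pw \<theta> N) x = partial_deriv i (L N) x / pw \<theta> N"
            unfolding partial_deriv_def
            using deriv_cdivide_right[OF holo_in_differentiable[OF conjunct1[OF elim] x i]] by simp
          also have "\<dots> = partial_deriv i (mean_HC N) x / (mean_HC N x * pw \<theta> N)"
            using elim x by (metis divide_divide_eq_left)
          finally show "partial_deriv i (\<lambda>x. L N x / pw \<theta> N) x = partial_deriv i (mean_HC N) x / (mean_HC N x * pw \<theta> N)" .
        qed
      qed
    qed
  qed
  have sub2: "polydisc r (e/2) \<subseteq> polydisc r e" using e by (intro polydisc_mono) auto
  show ?thesis
  proof (rule that[of "e/2"])
    show "cball 0 (e/2) \<subseteq> S" using e_S e by (auto simp: subset_eq)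
    show "\<forall>\<^sub>F N in sequentially. dominated_on (M N) r (e/2) (\<lambda>\<omega> x. hc N \<omega> x)"
      using dom by eventually_elim (rule dominated_on_mono, use e in auto)
    show "\<forall>\<^sub>F N in sequentially. \<forall>x\<in>polydisc r (e/2). mean_HC N x \<noteq> 0"
      using nz by eventually_elim (use sub2 in auto)
    show "\<forall>\<^sub>F N in sequentially. holo_in i r (e/2) (mean_HC N)" if "i < r" for i
      using hol[OF that] by eventually_elim (rule holo_in_mono, use e in auto)
  qed (use e final in auto)
qed

end

section \<open>The recursion for weighted averages\<close>

lemma bounded_const_image [simp]: "bounded ((\<lambda>_. c) ` X)" for c :: complex
  by (auto simp: bounded_iff)

context log_HC_asymptotics
begin

definition wdiag :: "(nat \<Rightarrow> 'a \<Rightarrow> complex) \<Rightarrow> nat \<Rightarrow> nat \<Rightarrow> nat \<Rightarrow> 'a \<Rightarrow> (nat \<Rightarrow> complex) \<Rightarrow> complex" where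
  "wdiag w k i N \<omega> x = w N \<omega> * diag_avg (haar N) N (lam N \<omega>) k i x"

definition woff :: "(nat \<Rightarrow> 'a \<Rightarrow> complex) \<Rightarrow> nat \<Rightarrow> nat \<Rightarrow> nat \<Rightarrow> nat \<Rightarrow> 'a \<Rightarrow> (nat \<Rightarrow> complex) \<Rightarrow> complex" where
  "woff w k i j N \<omega> x = w N \<omega> * off_avg (haar N) N (lam N \<omega>) k i j x"

text \<open>For \<open>k = Suc p\<close>, the \<open>k\<close>-th moment in the theorem: \<open>N powr (k + \<theta>)\<close> collects the scaling by \<open>1 / N\<close> of each
eigenvalue and the mass \<open>N powr (-\<theta>)\<close> of each atom.\<close>
definition power_sum :: "nat \<Rightarrow> nat \<Rightarrow> 'a \<Rightarrow> complex" where
  "power_sum p N \<omega> = (\<Sum>l<N. of_real (lam N \<omega> l) ^ Suc p) / pw (real (Suc p) + \<theta>) N"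

text \<open>The convergence is required near the origin and in any number of variables because every step of the recursion uses up one
variable; at the origin it says that \<open>c\<close> is the limit of the mean of \<open>w\<close>.\<close>
definition weight_limit :: "(nat \<Rightarrow> 'a \<Rightarrow> complex) \<Rightarrow> complex \<Rightarrow> bool" where
  "weight_limit w c \<longleftrightarrow> (\<forall>r\<ge>1. \<exists>e>0.
     (\<forall>\<^sub>F N in sequentially. dominated_on (M N) r e (\<lambda>\<omega> x. w N \<omega> * hc N \<omega> x)) \<and>
     uniform_limit (polydisc r e) (\<lambda>N x. (\<integral>\<omega>. w N \<omega> * hc N \<omega> x \<partial>M N) / mean_HC N x) (\<lambda>_. c) sequentially)"

text \<open>The claim of the induction, with \<open>k = Suc p\<close>: the power \<open>p + \<theta>\<close> of \<open>N\<close> is \<open>k - 1 + \<theta>\<close>, and the limit is the Taylor shift of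
\<open>deriv \<Psi>\<close> by \<open>k - 1\<close> places.\<close>
definition diag_limit :: "(nat \<Rightarrow> 'a \<Rightarrow> complex) \<Rightarrow> complex \<Rightarrow> nat \<Rightarrow> bool" where
  "diag_limit w c p \<longleftrightarrow> (\<forall>r\<ge>1. \<exists>e>0. \<forall>i<r.
     (\<forall>\<^sub>F N in sequentially. dominated_on (M N) r e (wdiag w (Suc p) i N)) \<and>
     uniform_limit (polydisc r e)
       (\<lambda>N x. (\<integral>\<omega>. wdiag w (Suc p) i N \<omega> x \<partial>M N) / (pw (real p + \<theta>) N * mean_HC N x))
       (\<lambda>x. c * taylor_shift (deriv \<Psi>) p (x i)) sequentially)"

lemma wdiag_entire:
  assumes "i < N" "l < N" shows "(\<lambda>z. wdiag w k i N \<omega> (x(l := z))) holomorphic_on T"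
  unfolding wdiag_def using assms
  by (intro holomorphic_intros haar_unitary.diag_avg_entire[OF haar_at]) auto

lemma woff_entire:
  assumes "i < N" "j < N" "l < N" shows "(\<lambda>z. woff w k i j N \<omega> (x(l := z))) holomorphic_on T"
  unfolding woff_def using assms
  by (intro holomorphic_intros haar_unitary.off_avg_entire[OF haar_at]) auto

lemma wdiag_0: "i < N \<Longrightarrow> wdiag w 0 i N \<omega> x = w N \<omega> * hc N \<omega> x"
  unfolding wdiag_def by (subst haar_unitary.diag_avg_0[OF haar_at]) auto

lemma woff_0: "i < N \<Longrightarrow> j < N \<Longrightarrow> i \<noteq> j \<Longrightarrow> woff w 0 i j N \<omega> x = 0"
  unfolding woff_def by (subst haar_unitary.off_avg_0[OF haar_at]) auto

lemma weighted_ward: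
  assumes "i < N" "j < N" "i \<noteq> j"
  shows "(x i - x j) * woff w k i j N \<omega> x = wdiag w k i N \<omega> x - wdiag w k j N \<omega> x"
proof -
  have N: "N \<ge> 1" using assms by simp
  have "(x i - x j) * woff w k i j N \<omega> x = w N \<omega> * ((x i - x j) * off_avg (haar N) N (lam N \<omega>) k i j x)"
    by (simp add: woff_def)
  also have "\<dots> = wdiag w k i N \<omega> x - wdiag w k j N \<omega> x"
    unfolding haar_unitary.ward[OF haar_at[OF N] assms] by (simp add: wdiag_def right_diff_distrib)
  finally show ?thesis .
qed

text \<open>With sources supported on the first \<open>r\<close> coordinates, the \<open>N - r\<close> off-diagonal terms with vanishing second source
coincide and are represented by the index \<open>r\<close>.\<close>
lemma wdiag_Suc:
  assumes i: "i < r" and r: "r < N" and x: "x \<in> polydisc r e"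
  shows "wdiag w (Suc k) i N \<omega> x = partial_deriv i (wdiag w k i N \<omega>) x
    + (\<Sum>j\<in>{..<r} - {i}. woff w k i j N \<omega> x) + of_nat (N - r) * woff w k i r N \<omega> x"
proof -
  have N: "N \<ge> 1" and iN: "i < N" using i r by auto
  have x0: "\<And>a. a \<ge> r \<Longrightarrow> x a = 0" using x by (simp add: polydisc_def)
  have "(\<lambda>z. diag_avg (haar N) N (lam N \<omega>) k i (x(i := z))) field_differentiable at (x i)"
    using haar_unitary.diag_avg_entire[OF haar_at[OF N] iN iN, of "lam N \<omega>" k x UNIV]
    by (simp add: holomorphic_on_def)
  then have "partial_deriv i (wdiag w k i N \<omega>) x
      = w N \<omega> * partial_deriv i (diag_avg (haar N) N (lam N \<omega>) k i) x"
    unfolding partial_deriv_def wdiag_def by (rule deriv_cmult)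
  moreover have "diag_avg (haar N) N (lam N \<omega>) (Suc k) i x =
    partial_deriv i (diag_avg (haar N) N (lam N \<omega>) k i) x
    + (\<Sum>j\<in>{..<r} - {i}. off_avg (haar N) N (lam N \<omega>) k i j x)
    + of_nat (N - r) * off_avg (haar N) N (lam N \<omega>) k i r x"
    by (rule haar_unitary.diag_avg_Suc_finite_rank[OF haar_at[OF N] i r]) (use x0 in simp)
  ultimately show ?thesis
    unfolding wdiag_def woff_def
    by (simp add: algebra_simps sum_distrib_left)
qed

lemma powr_null: "s < 0 \<Longrightarrow> (\<lambda>N. pw s N) \<longlonglongrightarrow> 0"
proof -
  assume s: "s < 0"
  have "(\<lambda>N. real N powr s) \<longlonglongrightarrow> 0" using tendsto_neg_powr[OF s filterlim_real_sequentially] .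
  from tendsto_of_real[OF this, where 'a = complex] show ?thesis by simp
qed

lemma ratio_tendsto_1: "(\<lambda>N. of_nat (N - r) / of_nat N :: complex) \<longlonglongrightarrow> 1"
proof -
  have "(\<lambda>N. real (N - r) / real N) \<longlonglongrightarrow> 1"
  proof (rule Lim_transform_eventually)
    show "(\<lambda>N. (real N - real r) / real N) \<longlonglongrightarrow> 1" by real_asymp
    show "\<forall>\<^sub>F N in sequentially. (real N - real r) / real N = real (N - r) / real N"
      using eventually_ge_at_top[of r] by eventually_elim (simp add: of_nat_diff)
  qed
  from tendsto_of_real[OF this, where 'a = complex] show ?thesis by simp
qed

text \<open>For the zeroth power the off-diagonal averages vanish, so the average of \<open>B i i\<close> is the derivative of the weighted mean, \<open>mean_HC N * G N\<close> with
\<open>G N\<close> close to \<open>c\<close>. By the product rule and after division by \<open>N powr \<theta>\<close>, the derivative of \<open>G N\<close> disappears and the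
logarithmic derivative remains.\<close>
lemma diag_limit_0:
  assumes w: "weight_limit w c" shows "diag_limit w c 0"
  unfolding diag_limit_def
proof (intro allI impI)
  fix r :: nat assume r: "r \<ge> 1"
  obtain e1 where e1: "e1 > 0" and
    dw: "\<forall>\<^sub>F N in sequentially. dominated_on (M N) r e1 (\<lambda>\<omega> x. w N \<omega> * hc N \<omega> x)" and
    lw: "uniform_limit (polydisc r e1) (\<lambda>N x. (\<integral>\<omega>. w N \<omega> * hc N \<omega> x \<partial>M N) / mean_HC N x) (\<lambda>_. c) sequentially"
    using w r unfolding weight_limit_def by blast
  obtain e2 where e2: "e2 > 0" "cball 0 e2 \<subseteq> S" and
    nz: "\<forall>\<^sub>F N in sequentially. \<forall>x\<in>polydisc r e2. mean_HC N x \<noteq> 0" and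
    holF: "\<And>i. i < r \<Longrightarrow> \<forall>\<^sub>F N in sequentially. holo_in i r e2 (mean_HC N)" and
    lF: "\<And>i. i < r \<Longrightarrow> uniform_limit (polydisc r e2) (\<lambda>N x. partial_deriv i (mean_HC N) x / (mean_HC N x * pw \<theta> N))
        (\<lambda>x. deriv \<Psi> (x i)) sequentially"
    by (rule log_derivative_limit[OF r]) (rule that)
  define e where "e = min e1 e2"
  have e: "e > 0" "e \<le> e1" "e \<le> e2" using e1 e2 by (auto simp: e_def)
  have s1: "polydisc r e \<subseteq> polydisc r e1" and s2: "polydisc r e \<subseteq> polydisc r e2"
    and s3: "polydisc r (e/2) \<subseteq> polydisc r e"
    using e e1 e2 by (intro polydisc_mono; simp)+
  have eS: "cball 0 e \<subseteq> S" using e e2 by (auto intro: order_trans)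
  define E where "E = (\<lambda>N x. \<integral>\<omega>. w N \<omega> * hc N \<omega> x \<partial>M N)"
  define G where "G = (\<lambda>N x. E N x / mean_HC N x)"
  show "\<exists>e>0. \<forall>i<r.
     (\<forall>\<^sub>F N in sequentially. dominated_on (M N) r e (wdiag w (Suc 0) i N)) \<and>
     uniform_limit (polydisc r e)
       (\<lambda>N x. (\<integral>\<omega>. wdiag w (Suc 0) i N \<omega> x \<partial>M N) / (pw (real 0 + \<theta>) N * mean_HC N x))
       (\<lambda>x. c * taylor_shift (deriv \<Psi>) 0 (x i)) sequentially"
  proof (intro exI[of _ "e/2"] conjI allI impI)
    fix i assume i: "i < r"
    have dw': "\<forall>\<^sub>F N in sequentially. dominated_on (M N) r e (wdiag w 0 i N)"
      using dw eventually_gt_at_top[of r]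
    proof eventually_elim
      case (elim N)
      show ?case
        by (rule dominated_on_cong[OF dominated_on_mono[OF elim(1) order_refl e(2) e1]])
           (use elim i in \<open>auto simp: wdiag_0\<close>)
    qed
    have eqs: "\<forall>\<^sub>F N in sequentially. dominated_on (M N) r (e/2) (wdiag w (Suc 0) i N) \<and>
       holo_in i r e (E N) \<and>
       (\<forall>x\<in>polydisc r (e/2). (\<integral>\<omega>. wdiag w (Suc 0) i N \<omega> x \<partial>M N) = partial_deriv i (E N) x)"
      using dw' eventually_gt_at_top[of r]
    proof eventually_elim
      case (elim N)
      have iN: "i < N" using i elim by simp
      note ent = wdiag_entire[OF iN iN]
      have E: "E N = (\<lambda>x. \<integral>\<omega>. wdiag w 0 i N \<omega> x \<partial>M N)"
        unfolding E_def using iN by (simp add: wdiag_0)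
      have eq: "partial_deriv i (wdiag w 0 i N \<omega>) x = wdiag w (Suc 0) i N \<omega> x"
        if "x \<in> polydisc r (e/2)" for \<omega> x
      proof -
        have "(\<Sum>j\<in>{..<r} - {i}. woff w 0 i j N \<omega> x) = 0"
          by (rule sum.neutral) (use i elim in \<open>auto simp: woff_0\<close>)
        then show ?thesis
          unfolding wdiag_Suc[OF i elim(2) that] using i elim by (simp add: woff_0)
      qed
      have 1: "dominated_on (M N) r (e/2) (wdiag w (Suc 0) i N)"
        by (rule dominated_on_cong[OF dominated_on_partial_deriv[OF elim(1) i ent]]) (rule eq)
      have 2: "holo_in i r e (E N)" unfolding E by (rule holo_in_expectation[OF elim(1) i ent])
      have 3: "(\<integral>\<omega>. wdiag w (Suc 0) i N \<omega> x \<partial>M N) = partial_deriv i (E N) x"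
        if x: "x \<in> polydisc r (e/2)" for x
        unfolding E using partial_deriv_expectation[OF elim(1) i ent, of x] x s3 eq[OF x] by auto
      show ?case using 1 2 3 by blast
    qed
    show "\<forall>\<^sub>F N in sequentially. dominated_on (M N) r (e/2) (wdiag w (Suc 0) i N)"
      using eqs by eventually_elim simp
    have hF: "\<forall>\<^sub>F N in sequentially. holo_in i r e (mean_HC N)"
      using holF[OF i] by eventually_elim (rule holo_in_mono[OF _ order_refl e(3) e2(1)])
    have hG: "\<forall>\<^sub>F N in sequentially. holo_in i r e (G N)"
      using eqs hF nz unfolding G_def by eventually_elim (rule holo_in_divide, use i s2 in auto)
    have lG: "uniform_limit (polydisc r e) G (\<lambda>_. c) sequentially"
      using uniform_limit_on_subset[OF lw s1] by (simp add: G_def E_def)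
    have ldG: "uniform_limit (polydisc r (e/2)) (\<lambda>N. partial_deriv i (G N)) (\<lambda>_. 0) sequentially"
    proof -
      have "partial_deriv i (\<lambda>_. c) = (\<lambda>_. 0)" by (simp add: partial_deriv_def fun_eq_iff)
      then show ?thesis using uniform_limit_partial_deriv[OF i e(1) hG holo_in_const lG] by simp
    qed
    have t1: "uniform_limit (polydisc r (e/2)) (\<lambda>N x. pw (-\<theta>) N * partial_deriv i (G N) x) (\<lambda>_. 0) sequentially"
      using theta by (intro uniform_limit_null_mult powr_null ev_bounded_limit[OF ldG]) auto
    have dPsi: "deriv \<Psi> holomorphic_on S" using \<Psi> S by (intro holomorphic_deriv)
    have "bounded ((\<lambda>x. 1 * deriv \<Psi> (x i)) ` polydisc r e)"
      by (rule bounded_coordinate_image[OF dPsi eS e(1)])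
    then have b: "bounded ((\<lambda>x. deriv \<Psi> (x i)) ` polydisc r (e/2))"
      using s3 by (auto intro: bounded_subset)
    have t2: "uniform_limit (polydisc r (e/2)) (\<lambda>N x. G N x * (partial_deriv i (mean_HC N) x / (mean_HC N x * pw \<theta> N)))
      (\<lambda>x. c * deriv \<Psi> (x i)) sequentially"
      by (rule uniform_lim_mult[OF uniform_limit_on_subset[OF lG s3] uniform_limit_on_subset[OF lF[OF i]] _ b])
         (use s2 s3 in auto)
    have "uniform_limit (polydisc r (e/2)) (\<lambda>N x. G N x * (partial_deriv i (mean_HC N) x / (mean_HC N x * pw \<theta> N))
       + pw (-\<theta>) N * partial_deriv i (G N) x) (\<lambda>x. c * deriv \<Psi> (x i) + 0) sequentially"
      by (rule uniform_limit_add[OF t2 t1])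
    then show "uniform_limit (polydisc r (e/2))
       (\<lambda>N x. (\<integral>\<omega>. wdiag w (Suc 0) i N \<omega> x \<partial>M N) / (pw (real 0 + \<theta>) N * mean_HC N x))
       (\<lambda>x. c * taylor_shift (deriv \<Psi>) 0 (x i)) sequentially"
    proof (subst (asm) add_0_right, simp only: taylor_shift.simps, elim uniform_limit_eventually_cong)
      show "\<forall>\<^sub>F N in sequentially. \<forall>x\<in>polydisc r (e/2).
         G N x * (partial_deriv i (mean_HC N) x / (mean_HC N x * pw \<theta> N)) + pw (-\<theta>) N * partial_deriv i (G N) x =
         (\<integral>\<omega>. wdiag w (Suc 0) i N \<omega> x \<partial>M N) / (pw (real 0 + \<theta>) N * mean_HC N x)"
        using eqs hF hG nz eventually_ge_at_top[of 1]
      proof eventually_elim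
        case (elim N)
        show ?case
        proof
          fix x assume x2: "x \<in> polydisc r (e/2)"
          then have x: "x \<in> polydisc r e" using s3 by blast
          have nzx: "mean_HC N x \<noteq> 0" and pn: "pw \<theta> N \<noteq> 0" using elim x s2 by auto
          have "(\<integral>\<omega>. wdiag w (Suc 0) i N \<omega> x \<partial>M N) = partial_deriv i (E N) x" using elim(1) x2 by blast
          also have "\<dots> = partial_deriv i (\<lambda>x. mean_HC N x * G N x) x"
            by (rule partial_deriv_cong[OF _ x i]) (use elim(4) s2 in \<open>auto simp: G_def\<close>)
          also have "\<dots> = partial_deriv i (mean_HC N) x * G N x + mean_HC N x * partial_deriv i (G N) x"
            by (rule partial_deriv_mult[OF elim(2,3) x i])
          finally have I: "(\<integral>\<omega>. wdiag w (Suc 0) i N \<omega> x \<partial>M N)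
            = partial_deriv i (mean_HC N) x * G N x + mean_HC N x * partial_deriv i (G N) x" .
          have p: "pw (-\<theta>) N = 1 / pw \<theta> N" by (simp add: powr_minus divide_inverse)
          show "G N x * (partial_deriv i (mean_HC N) x / (mean_HC N x * pw \<theta> N)) + pw (-\<theta>) N * partial_deriv i (G N) x =
            (\<integral>\<omega>. wdiag w (Suc 0) i N \<omega> x \<partial>M N) / (pw (real 0 + \<theta>) N * mean_HC N x)"
            unfolding I p using nzx pn by (simp add: field_simps del: of_real_eq_0_iff)
        qed
      qed
    qed
  qed (use e in auto)
qed

text \<open>Apply the claim for \<open>p\<close> in \<open>r + 1\<close> variables, the last of which is set to \<open>0\<close>: this controls the entry with index \<open>r\<close>, which stands for all
indices with vanishing source. Write \<open>G i\<close> for the normalised diagonal averages and \<open>T j\<close> for the normalised off-diagonal ones, so that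
\<open>(x i - x j) * T j = G i - G j\<close>. Up to a prefactor that tends to \<open>1\<close>, the next diagonal average is \<open>T r\<close>, plus
the logarithmic derivative (divided by \<open>N powr \<theta>\<close>) times \<open>G i\<close> with prefactor \<open>N powr (\<theta> - 1)\<close>, plus the derivative of \<open>G i\<close> and the finitely many
other \<open>T j\<close> with prefactor \<open>1 / N\<close>. All but the first vanish in the limit.\<close>
lemma diag_limit_Suc:
  assumes dl: "diag_limit w c p" shows "diag_limit w c (Suc p)"
  unfolding diag_limit_def
proof (intro allI impI)
  fix r :: nat assume r: "r \<ge> 1"
  define \<gamma> where "\<gamma> = taylor_shift (deriv \<Psi>) p"
  define D where "D = (\<lambda>i N x. \<integral>\<omega>. wdiag w (Suc p) i N \<omega> x \<partial>M N)"
  define sc where "sc = pw (real p + \<theta>)"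
  define G where "G = (\<lambda>i N x. D i N x / (sc N * mean_HC N x))"
  obtain e1 where e1: "e1 > 0" and
    dw: "\<And>i. i < r + 1 \<Longrightarrow> \<forall>\<^sub>F N in sequentially. dominated_on (M N) (r + 1) e1 (wdiag w (Suc p) i N)" and
    lw: "\<And>i. i < r + 1 \<Longrightarrow> uniform_limit (polydisc (r + 1) e1) (G i) (\<lambda>x. c * \<gamma> (x i)) sequentially"
    using dl[unfolded diag_limit_def, rule_format, of "r + 1"] unfolding G_def D_def sc_def \<gamma>_def by auto
  obtain e2 where e2: "e2 > 0" "cball 0 e2 \<subseteq> S" and
    nz: "\<forall>\<^sub>F N in sequentially. \<forall>x\<in>polydisc r e2. mean_HC N x \<noteq> 0" and
    holF: "\<And>i. i < r \<Longrightarrow> \<forall>\<^sub>F N in sequentially. holo_in i r e2 (mean_HC N)" and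
    lF: "\<And>i. i < r \<Longrightarrow> uniform_limit (polydisc r e2) (\<lambda>N x. partial_deriv i (mean_HC N) x / (mean_HC N x * pw \<theta> N))
        (\<lambda>x. deriv \<Psi> (x i)) sequentially"
    by (rule log_derivative_limit[OF r]) (rule that)
  define e where "e = min e1 e2"
  have e: "e > 0" "e \<le> e1" "e \<le> e2" using e1 e2 by (auto simp: e_def)
  have s1: "polydisc r e \<subseteq> polydisc (r + 1) e1" and s2: "polydisc r e \<subseteq> polydisc r e2"
    and s3: "polydisc r (e/2) \<subseteq> polydisc r e" and s4: "polydisc r (e/2/2) \<subseteq> polydisc r (e/2)"
    using e e1 e2 by (intro polydisc_mono; simp)+
  have eS: "cball 0 e \<subseteq> S" using e e2 by (auto intro: order_trans)
  have dPsi: "deriv \<Psi> holomorphic_on S" using \<Psi> S by (intro holomorphic_deriv)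
  have \<gamma>_hol: "\<gamma> holomorphic_on S" and \<gamma>'_hol: "taylor_shift (deriv \<Psi>) (Suc p) holomorphic_on S"
    unfolding \<gamma>_def by (rule taylor_shift_holomorphic[OF S(1) dPsi])+
  let ?Z = "polydisc r (e/2/2)"
  have s5: "?Z \<subseteq> polydisc r e" using s3 s4 by blast
  have bdd: "bounded ((\<lambda>x. a * f (x i)) ` X)" if "f holomorphic_on S" "X \<subseteq> polydisc r e" for a f i X
    by (rule bounded_subset[OF bounded_coordinate_image[OF that(1) eS e(1), of a i r] image_mono[OF that(2)]])
  have dom: "\<forall>\<^sub>F N in sequentially. dominated_on (M N) r e (wdiag w (Suc p) i N)" if "i \<le> r" for i
  proof -
    have "\<forall>\<^sub>F N in sequentially. dominated_on (M N) (r + 1) e1 (wdiag w (Suc p) i N)"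
      using that by (intro dw) auto
    then show ?thesis
      by eventually_elim (rule dominated_on_mono[OF _ _ e(2) e1], auto)
  qed
  have lG: "uniform_limit (polydisc r e) (G i) (\<lambda>x. c * \<gamma> (x i)) sequentially" if "i \<le> r" for i
    using uniform_limit_on_subset[OF lw s1, of i] that by simp
  show "\<exists>e>0. \<forall>i<r.
     (\<forall>\<^sub>F N in sequentially. dominated_on (M N) r e (wdiag w (Suc (Suc p)) i N)) \<and>
     uniform_limit (polydisc r e)
       (\<lambda>N x. (\<integral>\<omega>. wdiag w (Suc (Suc p)) i N \<omega> x \<partial>M N) / (pw (real (Suc p) + \<theta>) N * mean_HC N x))
       (\<lambda>x. c * taylor_shift (deriv \<Psi>) (Suc p) (x i)) sequentially"
  \<comment> \<open>one halving dominates the off-diagonal averages, a second one makes their quotients converge uniformly\<close>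
  proof (intro exI[of _ "e/2/2"] conjI allI impI)
    fix i assume i: "i < r"
    define Q where "Q = (\<lambda>j N x. \<integral>\<omega>. woff w (Suc p) i j N \<omega> x \<partial>M N)"
    define T where "T = (\<lambda>j N x. Q j N x / (sc N * mean_HC N x))"
    have hF: "\<forall>\<^sub>F N in sequentially. holo_in i r e (mean_HC N)"
      using holF[OF i] by eventually_elim (rule holo_in_mono[OF _ order_refl e(3) e2(1)])
    have hD: "\<forall>\<^sub>F N in sequentially. holo_in i r e (D i N)"
      using dom[OF less_imp_le[OF i]] eventually_gt_at_top[of r] unfolding D_def
      by eventually_elim (rule holo_in_expectation[OF _ i wdiag_entire], use i in auto)
    have hG: "\<forall>\<^sub>F N in sequentially. holo_in i r e (G i N)"
      using hD hF nz eventually_ge_at_top[of 1] unfolding G_def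
      by eventually_elim (intro holo_in_divide holo_in_mult holo_in_const, use i s2 in \<open>auto simp: sc_def\<close>)
    have off: "\<forall>\<^sub>F N in sequentially. dominated_on (M N) r (e/2) (woff w (Suc p) i j N) \<and>
        holo_in i r (e/2) (T j N) \<and> (\<forall>x\<in>polydisc r (e/2). (x i - x j) * T j N x = G i N x - G j N x)"
      if j: "j \<le> r" "j \<noteq> i" for j
      using dom[OF less_imp_le[OF i]] dom[OF j(1)] hF nz eventually_gt_at_top[of r]
    proof eventually_elim
      case (elim N)
      have di: "dominated_on (M N) r e (wdiag w (Suc p) i N)"
        and dj: "dominated_on (M N) r e (wdiag w (Suc p) j N)" and rN: "r < N"
        using elim i j by auto
      have ij: "i < N" "j < N" "i \<noteq> j" using i j rN by auto
      note ent = woff_entire[OF ij(1,2,1)]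
      have dij: "dominated_on (M N) r e (\<lambda>\<omega> x. wdiag w (Suc p) i N \<omega> x + (- 1) * wdiag w (Suc p) j N \<omega> x)"
        by (intro dominated_on_add dominated_on_cmult di dj)
      have 1: "dominated_on (M N) r (e/2) (woff w (Suc p) i j N)"
        by (rule dominated_on_quotient[OF dij i ij(3) ent]) (simp add: weighted_ward[OF ij])
      have "holo_in i r (e/2) (Q j N)"
        unfolding Q_def by (rule holo_in_expectation[OF 1 i ent])
      moreover have "holo_in i r (e/2) (mean_HC N)" by (rule holo_in_mono[OF elim(3)]) (use e in auto)
      ultimately have 2: "holo_in i r (e/2) (T j N)"
        unfolding T_def using i s2 s3 elim(4) rN
        by (intro holo_in_divide holo_in_mult holo_in_const) (auto simp: sc_def)
      have 3: "(x i - x j) * T j N x = G i N x - G j N x" if x: "x \<in> polydisc r (e/2)" for x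
      proof -
        have x': "x \<in> polydisc r e" using x s3 by blast
        have "(x i - x j) * Q j N x = (\<integral>\<omega>. (x i - x j) * woff w (Suc p) i j N \<omega> x \<partial>M N)"
          unfolding Q_def by simp
        also have "\<dots> = D i N x - D j N x"
          unfolding weighted_ward[OF ij] D_def
          by (rule Bochner_Integration.integral_diff[OF dominated_on_integrable[OF di x'] dominated_on_integrable[OF dj x']])
        finally show ?thesis unfolding T_def G_def by (simp add: diff_divide_distrib)
      qed
      show ?case using 1 2 3 by blast
    qed
    have dom_off: "\<forall>\<^sub>F N in sequentially. \<forall>j\<in>{..r} - {i}. dominated_on (M N) r (e/2) (woff w (Suc p) i j N)"
    proof (intro eventually_ball_finite ballI)
      fix j assume "j \<in> {..r} - {i}"
      then have "j \<le> r" "j \<noteq> i" by auto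
      from off[OF this]
      show "\<forall>\<^sub>F N in sequentially. dominated_on (M N) r (e/2) (woff w (Suc p) i j N)"
        by eventually_elim simp
    qed simp
    have rec: "\<forall>\<^sub>F N in sequentially. dominated_on (M N) r (e/2) (wdiag w (Suc (Suc p)) i N) \<and>
      (\<forall>x\<in>polydisc r (e/2). (\<integral>\<omega>. wdiag w (Suc (Suc p)) i N \<omega> x \<partial>M N)
         = partial_deriv i (D i N) x + (\<Sum>j\<in>{..<r} - {i}. Q j N x) + of_nat (N - r) * Q r N x)"
      using dom[OF less_imp_le[OF i]] dom_off eventually_gt_at_top[of r]
    proof eventually_elim
      case (elim N)
      have di: "dominated_on (M N) r e (wdiag w (Suc p) i N)" and iN: "i < N" using elim i by auto
      note ent = wdiag_entire[OF iN iN]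
      have dd: "dominated_on (M N) r (e/2) (\<lambda>\<omega>. partial_deriv i (wdiag w (Suc p) i N \<omega>))"
        by (rule dominated_on_partial_deriv[OF di i ent])
      have do: "dominated_on (M N) r (e/2) (woff w (Suc p) i j N)" if "j \<le> r" "j \<noteq> i" for j
        using elim(2) that by auto
      have "dominated_on (M N) r (e/2) (\<lambda>\<omega> x. partial_deriv i (wdiag w (Suc p) i N \<omega>) x
          + (\<Sum>j\<in>{..<r} - {i}. woff w (Suc p) i j N \<omega> x) + of_nat (N - r) * woff w (Suc p) i r N \<omega> x)"
        using i by (intro dominated_on_add dominated_on_sum dominated_on_cmult dd do) auto
      then have 1: "dominated_on (M N) r (e/2) (wdiag w (Suc (Suc p)) i N)"
        by (rule dominated_on_cong) (simp add: wdiag_Suc[OF i elim(3)])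
      have 2: "(\<integral>\<omega>. wdiag w (Suc (Suc p)) i N \<omega> x \<partial>M N)
         = partial_deriv i (D i N) x + (\<Sum>j\<in>{..<r} - {i}. Q j N x) + of_nat (N - r) * Q r N x"
        if x: "x \<in> polydisc r (e/2)" for x
      proof -
        have x': "x \<in> polydisc r e" using x s3 by blast
        note ii = dominated_on_integrable[OF dd x]
        have io: "integrable (M N) (\<lambda>\<omega>. woff w (Suc p) i j N \<omega> x)" if "j \<le> r" "j \<noteq> i" for j
          by (rule dominated_on_integrable[OF do[OF that] x])
        have isum: "integrable (M N) (\<lambda>\<omega>. \<Sum>j\<in>{..<r} - {i}. woff w (Suc p) i j N \<omega> x)"
          by (intro Bochner_Integration.integrable_sum io) auto
        have ir: "integrable (M N) (\<lambda>\<omega>. of_nat (N - r) * woff w (Suc p) i r N \<omega> x)"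
          using i by (intro integrable_mult_right io) auto
        have "(\<integral>\<omega>. wdiag w (Suc (Suc p)) i N \<omega> x \<partial>M N) =
          (\<integral>\<omega>. partial_deriv i (wdiag w (Suc p) i N \<omega>) x \<partial>M N)
          + (\<integral>\<omega>. (\<Sum>j\<in>{..<r} - {i}. woff w (Suc p) i j N \<omega> x) \<partial>M N)
          + (\<integral>\<omega>. of_nat (N - r) * woff w (Suc p) i r N \<omega> x \<partial>M N)"
          unfolding wdiag_Suc[OF i elim(3) x]
          using ii isum ir by (simp del: integral_mult_right_zero integral_mult_right)
        also have "(\<integral>\<omega>. (\<Sum>j\<in>{..<r} - {i}. woff w (Suc p) i j N \<omega> x) \<partial>M N) = (\<Sum>j\<in>{..<r} - {i}. Q j N x)"
          unfolding Q_def by (intro Bochner_Integration.integral_sum io) auto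
        also have "(\<integral>\<omega>. of_nat (N - r) * woff w (Suc p) i r N \<omega> x \<partial>M N) = of_nat (N - r) * Q r N x"
          unfolding Q_def by simp
        also have "(\<integral>\<omega>. partial_deriv i (wdiag w (Suc p) i N \<omega>) x \<partial>M N) = partial_deriv i (D i N) x"
          unfolding D_def by (rule partial_deriv_expectation[OF di i ent x', symmetric])
        finally show ?thesis .
      qed
      show ?case using 1 2 by blast
    qed
    show "\<forall>\<^sub>F N in sequentially. dominated_on (M N) r (e/2/2) (wdiag w (Suc (Suc p)) i N)"
      using rec by eventually_elim (rule dominated_on_mono[of _ r "e/2"], use e in auto)
    have lT: "uniform_limit ?Z (T r) (\<lambda>x. c * taylor_shift (deriv \<Psi>) (Suc p) (x i)) sequentially"
    proof (rule uniform_limit_quotient[OF i])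
      show "i \<noteq> r" "0 < e/2" using i e by auto
      show "\<forall>\<^sub>F N in sequentially. holo_in i r (e/2) (T r N)"
        "\<forall>\<^sub>F N in sequentially. \<forall>x\<in>polydisc r (e/2). (x i - x r) * T r N x = G i N x - G r N x"
        using off[of r] i by (auto elim: eventually_mono)
      show "holo_in i r (e/2) (\<lambda>x. c * taylor_shift (deriv \<Psi>) (Suc p) (x i))"
        by (intro holo_in_mult holo_in_const holo_in_coordinate[OF \<gamma>'_hol _ i])
           (use eS e in \<open>auto simp: subset_eq simp del: taylor_shift.simps\<close>)
      show "(x i - x r) * (c * taylor_shift (deriv \<Psi>) (Suc p) (x i)) = c * \<gamma> (x i) - c * \<gamma> (x r)"
        if "x \<in> polydisc r (e/2)" for x
      proof -
        have "x r = 0" using that by (simp add: polydisc_def)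
        then show ?thesis using taylor_shift_mult[of "x i" "deriv \<Psi>" p]
          by (simp add: \<gamma>_def right_diff_distrib[symmetric] mult.left_commute del: taylor_shift.simps)
      qed
      show "uniform_limit (polydisc r (e/2)) (\<lambda>N x. G i N x - G r N x) (\<lambda>x. c * \<gamma> (x i) - c * \<gamma> (x r)) sequentially"
        using i by (intro uniform_limit_minus uniform_limit_on_subset[OF lG s3]) auto
    qed
    have bT: "ev_bounded ?Z (T j)" if j: "j \<in> {..<r} - {i}" for j
    proof -
      have "ev_bounded (polydisc r e) (\<lambda>N x. G i N x + (- 1) * G j N x)"
      proof (intro ev_bounded_add ev_bounded_mult)
        show "ev_bounded (polydisc r e) (G i)" "ev_bounded (polydisc r e) (G j)"
          using i j by (auto intro!: ev_bounded_limit[OF lG bdd] \<gamma>_hol)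
        show "ev_bounded (polydisc r e) (\<lambda>_ _. - 1)" by (auto simp: ev_bounded_def intro!: exI[of _ 1])
      qed
      then obtain C where C: "\<forall>\<^sub>F N in sequentially. \<forall>x\<in>polydisc r e. norm (G i N x + (- 1) * G j N x) \<le> C"
        by (auto simp: ev_bounded_def)
      have jr: "j \<le> r" "j \<noteq> i" "i \<noteq> j" using j by auto
      have "\<forall>\<^sub>F N in sequentially. \<forall>x\<in>?Z. norm (T j N x) \<le> 4 * C / (e/2)"
        using C off[OF jr(1,2)]
      proof eventually_elim
        case (elim N)
        show ?case
        proof
          fix x assume "x \<in> ?Z"
          show "norm (T j N x) \<le> 4 * C / (e/2)"
            by (rule norm_quotient_le[OF _ i jr(3) _ _ \<open>x \<in> ?Z\<close>]) (use elim e s3 in auto)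
        qed
      qed
      then show ?thesis unfolding ev_bounded_def by blast
    qed
    have ldG: "uniform_limit (polydisc r (e/2)) (\<lambda>N. partial_deriv i (G i N)) (partial_deriv i (\<lambda>x. c * \<gamma> (x i))) sequentially"
      using i by (intro uniform_limit_partial_deriv[OF i e(1) hG _ lG] holo_in_mult holo_in_const holo_in_coordinate[OF \<gamma>_hol])
         (use eS ball_subset_cball in auto)
    have pdg: "partial_deriv i (\<lambda>x. c * \<gamma> (x i)) x = c * deriv \<gamma> (x i)" if "x \<in> ?Z" for x
    proof -
      have "x i \<in> S" using polydisc_norm[OF subsetD[OF s5 that] e(1), of i] eS by (auto simp: subset_eq)
      then have "\<gamma> field_differentiable at (x i)"
        using \<gamma>_hol S holomorphic_on_imp_differentiable_at by blast
      then show ?thesis unfolding partial_deriv_def by (simp add: deriv_cmult)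
    qed
    have bdG: "ev_bounded ?Z (\<lambda>N. partial_deriv i (G i N))"
    proof (rule ev_bounded_limit[OF uniform_limit_on_subset[OF ldG s4]])
      have "(partial_deriv i (\<lambda>x. c * \<gamma> (x i))) ` ?Z = (\<lambda>x. c * deriv \<gamma> (x i)) ` ?Z"
        by (rule image_cong) (auto simp: pdg)
      then show "bounded ((partial_deriv i (\<lambda>x. c * \<gamma> (x i))) ` ?Z)"
        using bdd[OF holomorphic_deriv[OF \<gamma>_hol S(1)] s5] by simp
    qed
    define R where "R = (\<lambda>N x. partial_deriv i (mean_HC N) x / (mean_HC N x * pw \<theta> N))"
    have bR: "ev_bounded ?Z R"
    proof (rule ev_bounded_limit)
      show "uniform_limit ?Z R (\<lambda>x. deriv \<Psi> (x i)) sequentially"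
        unfolding R_def by (rule uniform_limit_on_subset[OF lF[OF i]]) (use s5 s2 in blast)
      show "bounded ((\<lambda>x. deriv \<Psi> (x i)) ` ?Z)" using bdd[OF dPsi s5, of 1 i] by simp
    qed
    have bG: "ev_bounded ?Z (G i)"
      using i by (intro ev_bounded_subset[OF ev_bounded_limit[OF lG bdd[OF \<gamma>_hol]] s5]) auto
    have t1: "uniform_limit ?Z (\<lambda>N x. pw (\<theta> - 1) N * (R N x * G i N x)) (\<lambda>_. 0) sequentially"
      using theta by (intro uniform_limit_null_mult powr_null ev_bounded_mult bR bG) auto
    have t2: "uniform_limit ?Z (\<lambda>N x. pw (- 1) N * (partial_deriv i (G i N) x + (\<Sum>j\<in>{..<r} - {i}. T j N x))) (\<lambda>_. 0) sequentially"
      by (intro uniform_limit_null_mult powr_null ev_bounded_add ev_bounded_sum bdG bT) auto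
    have t3: "uniform_limit ?Z (\<lambda>N x. (of_nat (N - r) / of_nat N) * T r N x) (\<lambda>x. 1 * (c * taylor_shift (deriv \<Psi>) (Suc p) (x i))) sequentially"
      by (rule uniform_lim_mult[OF uniform_limit_scalar[OF ratio_tendsto_1] lT]) (use bdd[OF \<gamma>'_hol s5] in auto)
    have sum: "uniform_limit ?Z (\<lambda>N x. (pw (\<theta> - 1) N * (R N x * G i N x)
        + pw (- 1) N * (partial_deriv i (G i N) x + (\<Sum>j\<in>{..<r} - {i}. T j N x)))
        + (of_nat (N - r) / of_nat N) * T r N x) (\<lambda>x. c * taylor_shift (deriv \<Psi>) (Suc p) (x i)) sequentially"
      using uniform_limit_add[OF uniform_limit_add[OF t1 t2] t3] by (simp del: taylor_shift.simps)
    show "uniform_limit ?Z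
       (\<lambda>N x. (\<integral>\<omega>. wdiag w (Suc (Suc p)) i N \<omega> x \<partial>M N) / (pw (real (Suc p) + \<theta>) N * mean_HC N x))
       (\<lambda>x. c * taylor_shift (deriv \<Psi>) (Suc p) (x i)) sequentially"
    proof (rule uniform_limit_eventually_cong[OF sum])
      show "\<forall>\<^sub>F N in sequentially. \<forall>x\<in>?Z. (pw (\<theta> - 1) N * (R N x * G i N x)
        + pw (- 1) N * (partial_deriv i (G i N) x + (\<Sum>j\<in>{..<r} - {i}. T j N x)))
        + (of_nat (N - r) / of_nat N) * T r N x
        = (\<integral>\<omega>. wdiag w (Suc (Suc p)) i N \<omega> x \<partial>M N) / (pw (real (Suc p) + \<theta>) N * mean_HC N x)"
        using rec hF hG nz eventually_ge_at_top[of 1]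
      proof eventually_elim
        case (elim N)
        show ?case
        proof
          fix x assume xZ: "x \<in> ?Z"
          then have x2: "x \<in> polydisc r (e/2)" and x: "x \<in> polydisc r e" using s4 s5 by auto
          define f where "f = mean_HC N x"
          define n where "n = complex_of_nat N"
          define t where "t = pw \<theta> N"
          define s where "s = sc N"
          have nzx: "f \<noteq> 0" "n \<noteq> 0" "t \<noteq> 0" "s \<noteq> 0"
            using elim x s2 by (auto simp: f_def n_def t_def s_def sc_def)
          have Deq: "D i N y = s * (mean_HC N y * G i N y)" if "y \<in> polydisc r e" for y
            using that elim(4) s2 nzx(4) by (auto simp: G_def s_def)
          have "partial_deriv i (D i N) x = partial_deriv i (\<lambda>y. s * (mean_HC N y * G i N y)) x"
            by (rule partial_deriv_cong[OF Deq x i])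
          also have "\<dots> = s * partial_deriv i (\<lambda>y. mean_HC N y * G i N y) x"
            using partial_deriv_mult[OF holo_in_const holo_in_mult[OF elim(2,3)] x i, of s]
            by (simp add: partial_deriv_def)
          also have "\<dots> = s * (partial_deriv i (mean_HC N) x * G i N x + f * partial_deriv i (G i N) x)"
            unfolding partial_deriv_mult[OF elim(2,3) x i] f_def ..
          finally have pD: "partial_deriv i (D i N) x = s * (partial_deriv i (mean_HC N) x * G i N x + f * partial_deriv i (G i N) x)" .
          have Qeq: "Q j N x = s * f * T j N x" for j using nzx by (simp add: T_def f_def s_def)
          have I: "(\<integral>\<omega>. wdiag w (Suc (Suc p)) i N \<omega> x \<partial>M N)
              = s * (partial_deriv i (mean_HC N) x * G i N x + f * partial_deriv i (G i N) x)
               + s * f * (\<Sum>j\<in>{..<r} - {i}. T j N x) + of_nat (N - r) * (s * f * T r N x)"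
            using elim(1) x2 unfolding pD[symmetric] Qeq[symmetric] sum_distrib_left by blast
          have pws: "pw (\<theta> - 1) N = t / n" "pw (- 1) N = 1 / n" "pw (real (Suc p) + \<theta>) N = n * s"
            using elim(5) by (auto simp: t_def n_def s_def sc_def powr_diff powr_minus powr_add divide_inverse)
          have Req: "R N x = partial_deriv i (mean_HC N) x / (f * t)" by (simp add: R_def f_def t_def)
          show "(pw (\<theta> - 1) N * (R N x * G i N x)
            + pw (- 1) N * (partial_deriv i (G i N) x + (\<Sum>j\<in>{..<r} - {i}. T j N x)))
            + (of_nat (N - r) / of_nat N) * T r N x
            = (\<integral>\<omega>. wdiag w (Suc (Suc p)) i N \<omega> x \<partial>M N) / (pw (real (Suc p) + \<theta>) N * mean_HC N x)"
            unfolding I pws Req f_def[symmetric] n_def[symmetric] using nzx by (simp add: field_simps)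
        qed
      qed
    qed
  qed (use e in auto)
qed

lemma diag_limit: "weight_limit w c \<Longrightarrow> diag_limit w c p"
  by (induction p) (auto intro: diag_limit_0 diag_limit_Suc)

text \<open>The power sum is the trace of \<open>B ^ Suc p\<close>. On a polydisc in \<open>r\<close> variables its average consists of \<open>r\<close> diagonal
averages, negligible after division by \<open>N\<close>, and \<open>N - r\<close> copies of the one with index \<open>r\<close>. The limit of the latter depends only
on \<open>x r\<close>, which is \<open>0\<close>; hence the constant.\<close>
lemma weight_limit_power_sum:
  assumes w: "weight_limit w c"
  shows "weight_limit (\<lambda>N \<omega>. w N \<omega> * power_sum p N \<omega>)
     (c * taylor_shift (deriv \<Psi>) p 0)"
  unfolding weight_limit_def
proof (intro allI impI)
  fix r :: nat assume r: "r \<ge> 1"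
  define \<gamma> where "\<gamma> = taylor_shift (deriv \<Psi>) p"
  define D where "D = (\<lambda>i N x. \<integral>\<omega>. wdiag w (Suc p) i N \<omega> x \<partial>M N)"
  define sc where "sc = pw (real p + \<theta>)"
  define G where "G = (\<lambda>i N x. D i N x / (sc N * mean_HC N x))"
  define w' where "w' = (\<lambda>N \<omega>. w N \<omega> * power_sum p N \<omega>)"
  obtain e1 where e1: "e1 > 0" and
    dw: "\<And>i. i < r + 1 \<Longrightarrow> \<forall>\<^sub>F N in sequentially. dominated_on (M N) (r + 1) e1 (wdiag w (Suc p) i N)" and
    lw: "\<And>i. i < r + 1 \<Longrightarrow> uniform_limit (polydisc (r + 1) e1) (G i) (\<lambda>x. c * \<gamma> (x i)) sequentially"
    using diag_limit[OF w, of p, unfolded diag_limit_def, rule_format, of "r + 1"] unfolding G_def D_def sc_def \<gamma>_def by auto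
  obtain e2 where e2: "e2 > 0" "cball 0 e2 \<subseteq> S" using S open_contains_cball by blast
  define e where "e = min e1 e2"
  have e: "e > 0" "e \<le> e1" "e \<le> e2" using e1 e2 by (auto simp: e_def)
  have s1: "polydisc r e \<subseteq> polydisc (r + 1) e1" using e e1 by (intro polydisc_mono) auto
  have eS: "cball 0 e \<subseteq> S" using e e2 by (auto intro: order_trans)
  have dPsi: "deriv \<Psi> holomorphic_on S" using \<Psi> S by (intro holomorphic_deriv)
  have \<gamma>_hol: "\<gamma> holomorphic_on S"
    unfolding \<gamma>_def using S dPsi by (auto intro!: taylor_shift_holomorphic)
  have bdd: "bounded ((\<lambda>x. c * \<gamma> (x i)) ` polydisc r e)" for i
    by (rule bounded_coordinate_image[OF \<gamma>_hol eS e(1)])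
  have dom: "\<forall>\<^sub>F N in sequentially. \<forall>i\<in>{..r}. dominated_on (M N) r e (wdiag w (Suc p) i N)"
  proof (intro eventually_ball_finite ballI)
    fix i assume "i \<in> {..r}"
    then have "\<forall>\<^sub>F N in sequentially. dominated_on (M N) (r + 1) e1 (wdiag w (Suc p) i N)"
      by (intro dw) auto
    then show "\<forall>\<^sub>F N in sequentially. dominated_on (M N) r e (wdiag w (Suc p) i N)"
      by eventually_elim (rule dominated_on_mono[OF _ _ e(2) e1], auto)
  qed simp
  have lG: "uniform_limit (polydisc r e) (G i) (\<lambda>x. c * \<gamma> (x i)) sequentially" if "i \<le> r" for i
    using uniform_limit_on_subset[OF lw s1, of i] that by simp
  have rec: "\<forall>\<^sub>F N in sequentially. dominated_on (M N) r e (\<lambda>\<omega> x. w' N \<omega> * hc N \<omega> x) \<and>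
     (\<forall>x\<in>polydisc r e. (\<integral>\<omega>. w' N \<omega> * hc N \<omega> x \<partial>M N) / mean_HC N x
        = pw (- 1) N * (\<Sum>i<r. G i N x) + (of_nat (N - r) / of_nat N) * G r N x)"
    using dom eventually_gt_at_top[of r]
  proof eventually_elim
    case (elim N)
    have N: "N \<ge> 1" using elim by simp
    have di: "dominated_on (M N) r e (wdiag w (Suc p) i N)" if "i \<le> r" for i using elim that by auto
    define b where "b = 1 / pw (real (Suc p) + \<theta>) N"
    have eq: "w' N \<omega> * hc N \<omega> x = b * ((\<Sum>i<r. wdiag w (Suc p) i N \<omega> x) + of_nat (N - r) * wdiag w (Suc p) r N \<omega> x)"
      if x: "x \<in> polydisc r e" for \<omega> x
    proof -
      have "(\<Sum>l<N. of_real (lam N \<omega> l) ^ Suc p) * hc N \<omega> x =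
        (\<Sum>i<r. diag_avg (haar N) N (lam N \<omega>) (Suc p) i x) + of_nat (N - r) * diag_avg (haar N) N (lam N \<omega>) (Suc p) r x"
        by (rule haar_unitary.sum_diag_avg_finite_rank[OF haar_at[OF N] elim(2)]) (use x in \<open>simp add: polydisc_def\<close>)
      then have "b * w N \<omega> * ((\<Sum>l<N. of_real (lam N \<omega> l) ^ Suc p) * hc N \<omega> x) = b * w N \<omega> *
        ((\<Sum>i<r. diag_avg (haar N) N (lam N \<omega>) (Suc p) i x) + of_nat (N - r) * diag_avg (haar N) N (lam N \<omega>) (Suc p) r x)"
        by simp
      moreover have "w' N \<omega> * hc N \<omega> x = b * w N \<omega> * ((\<Sum>l<N. of_real (lam N \<omega> l) ^ Suc p) * hc N \<omega> x)"
        unfolding w'_def power_sum_def b_def by (simp add: mult_ac del: power_Suc)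
      ultimately show ?thesis
        unfolding wdiag_def by (simp add: distrib_left sum_distrib_left mult_ac)
    qed
    have "dominated_on (M N) r e (\<lambda>\<omega> x. b * ((\<Sum>i<r. wdiag w (Suc p) i N \<omega> x) + of_nat (N - r) * wdiag w (Suc p) r N \<omega> x))"
      by (intro dominated_on_cmult dominated_on_add dominated_on_sum di) auto
    then have 1: "dominated_on (M N) r e (\<lambda>\<omega> x. w' N \<omega> * hc N \<omega> x)"
      by (rule dominated_on_cong) (simp add: eq)
    have 2: "(\<integral>\<omega>. w' N \<omega> * hc N \<omega> x \<partial>M N) / mean_HC N x
        = pw (- 1) N * (\<Sum>i<r. G i N x) + (of_nat (N - r) / of_nat N) * G r N x" if x: "x \<in> polydisc r e" for x
    proof -
      have int: "integrable (M N) (\<lambda>\<omega>. wdiag w (Suc p) i N \<omega> x)" if "i \<le> r" for i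
        by (rule dominated_on_integrable[OF di[OF that] x])
      have "(\<integral>\<omega>. w' N \<omega> * hc N \<omega> x \<partial>M N) = b * ((\<Sum>i<r. D i N x) + of_nat (N - r) * D r N x)"
      proof -
        have s: "(\<integral>\<omega>. (\<Sum>i<r. wdiag w (Suc p) i N \<omega> x) \<partial>M N) = (\<Sum>i<r. D i N x)"
          unfolding D_def by (intro Bochner_Integration.integral_sum int) auto
        have "integrable (M N) (\<lambda>\<omega>. \<Sum>i<r. wdiag w (Suc p) i N \<omega> x)"
          by (intro Bochner_Integration.integrable_sum int) auto
        then show ?thesis unfolding eq[OF x] s[symmetric] by (simp add: int D_def)
      qed
      moreover have "b = pw (- 1) N / sc N" "pw (- 1) N = 1 / of_nat N"
        using N by (auto simp: b_def sc_def powr_minus powr_add divide_inverse)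
      ultimately show ?thesis
        unfolding G_def by (simp add: sum_divide_distrib[symmetric] add_divide_distrib distrib_left divide_divide_eq_left mult.assoc)
    qed
    show ?case using 1 2 by blast
  qed
  have t1: "uniform_limit (polydisc r e) (\<lambda>N x. pw (- 1) N * (\<Sum>i<r. G i N x)) (\<lambda>_. 0) sequentially"
    by (intro uniform_limit_null_mult powr_null ev_bounded_sum ev_bounded_limit[OF lG bdd]) auto
  have t2: "uniform_limit (polydisc r e) (\<lambda>N x. (of_nat (N - r) / of_nat N) * G r N x) (\<lambda>x. 1 * (c * \<gamma> (x r))) sequentially"
    by (rule uniform_lim_mult[OF uniform_limit_scalar[OF ratio_tendsto_1] lG]) (use bdd in auto)
  have t3: "uniform_limit (polydisc r e) (\<lambda>N x. pw (- 1) N * (\<Sum>i<r. G i N x) + (of_nat (N - r) / of_nat N) * G r N x)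
     (\<lambda>x. c * \<gamma> 0) sequentially"
  proof -
    have x0: "x r = 0" if "x \<in> polydisc r e" for x using that by (simp add: polydisc_def)
    show ?thesis
      by (subst uniform_limit_cong'[OF refl, where i = "\<lambda>x. 0 + 1 * (c * \<gamma> (x r))"])
         (use uniform_limit_add[OF t1 t2] in \<open>auto simp: x0\<close>)
  qed
  have "uniform_limit (polydisc r e) (\<lambda>N x. (\<integral>\<omega>. w' N \<omega> * hc N \<omega> x \<partial>M N) / mean_HC N x) (\<lambda>x. c * \<gamma> 0) sequentially"
    by (rule uniform_limit_eventually_cong[OF t3]) (use rec in \<open>auto elim: eventually_mono\<close>)
  moreover have "\<forall>\<^sub>F N in sequentially. dominated_on (M N) r e (\<lambda>\<omega> x. w' N \<omega> * hc N \<omega> x)"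
    using rec by eventually_elim blast
  ultimately show "\<exists>e>0. (\<forall>\<^sub>F N in sequentially. dominated_on (M N) r e (\<lambda>\<omega> x. w N \<omega> * power_sum p N \<omega> * hc N \<omega> x)) \<and>
     uniform_limit (polydisc r e) (\<lambda>N x. (\<integral>\<omega>. w N \<omega> * power_sum p N \<omega> * hc N \<omega> x \<partial>M N) / mean_HC N x)
       (\<lambda>_. c * taylor_shift (deriv \<Psi>) p 0) sequentially"
    using e(1) unfolding w'_def \<gamma>_def by blast
qed

end

section \<open>First and second moments\<close>

context log_HC_asymptotics
begin

lemma mean_HC_0: "N \<ge> 1 \<Longrightarrow> mean_HC N (\<lambda>_. 0) = 1"
  unfolding mean_HC_def using prob[of N]
  by (simp add: haar_unitary.HC_0[OF haar_at] prob_space.prob_space)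

lemma weight_limit_one: "weight_limit (\<lambda>_ _. 1) 1"
  unfolding weight_limit_def
proof (intro allI impI)
  fix r :: nat assume r: "r \<ge> 1"
  obtain e where e: "e > 0" and
    dF: "\<forall>\<^sub>F N in sequentially. dominated_on (M N) r e (\<lambda>\<omega> x. hc N \<omega> x)" and
    nz: "\<forall>\<^sub>F N in sequentially. \<forall>x\<in>polydisc r e. mean_HC N x \<noteq> 0"
    by (rule log_derivative_limit[OF r])
  have "uniform_limit (polydisc r e) (\<lambda>N x. mean_HC N x / mean_HC N x) (\<lambda>_. 1) sequentially"
    by (rule uniform_limit_eventually_cong[OF uniform_limit_scalar[OF tendsto_const]])
       (use nz in \<open>eventually_elim, simp\<close>)
  then show "\<exists>e>0. (\<forall>\<^sub>F N in sequentially. dominated_on (M N) r e (\<lambda>\<omega> x. 1 * hc N \<omega> x)) \<and>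
     uniform_limit (polydisc r e) (\<lambda>N x. (\<integral>\<omega>. 1 * hc N \<omega> x \<partial>M N) / mean_HC N x) (\<lambda>_. 1) sequentially"
    using e dF by (intro exI[of _ e]) (simp add: mean_HC_def)
qed

text \<open>At the origin the Harish-Chandra integral is \<open>1\<close>, and what remains is the expectation of the weight.\<close>
lemma weight_limit_at_0:
  assumes w: "weight_limit w c"
  shows "\<forall>\<^sub>F N in sequentially. integrable (M N) (w N)"
    and "(\<lambda>N. \<integral>\<omega>. w N \<omega> \<partial>M N) \<longlonglongrightarrow> c"
proof -
  obtain e where e: "e > 0" and
    d: "\<forall>\<^sub>F N in sequentially. dominated_on (M N) 1 e (\<lambda>\<omega> x. w N \<omega> * hc N \<omega> x)" and
    l: "uniform_limit (polydisc 1 e) (\<lambda>N x. (\<integral>\<omega>. w N \<omega> * hc N \<omega> x \<partial>M N) / mean_HC N x) (\<lambda>_. c) sequentially"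
    using w unfolding weight_limit_def by blast
  have 0: "(\<lambda>_. 0) \<in> polydisc 1 e" using e by (simp add: polydisc_def)
  have hc0: "hc N \<omega> (\<lambda>_. 0) = 1" if "N \<ge> 1" for N \<omega>
    by (rule haar_unitary.HC_0[OF haar_at[OF that]])
  show "\<forall>\<^sub>F N in sequentially. integrable (M N) (w N)"
    using d eventually_ge_at_top[of 1]
  proof eventually_elim
    case (elim N)
    show ?case using dominated_on_integrable[OF elim(1) 0] elim(2) by (simp add: hc0)
  qed
  have "(\<lambda>N. (\<integral>\<omega>. w N \<omega> * hc N \<omega> (\<lambda>_. 0) \<partial>M N) / mean_HC N (\<lambda>_. 0)) \<longlonglongrightarrow> c"
    by (rule tendsto_uniform_limitI[OF l 0])
  moreover have "\<forall>\<^sub>F N in sequentially. (\<integral>\<omega>. w N \<omega> * hc N \<omega> (\<lambda>_. 0) \<partial>M N) / mean_HC N (\<lambda>_. 0) = (\<integral>\<omega>. w N \<omega> \<partial>M N)"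
    using eventually_ge_at_top[of 1] by eventually_elim (simp add: hc0 mean_HC_0)
  ultimately show "(\<lambda>N. \<integral>\<omega>. w N \<omega> \<partial>M N) \<longlonglongrightarrow> c" by (rule Lim_transform_eventually)
qed

end

text \<open>The limit of the means of real random variables is real, so the mean of \<open>(X N - c)\<^sup>2\<close> tends to \<open>c\<^sup>2 - 2 * c * c + c\<^sup>2 = 0\<close>.\<close>
lemma converges_in_prob_second_moment:
  fixes X :: "nat \<Rightarrow> 'a \<Rightarrow> real" and c :: complex
  assumes prob: "\<And>N. N \<ge> 1 \<Longrightarrow> prob_space (M N)"
    and int1: "\<forall>\<^sub>F N in sequentially. integrable (M N) (X N)"
    and int2: "\<forall>\<^sub>F N in sequentially. integrable (M N) (\<lambda>\<omega>. (X N \<omega>)\<^sup>2)"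
    and lim1: "(\<lambda>N. complex_of_real (\<integral>\<omega>. X N \<omega> \<partial>M N)) \<longlonglongrightarrow> c"
    and lim2: "(\<lambda>N. complex_of_real (\<integral>\<omega>. (X N \<omega>)\<^sup>2 \<partial>M N)) \<longlonglongrightarrow> c\<^sup>2"
  shows "converges_in_prob M (\<lambda>N \<omega>. complex_of_real (X N \<omega>)) c"
proof -
  define a where "a = Re c"
  have "(\<lambda>N. Im (complex_of_real (\<integral>\<omega>. X N \<omega> \<partial>M N))) \<longlonglongrightarrow> Im c" by (rule tendsto_Im[OF lim1])
  then have "Im c = 0" by (simp add: LIMSEQ_const_iff)
  then have c: "c = of_real a" by (simp add: a_def complex_eq_iff)
  have l1: "(\<lambda>N. \<integral>\<omega>. X N \<omega> \<partial>M N) \<longlonglongrightarrow> a" using tendsto_Re[OF lim1] by (simp add: c)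
  have l2: "(\<lambda>N. \<integral>\<omega>. (X N \<omega>)\<^sup>2 \<partial>M N) \<longlonglongrightarrow> a\<^sup>2"
    using tendsto_Re[OF lim2] by (simp add: c flip: of_real_power)
  have ev: "\<forall>\<^sub>F N in sequentially. integrable (M N) (\<lambda>\<omega>. (X N \<omega> - a)\<^sup>2) \<and>
      (\<integral>\<omega>. (X N \<omega> - a)\<^sup>2 \<partial>M N) = (\<integral>\<omega>. (X N \<omega>)\<^sup>2 \<partial>M N) - 2 * a * (\<integral>\<omega>. X N \<omega> \<partial>M N) + a\<^sup>2"
    using int1 int2 eventually_ge_at_top[of 1]
  proof eventually_elim
    case (elim N)
    interpret prob_space "M N" using prob elim by simp
    have eq: "(X N \<omega> - a)\<^sup>2 = (X N \<omega>)\<^sup>2 - 2 * a * X N \<omega> + a\<^sup>2" for \<omega>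
      by (simp add: power2_diff)
    show ?case unfolding eq using elim by (simp add: prob_space)
  qed
  have "(\<lambda>N. (\<integral>\<omega>. (X N \<omega>)\<^sup>2 \<partial>M N) - 2 * a * (\<integral>\<omega>. X N \<omega> \<partial>M N) + a\<^sup>2) \<longlonglongrightarrow> a\<^sup>2 - 2 * a * a + a\<^sup>2"
    by (intro tendsto_intros l1 l2)
  then have "(\<lambda>N. (\<integral>\<omega>. (X N \<omega>)\<^sup>2 \<partial>M N) - 2 * a * (\<integral>\<omega>. X N \<omega> \<partial>M N) + a\<^sup>2) \<longlonglongrightarrow> 0"
    by (simp add: power2_eq_square)
  then have v: "(\<lambda>N. \<integral>\<omega>. (X N \<omega> - a)\<^sup>2 \<partial>M N) \<longlonglongrightarrow> 0"
    by (rule Lim_transform_eventually) (use ev in \<open>eventually_elim, simp\<close>)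
  show ?thesis
    unfolding converges_in_prob_def
  proof (intro allI impI)
    fix \<epsilon> :: real assume \<epsilon>: "\<epsilon> > 0"
    show "(\<lambda>N. measure (M N) {\<omega> \<in> space (M N). dist (complex_of_real (X N \<omega>)) c > \<epsilon>}) \<longlonglongrightarrow> 0"
    proof (rule tendsto_sandwich)
      show "\<forall>\<^sub>F N in sequentially. 0 \<le> measure (M N) {\<omega> \<in> space (M N). dist (complex_of_real (X N \<omega>)) c > \<epsilon>}"
        by simp
      show "\<forall>\<^sub>F N in sequentially. measure (M N) {\<omega> \<in> space (M N). dist (complex_of_real (X N \<omega>)) c > \<epsilon>}
          \<le> (\<integral>\<omega>. (X N \<omega> - a)\<^sup>2 \<partial>M N) / \<epsilon>\<^sup>2"
        using ev int1 eventually_ge_at_top[of 1]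
      proof eventually_elim
        case (elim N)
        interpret prob_space "M N" using prob elim by simp
        have [measurable]: "X N \<in> borel_measurable (M N)" using elim by simp
        have "dist (complex_of_real (X N \<omega>)) c = \<bar>X N \<omega> - a\<bar>" for \<omega>
          by (simp only: c dist_norm of_real_diff[symmetric] norm_of_real real_norm_def)
        then have "{\<omega> \<in> space (M N). dist (complex_of_real (X N \<omega>)) c > \<epsilon>} \<subseteq> {\<omega> \<in> space (M N). (X N \<omega> - a)\<^sup>2 \<ge> \<epsilon>\<^sup>2}"
          using \<epsilon> by (auto simp flip: abs_le_square_iff)
        then have "prob {\<omega> \<in> space (M N). dist (complex_of_real (X N \<omega>)) c > \<epsilon>} \<le> prob {\<omega> \<in> space (M N). (X N \<omega> - a)\<^sup>2 \<ge> \<epsilon>\<^sup>2}"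
          by (rule finite_measure_mono) measurable
        also have "\<dots> \<le> (\<integral>\<omega>. (X N \<omega> - a)\<^sup>2 \<partial>M N) / \<epsilon>\<^sup>2"
          by (rule integral_Markov_inequality_measure[where A = "{}"]) (use elim \<epsilon> in auto)
        finally show ?case .
      qed
      show "(\<lambda>N. (\<integral>\<omega>. (X N \<omega> - a)\<^sup>2 \<partial>M N) / \<epsilon>\<^sup>2) \<longlonglongrightarrow> 0"
        using tendsto_divide[OF v tendsto_const, of "\<epsilon>\<^sup>2"] \<epsilon> by simp
    qed simp
  qed
qed

theorem theorem1:
  fixes \<theta> :: real
    and haar :: "nat \<Rightarrow> complex mat measure"
    and M :: "nat \<Rightarrow> 'a measure"
    and A :: "nat \<Rightarrow> 'a \<Rightarrow> complex mat"
    and S :: "complex set"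
    and \<Psi> :: "complex \<Rightarrow> complex"
    and k :: nat
  assumes "0 < \<theta>" and "\<theta> < 1"
    and "\<And>N. N \<ge> 1 \<Longrightarrow> is_haar_prob N (haar N)"
    and "\<And>N. N \<ge> 1 \<Longrightarrow> prob_space (M N)"
    and "\<And>N. N \<ge> 1 \<Longrightarrow> A N \<in> measurable (M N) (mat_borel N)"
    and "\<And>N \<omega>. N \<ge> 1 \<Longrightarrow> \<omega> \<in> space (M N) \<Longrightarrow> hermitian_mat N (A N \<omega>)"
    and "open S" and "0 \<in> S" and "\<Psi> holomorphic_on S"
    and "\<And>r. r \<ge> 1 \<Longrightarrow> \<exists>\<epsilon>>0. \<exists>L.
          (\<forall>\<^sub>F N in sequentially.
             (\<forall>x\<in>polydisc r \<epsilon>.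
                integrable (M N) (\<lambda>\<omega>. HC (haar N) N x (\<lambda>i. herm_eigvals (A N \<omega>) ! i))) \<and>
             is_log_branch (polydisc r \<epsilon>)
               (\<lambda>x. \<integral>\<omega>. HC (haar N) N x (\<lambda>i. herm_eigvals (A N \<omega>) ! i) \<partial>M N) (L N)) \<and>
          uniform_limit (polydisc r \<epsilon>)
            (\<lambda>N x. L N x / complex_of_real (real N powr \<theta>))
            (\<lambda>x. \<Sum>i<r. \<Psi> (x i)) sequentially"
    and "k \<ge> 1"
  shows "converges_in_prob M
           (\<lambda>N \<omega>. complex_of_real
              (real N powr (- \<theta>) * (\<Sum>i<N. (herm_eigvals (A N \<omega>) ! i / real N) ^ k)))
           ((deriv ^^ k) \<Psi> 0 / fact (k - 1))"
proof -
  define lam where "lam = (\<lambda>N \<omega> i. herm_eigvals (A N \<omega>) ! i)"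
  interpret log_HC_asymptotics \<theta> haar M lam S \<Psi>
    unfolding lam_def by (rule log_HC_asymptotics.intro) (fact assms)+
  obtain p where k: "k = Suc p" using assms(11) by (cases k) auto
  define X where "X = (\<lambda>N \<omega>. real N powr (- \<theta>) * (\<Sum>i<N. (lam N \<omega> i / real N) ^ k))"
  define c where "c = taylor_shift (deriv \<Psi>) p 0"
  have c: "c = (deriv ^^ k) \<Psi> 0 / fact (k - 1)"
    unfolding c_def k
    by (subst taylor_shift_at_0[OF assms(7,8)]) (use assms in \<open>auto intro: holomorphic_deriv simp: funpow_swap1\<close>)
  let ?Y = "power_sum p"
  have Y: "?Y N \<omega> = complex_of_real (X N \<omega>)" if "N \<ge> 1" for N \<omega>
  proof -
    have "real N powr (real (Suc p) + \<theta>) = real N ^ Suc p * real N powr \<theta>"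
      using that by (simp add: powr_add powr_realpow del: of_nat_Suc)
    moreover have "(\<Sum>i<N. (lam N \<omega> i / real N) ^ Suc p) = (\<Sum>l<N. lam N \<omega> l ^ Suc p) / real N ^ Suc p"
      by (simp only: power_divide sum_divide_distrib)
    ultimately have "X N \<omega> = (\<Sum>l<N. lam N \<omega> l ^ Suc p) / real N powr (real (Suc p) + \<theta>)"
      by (simp add: X_def k powr_minus divide_inverse mult_ac del: power_Suc of_nat_Suc)
    then show ?thesis by (simp add: power_sum_def)
  qed
  have W1: "weight_limit (\<lambda>N \<omega>. 1 * ?Y N \<omega>) (1 * c)"
    unfolding c_def by (rule weight_limit_power_sum[OF weight_limit_one])
  have W2: "weight_limit (\<lambda>N \<omega>. 1 * ?Y N \<omega> * ?Y N \<omega>) (1 * c * c)"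
    using weight_limit_power_sum[OF W1, of p] by (simp only: c_def)
  have ge1: "\<forall>\<^sub>F N in sequentially. N \<ge> (1::nat)" by (rule eventually_ge_at_top)
  have "converges_in_prob M (\<lambda>N \<omega>. complex_of_real (X N \<omega>)) c"
  proof (rule converges_in_prob_second_moment)
    show "\<forall>\<^sub>F N in sequentially. integrable (M N) (X N)"
      using weight_limit_at_0(1)[OF W1] ge1
    proof eventually_elim
      case (elim N)
      then have "integrable (M N) (\<lambda>\<omega>. complex_of_real (X N \<omega>))" by (simp add: Y)
      then show ?case by (simp only: complex_of_real_integrable_eq)
    qed
    show "\<forall>\<^sub>F N in sequentially. integrable (M N) (\<lambda>\<omega>. (X N \<omega>)\<^sup>2)"
      using weight_limit_at_0(1)[OF W2] ge1
    proof eventually_elim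
      case (elim N)
      then have "integrable (M N) (\<lambda>\<omega>. complex_of_real ((X N \<omega>)\<^sup>2))" by (simp add: Y power2_eq_square)
      then show ?case by (simp only: complex_of_real_integrable_eq)
    qed
    show "(\<lambda>N. complex_of_real (\<integral>\<omega>. X N \<omega> \<partial>M N)) \<longlonglongrightarrow> c"
    proof (rule Lim_transform_eventually)
      show "(\<lambda>N. \<integral>\<omega>. 1 * ?Y N \<omega> \<partial>M N) \<longlonglongrightarrow> c" using weight_limit_at_0(2)[OF W1] by simp
      show "\<forall>\<^sub>F N in sequentially. (\<integral>\<omega>. 1 * ?Y N \<omega> \<partial>M N) = complex_of_real (\<integral>\<omega>. X N \<omega> \<partial>M N)"
        using ge1 by eventually_elim (simp add: Y)
    qed
    show "(\<lambda>N. complex_of_real (\<integral>\<omega>. (X N \<omega>)\<^sup>2 \<partial>M N)) \<longlonglongrightarrow> c\<^sup>2"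
    proof (rule Lim_transform_eventually)
      show "(\<lambda>N. \<integral>\<omega>. 1 * ?Y N \<omega> * ?Y N \<omega> \<partial>M N) \<longlonglongrightarrow> c\<^sup>2"
        using weight_limit_at_0(2)[OF W2] by (simp add: power2_eq_square)
      show "\<forall>\<^sub>F N in sequentially. (\<integral>\<omega>. 1 * ?Y N \<omega> * ?Y N \<omega> \<partial>M N) = complex_of_real (\<integral>\<omega>. (X N \<omega>)\<^sup>2 \<partial>M N)"
        using ge1 by eventually_elim (simp add: Y power2_eq_square flip: of_real_mult)
    qed
  qed (use assms in auto)
  then show ?thesis unfolding c X_def lam_def .
qed

end
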